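(* Let $J$ be a non-infinitesimal interval of ${}^\bullet\mathbb{R}$ and let $f,g:J\to{}^\bullet\mathbb{R}$ be smooth functions. Let $a,b\in J$ with $a<b$. Then $$\left(\int_a^b fg\right)^2\le\left(\int_a^b f^2\right)\cdot\left(\int_a^b g^2\right).$$
   Context: Fermat reals: let $\mathbb{R}_o[t]$ be the set of maps $x:\mathbb{R}_{\ge0}\to\mathbb{R}$, $t\mapsto x_t$, of the form $x_t=r+\sum_{i=1}^k\alpha_i t^{a_i}+o(t)$ as $t\to0^+$, with $k\in\mathbb{N}$, $r,\alpha_i\in\mathbb{R}$, $a_i\in\mathbb{R}_{\ge0}$. Write $x\sim y$ iff $x_t=y_t+o(t)$ as $t\to0^+$. The ring of Fermat reals is ${}^\bullet\mathbb{R}:=\mathbb{R}_o[t]/\sim$ with pointwise operations; $\mathbb{R}\subseteq{}^\bullet\mathbb{R}$ via constants. The standard part of $x=[x_t]$ is ${}^\circ x:=x_0$. ${}^\bullet\mathbb{R}$ is totally ordered by: $x\le y$ iff for representatives there is $z\in\mathbb{R}_o[t]$ with $z\sim0$ and $x_t\le y_t+z_t$ for all small $t\ge0$. $\overline{{}^\bullet\mathbb{R}}:={}^\bullet\mathbb{R}\cup\{\pm\infty\}$, ${}^\circ(\pm\infty):=\pm\infty$. An interval is a set $[a,b],(a,b),[a,b),(a,b]$ of points of ${}^\bullet\mathbb{R}$ with $a\le b$ in $\overline{{}^\bullet\mathbb{R}}$; non-infinitesimal if ${}^\circ a<{}^\circ b$. The Fermat topology on ${}^\bullet\mathbb{R}^n$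 has open sets ${}^\bullet V:=\{x:{}^\circ x\in V\}$, $V\subseteq\mathbb{R}^n$ open. For $\alpha\in C^\infty(W,\mathbb{R}^m)$, $W\subseteq\mathbb{R}^d$ open, ${}^\bullet\alpha([x_t]):=[\alpha(x_t)]$. A map $f:S\to{}^\bullet\mathbb{R}^m$, $S\subseteq{}^\bullet\mathbb{R}^n$, is smooth if for every $x\in S$ there exist open $V\subseteq\mathbb{R}^n$ with $x\in{}^\bullet V$, open $P\subseteq\mathbb{R}^{\mathsf p}$, $p\in{}^\bullet P$, $\alpha\in C^\infty(P\times V,\mathbb{R}^m)$ with $f(y)={}^\bullet\alpha(p,y)$ for $y\in{}^\bullet V\cap S$. For $g$ smooth on a non-infinitesimal interval $J$ and $x\in J$, $g'(x):={}^\bullet(\partial_2\alpha)(p,x)$ for any local representation of $g$ around $x$ (independent of it). Integral: for a non-infinitesimal interval $J$, smooth $f:J\to{}^\bullet\mathbb{R}$ and $u\in J$, $\int_u^{(-)}f$ is the unique smooth $I:J\to{}^\bullet\mathbb{R}$ with $I(u)=0$ and $I'(x)=f(x)$ for all $x\in J$, and $\int_u^v f:=I(v)$ for $v\in J$. *)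

theory Defs
  imports "HOL-Analysis.Analysis"
begin

text \<open>Maps x : R_{\<ge>0} \<rightarrow> R are represented by total functions real \<Rightarrow> real;
  values at negative t are irrelevant for every notion below.
  h = o(t) (as t \<rightarrow> 0+) is read on the closed half-line [0,\<delta>), i.e. |h t| \<le> \<epsilon> t
  for all small t \<ge> 0 (in particular h 0 = 0); this makes the standard part
  well defined, as the paper requires.\<close>

definition small_o :: "(real \<Rightarrow> real) \<Rightarrow> bool" where
  "small_o h \<longleftrightarrow> (\<forall>\<epsilon>>0. \<exists>\<delta>>0. \<forall>t. 0 \<le> t \<and> t < \<delta> \<longrightarrow> \<bar>h t\<bar> \<le> \<epsilon> * t)"

definition pw :: "real \<Rightarrow> real \<Rightarrow> real" where
  "pw t a = (if a = 0 then 1 else t powr a)"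

definition Ro :: "(real \<Rightarrow> real) set" where
  "Ro = {x. \<exists>(r::real) (k::nat) (\<alpha>::nat \<Rightarrow> real) (a::nat \<Rightarrow> real).
           (\<forall>i<k. 0 \<le> a i) \<and>
           small_o (\<lambda>t. x t - (r + (\<Sum>i<k. \<alpha> i * pw t (a i))))}"

definition fsim :: "(real \<Rightarrow> real) \<Rightarrow> (real \<Rightarrow> real) \<Rightarrow> bool" where
  "fsim x y \<longleftrightarrow> small_o (\<lambda>t. x t - y t)"

typedef fermat = "{A. \<exists>x\<in>Ro. A = {y\<in>Ro. fsim x y}}"
proof -
  have "(\<lambda>t. 0::real) \<in> Ro"
    unfolding Ro_def small_o_def
    by (rule CollectI, rule exI[of _ 0], rule exI[of _ 0]) auto
  then show ?thesis by blast
qed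

definition rep :: "fermat \<Rightarrow> (real \<Rightarrow> real)" where
  "rep x = (SOME r. r \<in> Rep_fermat x)"

definition cls :: "(real \<Rightarrow> real) \<Rightarrow> fermat" where
  "cls r = Abs_fermat {y\<in>Ro. fsim r y}"

instantiation fermat :: "{zero, one, plus, times, power, ord}"
begin
definition zero_fermat_def: "0 = cls (\<lambda>t. 0)"
definition one_fermat_def: "1 = cls (\<lambda>t. 1)"
definition plus_fermat_def: "x + y = cls (\<lambda>t. rep x t + rep y t)"
definition times_fermat_def: "x * y = cls (\<lambda>t. rep x t * rep y t)"
definition less_eq_fermat_def:
  "x \<le> y \<longleftrightarrow> (\<exists>xr\<in>Rep_fermat x. \<exists>yr\<in>Rep_fermat y. \<exists>z\<in>Ro. fsim z (\<lambda>t. 0) \<and>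
       (\<exists>\<delta>>0. \<forall>t. 0 \<le> t \<and> t < \<delta> \<longrightarrow> xr t \<le> yr t + z t))"
definition less_fermat_def: "(x::fermat) < y \<longleftrightarrow> x \<le> y \<and> x \<noteq> y"
instance ..
end

definition st :: "fermat \<Rightarrow> real" where
  "st x = rep x 0"

datatype efermat = Fin fermat | PInf | MInf

fun ele :: "efermat \<Rightarrow> efermat \<Rightarrow> bool" where
  "ele MInf _ = True"
| "ele _ PInf = True"
| "ele (Fin x) (Fin y) = (x \<le> y)"
| "ele _ _ = False"

definition elt :: "efermat \<Rightarrow> efermat \<Rightarrow> bool" where
  "elt a b \<longleftrightarrow> ele a b \<and> a \<noteq> b"

fun est :: "efermat \<Rightarrow> ereal" where
  "est (Fin x) = ereal (st x)"
| "est PInf = \<infinity>"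
| "est MInf = -\<infinity>"

definition noninf_interval :: "fermat set \<Rightarrow> bool" where
  "noninf_interval J \<longleftrightarrow> (\<exists>a b. ele a b \<and> est a < est b \<and>
     (J = {x. ele a (Fin x) \<and> ele (Fin x) b} \<or>
      J = {x. elt a (Fin x) \<and> elt (Fin x) b} \<or>
      J = {x. ele a (Fin x) \<and> elt (Fin x) b} \<or>
      J = {x. elt a (Fin x) \<and> ele (Fin x) b}))"

text \<open>R^N is encoded as the functions nat \<Rightarrow> real vanishing at coordinates \<ge> N,
  with the product topology (= Euclidean topology on this subspace).\<close>

definition emb :: "nat \<Rightarrow> (nat \<Rightarrow> real) set" where
  "emb N = {z. \<forall>i\<ge>N. z i = 0}"

definition openR :: "nat \<Rightarrow> (nat \<Rightarrow> real) set \<Rightarrow> bool" where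
  "openR N U \<longleftrightarrow> (\<exists>W. open W \<and> U = W \<inter> emb N)"

definition pdiff :: "nat \<Rightarrow> ((nat \<Rightarrow> real) \<Rightarrow> real) \<Rightarrow> (nat \<Rightarrow> real) \<Rightarrow> real" where
  "pdiff i \<alpha> z = deriv (\<lambda>s. \<alpha> (z(i := z i + s))) 0"

fun Ck :: "nat \<Rightarrow> nat \<Rightarrow> (nat \<Rightarrow> real) set \<Rightarrow> ((nat \<Rightarrow> real) \<Rightarrow> real) \<Rightarrow> bool" where
  "Ck N 0 U \<alpha> = continuous_on U \<alpha>"
| "Ck N (Suc k) U \<alpha> = (continuous_on U \<alpha> \<and>
      (\<forall>i<N. \<forall>z\<in>U. (\<lambda>s. \<alpha> (z(i := z i + s))) differentiable (at 0)) \<and>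
      (\<forall>i<N. Ck N k U (pdiff i \<alpha>)))"

definition Cinf :: "nat \<Rightarrow> (nat \<Rightarrow> real) set \<Rightarrow> ((nat \<Rightarrow> real) \<Rightarrow> real) \<Rightarrow> bool" where
  "Cinf N U \<alpha> \<longleftrightarrow> (\<forall>k. Ck N k U \<alpha>)"

definition prodset :: "nat \<Rightarrow> (nat \<Rightarrow> real) set \<Rightarrow> real set \<Rightarrow> (nat \<Rightarrow> real) set" where
  "prodset d P V = {z \<in> emb (Suc d). (\<lambda>i. if i < d then z i else 0) \<in> P \<and> z d \<in> V}"

text \<open>A point p of the Fermat reals^d is a map nat \<Rightarrow> fermat (coordinates \<ge> d ignored).\<close>
definition stv :: "nat \<Rightarrow> (nat \<Rightarrow> fermat) \<Rightarrow> (nat \<Rightarrow> real)" where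
  "stv d p = (\<lambda>i. if i < d then st (p i) else 0)"

definition ext_fun :: "nat \<Rightarrow> ((nat \<Rightarrow> real) \<Rightarrow> real) \<Rightarrow> (nat \<Rightarrow> fermat) \<Rightarrow> fermat \<Rightarrow> fermat" where
  "ext_fun d \<alpha> p y = cls (\<lambda>t. \<alpha> (\<lambda>i. if i < d then rep (p i) t else if i = d then rep y t else 0))"

definition local_rep ::
  "fermat set \<Rightarrow> (fermat \<Rightarrow> fermat) \<Rightarrow> fermat \<Rightarrow> real set \<Rightarrow> nat \<Rightarrow> (nat \<Rightarrow> real) set
     \<Rightarrow> (nat \<Rightarrow> fermat) \<Rightarrow> ((nat \<Rightarrow> real) \<Rightarrow> real) \<Rightarrow> bool" where
  "local_rep S f x V d P p \<alpha> \<longleftrightarrow>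
     open V \<and> st x \<in> V \<and> P \<subseteq> emb d \<and> openR d P \<and> stv d p \<in> P \<and>
     Cinf (Suc d) (prodset d P V) \<alpha> \<and>
     (\<forall>y\<in>S. st y \<in> V \<longrightarrow> f y = ext_fun d \<alpha> p y)"

definition fsmooth :: "fermat set \<Rightarrow> (fermat \<Rightarrow> fermat) \<Rightarrow> bool" where
  "fsmooth S f \<longleftrightarrow> (\<forall>x\<in>S. \<exists>V d P p \<alpha>. local_rep S f x V d P p \<alpha>)"

definition fr_deriv :: "fermat set \<Rightarrow> (fermat \<Rightarrow> fermat) \<Rightarrow> fermat \<Rightarrow> fermat" where
  "fr_deriv S g x = (SOME v. \<exists>V d P p \<alpha>. local_rep S g x V d P p \<alpha> \<and>
                          v = ext_fun d (pdiff d \<alpha>) p x)"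

text \<open>Integral: I is the unique smooth map on J with I(u) = 0 and I' = f on J
  (normalised to 0 outside J so that it is unique as a HOL function).\<close>
definition fintegral :: "fermat set \<Rightarrow> (fermat \<Rightarrow> fermat) \<Rightarrow> fermat \<Rightarrow> fermat \<Rightarrow> fermat" where
  "fintegral J f u v = (THE I. fsmooth J I \<and> I u = 0 \<and> (\<forall>x\<in>J. fr_deriv J I x = f x)
                               \<and> (\<forall>x. x \<notin> J \<longrightarrow> I x = 0)) v"

end

theory Submission
  imports Defs "HOL-Library.Landau_Symbols"
begin

text \<open>
  The integrals are computed at the level of representatives. By Taylor expansion in the
  infinitesimal parts of the parameters, a smooth function is locally of the form
  \<open>y \<mapsto> [\<Sum>q. c q (y t) * t powr q]\<close> with finitely many exponents and smooth coefficients of one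
  real variable. The coefficients with \<open>q \<le> 1\<close> are determined by the function on the real points
  of the interval, and at its end points by flatness; hence derivatives are well defined, local
  forms can be glued along compact pieces, and integration acts coefficientwise. The integrals of
  \<open>f g\<close>, \<open>f\<^sup>2\<close> and \<open>g\<^sup>2\<close> over \<open>[a, b]\<close> are then represented by classical integrals over
  \<open>[a t, b t]\<close>, and the classical Cauchy-Schwarz inequality applies for each small \<open>t\<close>.
\<close>

text \<open>Expansions stop after finitely many terms because an increment \<open>x t - x 0\<close>
  of a little-oh polynomial is O(t^\<gamma>) for some \<gamma> > 0, so that one of its powers is
  o(t). The main obstacle is that a congruence modulo o(t) can be neither differentiated nor
  integrated in y. Local forms are therefore exact sums, and the remainders in their construction
  are kept uniform on compact sets. A second obstacle: a and b may have the same standard part,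
  which may moreover be an end point of J, so the integral cannot be read off real points between a
  and b. The integral is also specified as the unique function on all of J, whereas a local form
  covers only a window; primitives are thus compared through windows that reach from the base point
  to the point in question. Finally, the order compares representatives only up to some z congruent
  to 0. Absorbing z into the representative of b orients the classical interval correctly for each
  small t.\<close>

section \<open>Congruence modulo o(t) near t = 0\<close>

text \<open>
  Unlike \<open>at_right 0\<close>, this filter contains the point \<open>0\<close>, since \<^const>\<open>small_o\<close> forces \<open>h 0 = 0\<close>.
\<close>

definition germ0 :: "real filter" where
  "germ0 = inf (nhds 0) (principal {0..})"

lemma eventually_germ0:
  "eventually P germ0 \<longleftrightarrow> (\<exists>\<delta>>0. \<forall>t. 0 \<le> t \<and> t < \<delta> \<longrightarrow> P t)"
proof -
  have "eventually P germ0 \<longleftrightarrow> (\<exists>d>0. \<forall>t. dist t 0 < d \<longrightarrow> t \<in> {0..} \<longrightarrow> P t)"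
    by (simp add: germ0_def eventually_inf_principal eventually_nhds_metric)
  also have "\<dots> \<longleftrightarrow> (\<exists>\<delta>>0. \<forall>t. 0 \<le> t \<and> t < \<delta> \<longrightarrow> P t)"
    by (intro ex_cong1 conj_cong refl) (auto simp: dist_real_def)
  finally show ?thesis .
qed

lemma eventually_germ0_nonneg: "eventually (\<lambda>t. 0 \<le> t) germ0"
  by (auto simp: eventually_germ0 intro: exI[of _ 1])

lemma eventually_germ0_at_0: "eventually P germ0 \<Longrightarrow> P 0"
  by (auto simp: eventually_germ0)

lemma tendsto_germ0: "((\<lambda>t. t) \<longlongrightarrow> 0) germ0"
  unfolding germ0_def by (rule filterlim_mono[OF filterlim_ident]) auto

lemma small_o_iff: "small_o h \<longleftrightarrow> h \<in> o[germ0](\<lambda>t. t)"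
proof -
  have "h \<in> o[germ0](\<lambda>t. t) \<longleftrightarrow> (\<forall>c>0. eventually (\<lambda>t. \<bar>h t\<bar> \<le> c * \<bar>t\<bar>) germ0)"
    by (simp add: smallo_def)
  also have "\<dots> \<longleftrightarrow> (\<forall>c>0. eventually (\<lambda>t. \<bar>h t\<bar> \<le> c * t) germ0)"
    using eventually_germ0_nonneg
    by (intro all_cong1 imp_cong refl eventually_cong[where F = germ0]) (auto elim: eventually_mono)
  finally show ?thesis by (simp add: small_o_def eventually_germ0)
qed

lemma fsim_iff: "fsim x y \<longleftrightarrow> (\<lambda>t. x t - y t) \<in> o[germ0](\<lambda>t. t)"
  by (simp add: fsim_def small_o_iff)

lemma fsim_refl [simp]: "fsim x x"
  by (simp add: fsim_iff)

lemma fsim_sym: "fsim x y \<Longrightarrow> fsim y x"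
  unfolding fsim_iff by (subst landau_o.small.uminus_in_iff[symmetric]) simp

lemma fsim_trans [trans]:
  assumes "fsim x y" "fsim y z" shows "fsim x z"
  using sum_in_smallo(1)[OF assms[unfolded fsim_iff]] by (simp add: fsim_iff)

lemma fsim_add:
  assumes "fsim x y" "fsim x' y'"
  shows "fsim (\<lambda>t. x t + x' t) (\<lambda>t. y t + y' t)"
  using sum_in_smallo(1)[OF assms[unfolded fsim_iff]]
  by (simp add: fsim_iff algebra_simps)

lemma fsim_diff:
  assumes "fsim x y" "fsim x' y'"
  shows "fsim (\<lambda>t. x t - x' t) (\<lambda>t. y t - y' t)"
  using sum_in_smallo(2)[OF assms[unfolded fsim_iff]]
  by (simp add: fsim_iff algebra_simps)

lemma fsim_sum:
  assumes "\<And>i. i \<in> I \<Longrightarrow> fsim (x i) (y i)"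
  shows "fsim (\<lambda>t. \<Sum>i\<in>I. x i t) (\<lambda>t. \<Sum>i\<in>I. y i t)"
  using big_sum_in_smallo[of I "\<lambda>i t. x i t - y i t" germ0 "\<lambda>t. t"] assms
  by (simp add: fsim_iff sum_subtractf)

lemma smallo_bounded_mult:
  assumes "f \<in> o[F](g)" "h \<in> O[F](\<lambda>_. 1::real)"
  shows "(\<lambda>t. h t * f t :: real) \<in> o[F](g)"
  using landau_o.big_small_mult[OF assms(2,1)] by simp

text \<open>From \<open>x * x' - y * y' = x * (x' - y') + y' * (x - y)\<close>: only the two factors
  that multiply a difference have to be bounded.\<close>

lemma fsim_mult:
  assumes "fsim x y" "fsim x' y'"
    and "x \<in> O[germ0](\<lambda>_. 1)" "y' \<in> O[germ0](\<lambda>_. 1)"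
  shows "fsim (\<lambda>t. x t * x' t) (\<lambda>t. y t * y' t)"
proof -
  have "(\<lambda>t. x t * (x' t - y' t) + y' t * (x t - y t)) \<in> o[germ0](\<lambda>t. t)"
    by (intro sum_in_smallo(1) smallo_bounded_mult assms[unfolded fsim_iff])
  then show ?thesis by (simp add: fsim_iff algebra_simps)
qed

text \<open>The o(t) bound includes t = 0, where it forces equality; this makes the standard part
  independent of the representative.\<close>

lemma fsim_at_0:
  assumes "fsim x y" shows "x 0 = y 0"
proof -
  have "\<exists>\<delta>>0. \<forall>t. 0 \<le> t \<and> t < \<delta> \<longrightarrow> \<bar>x t - y t\<bar> \<le> 1 * t"
    using assms zero_less_one unfolding fsim_def small_o_def by blast
  then show ?thesis by auto
qed

lemma fsim_eventually_eq: "eventually (\<lambda>t. x t = y t) germ0 \<Longrightarrow> fsim x y"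
  unfolding fsim_iff by (subst landau_o.small.in_cong[where g = "\<lambda>_. 0"]) (auto elim: eventually_mono)

lemma smallo_id_imp_bounded: "h \<in> o[germ0](\<lambda>t. t) \<Longrightarrow> h \<in> O[germ0](\<lambda>_. 1::real)"
proof -
  assume h: "h \<in> o[germ0](\<lambda>t. t)"
  have "(\<lambda>t. t) \<in> O[germ0](\<lambda>_. 1::real)"
    by (intro bigoI_tendsto[where c = 0]) (use tendsto_germ0 in auto)
  with h show ?thesis by (meson landau_o.small_imp_big landau_o.big_trans)
qed

lemma fsim_bounded:
  assumes "fsim x y" "y \<in> O[germ0](\<lambda>_. 1)" shows "x \<in> O[germ0](\<lambda>_. 1)"
  using sum_in_bigo(1)[OF smallo_id_imp_bounded[OF assms(1)[unfolded fsim_iff]] assms(2)] by simp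


section \<open>Real powers\<close>

lemma pw_0 [simp]: "pw t 0 = 1"
  by (simp add: pw_def)

lemma pw_pos: "t > 0 \<Longrightarrow> pw t a > 0"
  by (simp add: pw_def)

lemma pw_add: "0 \<le> a \<Longrightarrow> 0 \<le> b \<Longrightarrow> pw t (a + b) = pw t a * pw t b"
  by (auto simp: pw_def powr_add)

lemma pw_tendsto_0: "a > 0 \<Longrightarrow> ((\<lambda>t. pw t a) \<longlongrightarrow> 0) germ0"
  using tendsto_powr'[OF tendsto_germ0 tendsto_const[of a]] eventually_germ0_nonneg
  by (simp add: pw_def)

lemma pw_smallo_1: "a > 0 \<Longrightarrow> (\<lambda>t. pw t a) \<in> o[germ0](\<lambda>_. 1)"
  by (intro smalloI_tendsto) (use pw_tendsto_0 in auto)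

lemma pw_smallo:
  assumes "0 \<le> a" "a < b" shows "(\<lambda>t. pw t b) \<in> o[germ0](\<lambda>t. pw t a)"
proof -
  have "(\<lambda>t. pw t (b - a) * pw t a) \<in> o[germ0](\<lambda>t. 1 * pw t a)"
    using assms by (intro landau_o.small_big_mult pw_smallo_1) auto
  then show ?thesis using assms by (simp flip: pw_add)
qed

lemma pw_bigo:
  assumes "0 \<le> a" "a \<le> b" shows "(\<lambda>t. pw t b) \<in> O[germ0](\<lambda>t. pw t a)"
  using pw_smallo[of a b] assms by (cases "a = b") (auto intro: landau_o.small_imp_big)

lemma pw_bounded: "0 \<le> a \<Longrightarrow> (\<lambda>t. pw t a) \<in> O[germ0](\<lambda>_. 1)"
  using pw_bigo[of 0 a] by simp

lemma germ0_pw_1: "o[germ0](\<lambda>t. t) = o[germ0](\<lambda>t. pw t 1)"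
  by (rule landau_o.small.cong) (use eventually_germ0_nonneg in \<open>auto simp: pw_def elim: eventually_mono\<close>)

lemma pw_smallo_id: "a > 1 \<Longrightarrow> (\<lambda>t. pw t a) \<in> o[germ0](\<lambda>t. t)"
  unfolding germ0_pw_1 by (rule pw_smallo) auto

lemma pw_power: "0 \<le> a \<Longrightarrow> pw t a ^ n = pw t (real n * a)"
proof (induction n)
  case (Suc n)
  then show ?case using pw_add[of a "real n * a" t] by (simp add: algebra_simps)
qed simp

lemma pw_not_smallo_self: "(\<lambda>t. pw t a) \<notin> o[germ0](\<lambda>t. pw t a)"
proof
  assume "(\<lambda>t. pw t a) \<in> o[germ0](\<lambda>t. pw t a)"
  then have "eventually (\<lambda>t. \<bar>pw t a\<bar> \<le> 1/2 * \<bar>pw t a\<bar>) germ0"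
    using landau_o.smallD[of "\<lambda>t. pw t a" germ0 "\<lambda>t. pw t a" "1/2"] by auto
  then obtain d where "d > 0" "\<And>t. 0 \<le> t \<and> t < d \<Longrightarrow> \<bar>pw t a\<bar> \<le> 1/2 * \<bar>pw t a\<bar>"
    by (auto simp: eventually_germ0)
  from this(2)[of "d/2"] pw_pos[of "d/2" a] \<open>d > 0\<close> show False by simp
qed

text \<open>Real powers with exponents up to 1 are linearly independent modulo o(t): among the terms
  with nonzero coefficient, the one with the least exponent dominates the others. Above exponent 1
  nothing follows, because such terms are themselves o(t).\<close>

lemma pw_sum_smallo_imp_coeff_0:
  assumes fin: "finite E" and nn: "\<And>q. q \<in> E \<Longrightarrow> 0 \<le> q"
    and small: "(\<lambda>t. \<Sum>q\<in>E. w q * pw t q) \<in> o[germ0](\<lambda>t. t)"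
    and q: "q \<in> E" "q \<le> 1"
  shows "w q = 0"
proof (rule ccontr)
  assume "w q \<noteq> 0"
  define E' where "E' = {q\<in>E. w q \<noteq> 0}"
  \<comment> \<open>The least exponent with nonzero coefficient; \<open>m \<le> q \<le> 1\<close>
    puts o(t) inside o(t^m).\<close>
  define m where "m = Min E'"
  have E': "finite E'" "q \<in> E'" using fin q \<open>w q \<noteq> 0\<close> by (auto simp: E'_def)
  then have m: "m \<in> E'" "m \<le> q" unfolding m_def using Min_in[of E'] Min_le[of E' q] by blast+
  then have m0: "0 \<le> m" "m \<le> 1" "w m \<noteq> 0" using nn q by (auto simp: E'_def)
  have "(\<lambda>t. \<Sum>q\<in>E. w q * pw t q) \<in> o[germ0](\<lambda>t. pw t m)"
    using small landau_o.small_big_trans[OF _ pw_bigo[OF m0(1,2)]] unfolding germ0_pw_1 by blast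
  moreover have "(\<Sum>q\<in>E. w q * pw t q) = w m * pw t m + (\<Sum>q\<in>E' - {m}. w q * pw t q)" for t
  proof -
    have "(\<Sum>q\<in>E. w q * pw t q) = (\<Sum>q\<in>E'. w q * pw t q)"
      unfolding E'_def by (rule sum.mono_neutral_right) (use fin in auto)
    with m E' show ?thesis by (simp add: sum.remove)
  qed
  ultimately have "(\<lambda>t. w m * pw t m + (\<Sum>q\<in>E' - {m}. w q * pw t q)) \<in> o[germ0](\<lambda>t. pw t m)"
    by simp
  moreover have "(\<lambda>t. \<Sum>q\<in>E' - {m}. w q * pw t q) \<in> o[germ0](\<lambda>t. pw t m)"
  proof (rule big_sum_in_smallo)
    fix p assume "p \<in> E' - {m}"
    then have "m < p" using E' unfolding m_def by (simp add: order.not_eq_order_implies_strict)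
    then show "(\<lambda>t. w p * pw t p) \<in> o[germ0](\<lambda>t. pw t m)"
      using pw_smallo[OF m0(1)] by simp
  qed
  ultimately have "(\<lambda>t. w m * pw t m) \<in> o[germ0](\<lambda>t. pw t m)"
    using sum_in_smallo(2) by fastforce
  with m0 pw_not_smallo_self show False by simp
qed


section \<open>Smooth functions of one variable\<close>

definition smooth_on :: "real set \<Rightarrow> (real \<Rightarrow> real) \<Rightarrow> bool" where
  "smooth_on V c \<longleftrightarrow> (\<forall>n. \<forall>x\<in>V. (deriv ^^ n) c differentiable (at x))"

text \<open>Peels off the first derivative instead of the last one, so that the sum and product
  rules go by induction with the functions generalised.\<close>

fun differentiable_upto :: "nat \<Rightarrow> real set \<Rightarrow> (real \<Rightarrow> real) \<Rightarrow> bool" where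
  "differentiable_upto 0 V c \<longleftrightarrow> True"
| "differentiable_upto (Suc n) V c \<longleftrightarrow>
     (\<forall>x\<in>V. c differentiable (at x)) \<and> differentiable_upto n V (deriv c)"

lemma differentiable_upto_iff:
  "differentiable_upto n V c \<longleftrightarrow> (\<forall>m<n. \<forall>x\<in>V. (deriv ^^ m) c differentiable (at x))"
proof (induction n arbitrary: c)
  case (Suc n)
  show ?case
    unfolding differentiable_upto.simps Suc.IH All_less_Suc2 funpow_Suc_right by simp
qed simp

lemma smooth_on_upto: "smooth_on V c \<longleftrightarrow> (\<forall>n. differentiable_upto n V c)"
  unfolding smooth_on_def differentiable_upto_iff by auto

lemma smooth_on_differentiable: "smooth_on V c \<Longrightarrow> x \<in> V \<Longrightarrow> c differentiable (at x)"
  by (auto simp: smooth_on_def dest: spec[of _ 0])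

lemma smooth_on_deriv: "smooth_on V c \<Longrightarrow> smooth_on V (deriv c)"
  unfolding smooth_on_upto using differentiable_upto.simps(2) by blast

lemma smooth_on_iff_deriv:
  "smooth_on V c \<longleftrightarrow> (\<forall>x\<in>V. c differentiable (at x)) \<and> smooth_on V (deriv c)"
proof -
  have "smooth_on V c" if "\<forall>x\<in>V. c differentiable (at x)" "smooth_on V (deriv c)"
    unfolding smooth_on_upto
  proof
    show "differentiable_upto n V c" for n
      using that by (cases n) (auto simp: smooth_on_upto)
  qed
  then show ?thesis using smooth_on_deriv smooth_on_differentiable by blast
qed

lemma smooth_on_funpow_deriv: "smooth_on V c \<Longrightarrow> smooth_on V ((deriv ^^ n) c)"
  by (induction n) (auto intro: smooth_on_deriv)

lemma smooth_on_subset: "smooth_on V c \<Longrightarrow> W \<subseteq> V \<Longrightarrow> smooth_on W c"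
  unfolding smooth_on_def by blast

lemma smooth_on_DERIV:
  "smooth_on V c \<Longrightarrow> x \<in> V \<Longrightarrow> (c has_real_derivative deriv c x) (at x)"
  using smooth_on_differentiable by (simp add: DERIV_deriv_iff_real_differentiable)

lemma smooth_on_DERIV_funpow:
  "smooth_on V c \<Longrightarrow> x \<in> V \<Longrightarrow> ((deriv ^^ n) c has_real_derivative (deriv ^^ Suc n) c x) (at x)"
  using smooth_on_DERIV[OF smooth_on_funpow_deriv] by simp

lemma smooth_on_isCont: "smooth_on V c \<Longrightarrow> x \<in> V \<Longrightarrow> isCont c x"
  using DERIV_isCont smooth_on_DERIV by blast

lemma eventually_nhds_eq_on:
  "open V \<Longrightarrow> x \<in> V \<Longrightarrow> (\<And>y. y \<in> V \<Longrightarrow> c y = e y) \<Longrightarrow> eventually (\<lambda>y. c y = e y) (nhds x)"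
  by (auto intro: eventually_nhds_in_open[THEN eventually_mono])

lemma deriv_cong_on:
  "open V \<Longrightarrow> x \<in> V \<Longrightarrow> (\<And>y. y \<in> V \<Longrightarrow> c y = e y) \<Longrightarrow> deriv c x = deriv e (x::real)"
  by (rule deriv_cong_ev[OF eventually_nhds_eq_on]) auto

lemma differentiable_cong_on:
  fixes c e :: "real \<Rightarrow> real"
  assumes "open V" "x \<in> V" "\<And>y. y \<in> V \<Longrightarrow> c y = e y" "c differentiable (at x)"
  shows "e differentiable (at x)"
  using has_field_derivative_transform_within_open[of c _ x V e] assms
  unfolding real_differentiable_def by blast

lemma differentiable_upto_cong:
  assumes V: "open V"
  shows "(\<And>y. y \<in> V \<Longrightarrow> c y = e y) \<Longrightarrow> differentiable_upto n V c \<Longrightarrow> differentiable_upto n V e"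
proof (induction n arbitrary: c e)
  case (Suc n)
  have c: "\<And>x. x \<in> V \<Longrightarrow> c differentiable (at x)" "differentiable_upto n V (deriv c)"
    using Suc.prems(2) by simp_all
  have "differentiable_upto n V (deriv e)"
    by (rule Suc.IH[OF deriv_cong_on[OF V] c(2)]) (use Suc.prems(1) in blast)+
  moreover have "e differentiable (at x)" if "x \<in> V" for x
    by (rule differentiable_cong_on[OF V that Suc.prems(1) c(1)[OF that]])
  ultimately show ?case by simp
qed simp

lemma smooth_on_cong:
  "open V \<Longrightarrow> (\<And>y. y \<in> V \<Longrightarrow> c y = e y) \<Longrightarrow> smooth_on V c \<Longrightarrow> smooth_on V e"
  unfolding smooth_on_upto using differentiable_upto_cong by blast

lemma smooth_on_const: "smooth_on V (\<lambda>_. k)"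
proof -
  have "\<exists>k'. (deriv ^^ n) (\<lambda>_::real. k::real) = (\<lambda>_. k')" for n
    by (induction n) auto
  then show ?thesis unfolding smooth_on_def by (metis differentiable_const)
qed

lemma differentiable_upto_add:
  "open V \<Longrightarrow> differentiable_upto n V c \<Longrightarrow> differentiable_upto n V e \<Longrightarrow>
    differentiable_upto n V (\<lambda>x. c x + e x)"
proof (induction n arbitrary: c e)
  case (Suc n)
  have "differentiable_upto n V (\<lambda>x. deriv c x + deriv e x)"
    using Suc by simp
  then have "differentiable_upto n V (deriv (\<lambda>x. c x + e x))"
    by (rule differentiable_upto_cong[OF Suc.prems(1), rotated])
       (use Suc.prems in \<open>auto intro!: DERIV_imp_deriv[symmetric] DERIV_add
          simp: DERIV_deriv_iff_real_differentiable\<close>)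
  then show ?case using Suc.prems by simp
qed simp

lemma differentiable_upto_mono: "differentiable_upto (Suc n) V c \<Longrightarrow> differentiable_upto n V c"
  unfolding differentiable_upto_iff by auto

text \<open>The Leibniz terms contain \<open>c\<close> and \<open>e\<close> themselves next to their
  derivatives, so the order n + 1 of both is lowered to n before the induction hypothesis
  applies.\<close>

lemma differentiable_upto_mult:
  "open V \<Longrightarrow> differentiable_upto n V c \<Longrightarrow> differentiable_upto n V e \<Longrightarrow>
    differentiable_upto n V (\<lambda>x. c x * e x)"
proof (induction n arbitrary: c e)
  case (Suc n)
  have "differentiable_upto n V (\<lambda>x. deriv c x * e x + c x * deriv e x)"
    using Suc.prems differentiable_upto_mono[OF Suc.prems(2)] differentiable_upto_mono[OF Suc.prems(3)]
    by (intro differentiable_upto_add Suc.IH) auto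
  then have "differentiable_upto n V (deriv (\<lambda>x. c x * e x))"
    by (rule differentiable_upto_cong[OF Suc.prems(1), rotated])
       (use Suc.prems in \<open>auto intro!: DERIV_imp_deriv[symmetric] derivative_eq_intros
          simp: DERIV_deriv_iff_real_differentiable[symmetric]\<close>)
  then show ?case using Suc.prems by simp
qed simp

lemma smooth_on_add: "open V \<Longrightarrow> smooth_on V c \<Longrightarrow> smooth_on V e \<Longrightarrow> smooth_on V (\<lambda>x. c x + e x)"
  unfolding smooth_on_upto using differentiable_upto_add by blast

lemma smooth_on_mult: "open V \<Longrightarrow> smooth_on V c \<Longrightarrow> smooth_on V e \<Longrightarrow> smooth_on V (\<lambda>x. c x * e x)"
  unfolding smooth_on_upto using differentiable_upto_mult by blast

lemma smooth_on_local:
  assumes "\<And>x. x \<in> V \<Longrightarrow> \<exists>W e. open W \<and> x \<in> W \<and> smooth_on W e \<and> (\<forall>y\<in>W. c y = e y)"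
  shows "smooth_on V c"
proof -
  have "(deriv ^^ n) c differentiable (at x)" if "x \<in> V" for n x
  proof -
    obtain W e where "open W" "x \<in> W" "smooth_on W e" "\<forall>y\<in>W. c y = e y"
      using assms \<open>x \<in> V\<close> by blast
    then have "smooth_on W c" using smooth_on_cong[of W e c] by auto
    with \<open>x \<in> W\<close> show ?thesis by (auto simp: smooth_on_def)
  qed
  then show ?thesis by (auto simp: smooth_on_def)
qed

lemma smooth_on_antiderivative:
  assumes "smooth_on {l<..<u} c"
  obtains e where "smooth_on {l<..<u} e" "\<And>x. x \<in> {l<..<u} \<Longrightarrow> deriv e x = c x"
proof (cases "l < u")
  case True
  have "\<exists>F. \<forall>x::real. ereal l < x \<longrightarrow> x < ereal u \<longrightarrow> (F has_vector_derivative c x) (at x)"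
    by (rule einterval_antiderivative) (use True assms smooth_on_isCont in auto)
  then obtain e where e: "\<And>x. x \<in> {l<..<u} \<Longrightarrow> (e has_real_derivative c x) (at x)"
    by (auto simp: has_real_derivative_iff_has_vector_derivative)
  then have d: "\<And>x. x \<in> {l<..<u} \<Longrightarrow> deriv e x = c x" by (auto intro: DERIV_imp_deriv)
  have "smooth_on {l<..<u} (deriv e)"
    by (rule smooth_on_cong[OF _ _ assms]) (use d in auto)
  with e have "smooth_on {l<..<u} e"
    by (subst smooth_on_iff_deriv) (meson real_differentiable_def)
  with d show ?thesis using that by blast
next
  case False
  \<comment> \<open>The interval is empty, so any function serves.\<close>
  then show ?thesis using that[of c] by (auto simp: smooth_on_def)
qed


section \<open>Taylor expansion with infinitesimal increment\<close>

text \<open>The Lagrange remainder is O(h^n) because the n-th derivative is bounded along the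
  segment from 0 to h. The filter is arbitrary so that one statement serves pointwise and uniform
  expansions: \<open>\<omega>\<close> stands for t or for a pair (t, y).\<close>

lemma taylor_bigo:
  fixes D :: "nat \<Rightarrow> 'a \<Rightarrow> real \<Rightarrow> real" and h :: "'a \<Rightarrow> real"
  assumes n: "n > 0"
    and ev: "eventually (\<lambda>\<omega>. \<forall>s. \<bar>s\<bar> \<le> \<bar>h \<omega>\<bar> \<longrightarrow>
        (\<forall>m<n. (D m \<omega> has_real_derivative D (Suc m) \<omega> s) (at s)) \<and> \<bar>D n \<omega> s\<bar> \<le> M) G"
  shows "(\<lambda>\<omega>. D 0 \<omega> (h \<omega>) - (\<Sum>m<n. D m \<omega> 0 / fact m * h \<omega> ^ m)) \<in> O[G](\<lambda>\<omega>. h \<omega> ^ n)"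
proof (rule bigoI[of _ "M / fact n"])
  show "\<forall>\<^sub>F \<omega> in G. norm (D 0 \<omega> (h \<omega>) - (\<Sum>m<n. D m \<omega> 0 / fact m * h \<omega> ^ m))
          \<le> M / fact n * norm (h \<omega> ^ n)"
    using ev
  proof eventually_elim
    case (elim \<omega>)
    define k where "k = \<bar>h \<omega>\<bar>"
    show ?case
    proof (cases "h \<omega> = 0")
      case True
      \<comment> \<open>Taylor's theorem has no intermediate point when h = 0; here only the term m
        = 0 survives, by 0^0 = 1.\<close>
      have "(\<Sum>m<n. D m \<omega> 0 / fact m * h \<omega> ^ m) = D 0 \<omega> 0"
        using n True by (subst sum.remove[of _ 0]) (auto intro: sum.neutral)
      then show ?thesis using True n by (simp add: zero_power)
    next
      case False
      have "\<exists>s. (if h \<omega> < 0 then h \<omega> < s \<and> s < 0 else 0 < s \<and> s < h \<omega>) \<and>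
          D 0 \<omega> (h \<omega>) = (\<Sum>m<n. D m \<omega> 0 / fact m * (h \<omega> - 0) ^ m) +
             D n \<omega> s / fact n * (h \<omega> - 0) ^ n"
        by (rule Taylor[where a = "- k" and b = k])
           (use n False elim in \<open>auto simp: k_def abs_le_iff\<close>)
      then obtain s where s1: "if h \<omega> < 0 then h \<omega> < s \<and> s < 0 else 0 < s \<and> s < h \<omega>"
        and s2: "D 0 \<omega> (h \<omega>) = (\<Sum>m<n. D m \<omega> 0 / fact m * h \<omega> ^ m) + D n \<omega> s / fact n * h \<omega> ^ n"
        unfolding diff_0_right by blast
      have s: "\<bar>s\<bar> \<le> \<bar>h \<omega>\<bar>" using s1 by (simp split: if_splits)
      have "\<bar>D n \<omega> s\<bar> \<le> M" using elim s by blast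
      then have "\<bar>D n \<omega> s\<bar> / fact n * \<bar>h \<omega> ^ n\<bar> \<le> M / fact n * \<bar>h \<omega> ^ n\<bar>"
        by (intro mult_right_mono divide_right_mono) auto
      then show ?thesis by (simp add: s2 abs_mult)
    qed
  qed
qed

lemma power_smallo_id:
  assumes "h \<in> O[germ0](\<lambda>t. pw t \<gamma>)" "\<gamma> > 0" "real n * \<gamma> > 1"
  shows "(\<lambda>t. h t ^ n) \<in> o[germ0](\<lambda>t. t)"
proof -
  have "(\<lambda>t. h t ^ n) \<in> O[germ0](\<lambda>t. pw t \<gamma> ^ n)"
    by (rule landau_o.big_power) fact
  also have "(\<lambda>t. pw t \<gamma> ^ n) \<in> o[germ0](\<lambda>t. t)"
    using assms pw_smallo_id by (simp add: pw_power)
  finally show ?thesis .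
qed

text \<open>A rate t^\<gamma> is demanded because mere convergence to 0 would not make any power
  o(t), as -1 / ln t shows.\<close>

definition infinitesimal :: "(real \<Rightarrow> real) \<Rightarrow> bool" where
  "infinitesimal h \<longleftrightarrow> (\<exists>\<gamma>>0. h \<in> O[germ0](\<lambda>t. pw t \<gamma>))"

lemma infinitesimal_tendsto: "infinitesimal h \<Longrightarrow> (h \<longlongrightarrow> 0) germ0"
proof -
  assume "infinitesimal h"
  then obtain \<gamma> where "\<gamma> > 0" and h: "h \<in> O[germ0](\<lambda>t. pw t \<gamma>)" by (auto simp: infinitesimal_def)
  have "h \<in> o[germ0](\<lambda>_. 1)"
    by (rule landau_o.big_small_trans[OF h pw_smallo_1]) fact
  then show ?thesis using smalloD_tendsto by fastforce
qed

lemma infinitesimal_nilpotent: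
  assumes "infinitesimal h"
  obtains n where "n > 0" "(\<lambda>t. h t ^ n) \<in> o[germ0](\<lambda>t. t)"
proof -
  obtain \<gamma> where \<gamma>: "\<gamma> > 0" "h \<in> O[germ0](\<lambda>t. pw t \<gamma>)" using assms by (auto simp: infinitesimal_def)
  obtain n where n: "real n > 1 / \<gamma>" using reals_Archimedean2 by blast
  then have "real n > 0" using \<gamma>(1) by (meson less_trans zero_less_divide_1_iff)
  moreover have "real n * \<gamma> > 1" using n \<gamma> by (simp add: field_simps)
  ultimately show ?thesis using that[of n] power_smallo_id \<gamma> by auto
qed

text \<open>Since some power \<open>h t ^ n\<close> is o(t), the Taylor polynomial of degree below n
  represents \<open>c (x0 + h t)\<close> modulo o(t), without any analyticity.\<close>

lemma smooth_on_taylor: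
  assumes c: "smooth_on V c" and V: "open V" "x0 \<in> V" and h: "infinitesimal h"
  obtains n where "n > 0"
    "fsim (\<lambda>t. c (x0 + h t)) (\<lambda>t. \<Sum>m<n. (deriv ^^ m) c x0 / fact m * h t ^ m)"
proof -
  obtain n where n: "n > 0" "(\<lambda>t. h t ^ n) \<in> o[germ0](\<lambda>t. t)"
    using infinitesimal_nilpotent[OF h] .
  define D where "D m (t::real) s = (deriv ^^ m) c (x0 + s)" for m t s
  obtain e where e: "e > 0" "cball x0 e \<subseteq> V" using V open_contains_cball by blast
  have "continuous_on (cball x0 e) ((deriv ^^ n) c)"
    using e c by (intro continuous_at_imp_continuous_on ballI smooth_on_isCont smooth_on_funpow_deriv) auto
  then have "bounded ((deriv ^^ n) c ` cball x0 e)"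
    by (intro compact_imp_bounded compact_continuous_image compact_cball)
  then obtain M where M: "\<And>x. x \<in> cball x0 e \<Longrightarrow> \<bar>(deriv ^^ n) c x\<bar> \<le> M"
    unfolding bounded_iff real_norm_def by blast
  have "eventually (\<lambda>t. \<bar>h t\<bar> < e) germ0"
    using tendstoD[OF infinitesimal_tendsto[OF h] e(1)] by simp
  then have "eventually (\<lambda>t. \<forall>s. \<bar>s\<bar> \<le> \<bar>h t\<bar> \<longrightarrow>
      (\<forall>m<n. (D m t has_real_derivative D (Suc m) t s) (at s)) \<and> \<bar>D n t s\<bar> \<le> M) germ0"
  proof eventually_elim
    case (elim t)
    have "(D m t has_real_derivative D (Suc m) t s) (at s)" if "\<bar>s\<bar> \<le> \<bar>h t\<bar>" for m s
    proof -
      have "x0 + s \<in> cball x0 e" using that elim by (simp add: dist_real_def)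
      then have "x0 + s \<in> V" using e by blast
      then have "((deriv ^^ m) c has_real_derivative (deriv ^^ Suc m) c (x0 + s)) (at (x0 + s))"
        by (rule smooth_on_DERIV_funpow[OF c])
      then show ?thesis unfolding D_def DERIV_shift add.commute[of x0] .
    qed
    moreover have "\<bar>D n t s\<bar> \<le> M" if "\<bar>s\<bar> \<le> \<bar>h t\<bar>" for s
      unfolding D_def using that elim by (intro M) (auto simp: dist_real_def)
    ultimately show ?case by blast
  qed
  from landau_o.big_small_trans[OF taylor_bigo[OF n(1) this] n(2)] show ?thesis
    using that[OF n(1)] unfolding fsim_iff D_def by simp
qed


section \<open>Smooth families of real-exponent polynomials\<close>

text \<open>The sum is an exact equality for every t, and \<open>E\<close> does not depend on y;
  this lets differentiation and integration in y act coefficient by coefficient.\<close>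

definition pcoeffs :: "real set \<Rightarrow> (real \<Rightarrow> real \<Rightarrow> real) \<Rightarrow> real set \<Rightarrow> (real \<Rightarrow> real \<Rightarrow> real) \<Rightarrow> bool" where
  "pcoeffs V F E c \<longleftrightarrow> finite E \<and> (\<forall>q\<in>E. 0 \<le> q \<and> smooth_on V (c q)) \<and>
     (\<forall>t. \<forall>y\<in>V. F t y = (\<Sum>q\<in>E. c q y * pw t q))"

definition power_family :: "real set \<Rightarrow> (real \<Rightarrow> real \<Rightarrow> real) \<Rightarrow> bool" where
  "power_family V F \<longleftrightarrow> (\<exists>E c. pcoeffs V F E c)"

definition dy :: "(real \<Rightarrow> real \<Rightarrow> real) \<Rightarrow> real \<Rightarrow> real \<Rightarrow> real" where
  "dy F t y = deriv (F t) y"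

lemma pcoeffsD:
  assumes "pcoeffs V F E c"
  shows "finite E" "\<And>q. q \<in> E \<Longrightarrow> 0 \<le> q" "\<And>q. q \<in> E \<Longrightarrow> smooth_on V (c q)"
    "\<And>t y. y \<in> V \<Longrightarrow> F t y = (\<Sum>q\<in>E. c q y * pw t q)"
  using assms unfolding pcoeffs_def by blast+

lemma power_familyI:
  assumes "finite E" "\<And>q. q \<in> E \<Longrightarrow> 0 \<le> q" "\<And>q. q \<in> E \<Longrightarrow> smooth_on V (c q)"
    "\<And>t y. y \<in> V \<Longrightarrow> F t y = (\<Sum>q\<in>E. c q y * pw t q)"
  shows "power_family V F"
  unfolding power_family_def pcoeffs_def
  by (intro exI[of _ E] exI[of _ c] conjI ballI allI) (fact assms)+

lemma power_family_cong:
  assumes "power_family V F" and eq: "\<And>t y. y \<in> V \<Longrightarrow> G t y = F t y" shows "power_family V G"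
proof -
  obtain E c where Ec: "pcoeffs V F E c" using assms(1) unfolding power_family_def by blast
  note F = pcoeffsD[OF Ec]
  show ?thesis by (rule power_familyI[OF F(1-3) trans[OF eq F(4)]])
qed

lemma power_family_subset:
  assumes "power_family V F" "W \<subseteq> V" shows "power_family W F"
proof -
  obtain E c where Ec: "pcoeffs V F E c"
    using assms(1) unfolding power_family_def by blast
  note Fc = pcoeffsD[OF Ec]
  show ?thesis
    by (rule power_familyI[OF Fc(1,2) smooth_on_subset[OF Fc(3) assms(2)] Fc(4)]) (use assms(2) in blast)+
qed

lemma power_family_term: "0 \<le> q \<Longrightarrow> smooth_on V c \<Longrightarrow> power_family V (\<lambda>t y. c y * pw t q)"
  by (rule power_familyI[of "{q}" _ "\<lambda>_. c"]) auto

lemma power_family_smooth: "smooth_on V c \<Longrightarrow> power_family V (\<lambda>t. c)"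
  using power_family_term[of 0 V c] by simp

lemma power_family_const: "power_family V (\<lambda>t y. k)"
  by (rule power_family_smooth[OF smooth_on_const])

lemma power_family_add:
  assumes V: "open V" and F: "power_family V F" and G: "power_family V G"
  shows "power_family V (\<lambda>t y. F t y + G t y)"
proof -
  obtain E c where Ec: "pcoeffs V F E c"
    using F unfolding power_family_def by blast
  note F = pcoeffsD[OF Ec]
  obtain E' c' where Ec': "pcoeffs V G E' c'"
    using G unfolding power_family_def by blast
  note G = pcoeffsD[OF Ec']
  define d where "d q = (\<lambda>y. (if q \<in> E then c q y else 0) + (if q \<in> E' then c' q y else 0))" for q
  show ?thesis
  proof (rule power_familyI[of "E \<union> E'" _ d])
    show "finite (E \<union> E')" using F(1) G(1) by simp
    show "0 \<le> q" if "q \<in> E \<union> E'" for q using F(2) G(2) that by blast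
    have "smooth_on V (\<lambda>y. if q \<in> E then c q y else 0)" for q
      by (cases "q \<in> E") (simp_all add: F(3) smooth_on_const)
    moreover have "smooth_on V (\<lambda>y. if q \<in> E' then c' q y else 0)" for q
      by (cases "q \<in> E'") (simp_all add: G(3) smooth_on_const)
    ultimately show "smooth_on V (d q)" for q
      unfolding d_def by (intro smooth_on_add V)
    fix t y assume "y \<in> V"
    have "(\<Sum>q\<in>E. c q y * pw t q) = (\<Sum>q\<in>E\<union>E'. (if q \<in> E then c q y else 0) * pw t q)"
      by (rule sum.mono_neutral_cong_left) (use F(1) G(1) in simp_all)
    moreover have "(\<Sum>q\<in>E'. c' q y * pw t q) = (\<Sum>q\<in>E\<union>E'. (if q \<in> E' then c' q y else 0) * pw t q)"
      by (rule sum.mono_neutral_cong_left) (use F(1) G(1) in simp_all)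
    ultimately show "F t y + G t y = (\<Sum>q\<in>E\<union>E'. d q y * pw t q)"
      by (simp only: F(4)[OF \<open>y \<in> V\<close>] G(4)[OF \<open>y \<in> V\<close>] d_def distrib_right sum.distrib)
  qed
qed

lemma power_family_sum:
  assumes "open V" "\<And>i. i \<in> I \<Longrightarrow> power_family V (F i)"
  shows "power_family V (\<lambda>t y. \<Sum>i\<in>I. F i t y)"
  using assms(2)
proof (induction I rule: infinite_finite_induct)
  case (insert i I)
  then have "power_family V (\<lambda>t y. F i t y + (\<Sum>i\<in>I. F i t y))" by (intro power_family_add assms(1)) blast+
  with insert show ?case by simp
qed (simp_all add: power_family_const)

text \<open>Distinct pairs may have the same exponent \<open>p + q\<close>; the product is therefore
  assembled as a double sum of one-term families, whose addition collects equal exponents.\<close>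

lemma power_family_mult:
  assumes V: "open V" and F: "power_family V F" and G: "power_family V G"
  shows "power_family V (\<lambda>t y. F t y * G t y)"
proof -
  obtain E c where Ec: "pcoeffs V F E c"
    using F unfolding power_family_def by blast
  note F = pcoeffsD[OF Ec]
  obtain E' c' where Ec': "pcoeffs V G E' c'"
    using G unfolding power_family_def by blast
  note G = pcoeffsD[OF Ec']
  have "power_family V (\<lambda>t y. \<Sum>p\<in>E. \<Sum>q\<in>E'. (c p y * c' q y) * pw t (p + q))"
    by (intro power_family_sum power_family_term smooth_on_mult V F(3) G(3) add_nonneg_nonneg F(2) G(2))
  then show ?thesis
  proof (rule power_family_cong)
    fix t y assume "y \<in> V"
    show "F t y * G t y = (\<Sum>p\<in>E. \<Sum>q\<in>E'. (c p y * c' q y) * pw t (p + q))"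
      unfolding F(4)[OF \<open>y \<in> V\<close>] G(4)[OF \<open>y \<in> V\<close>] sum_product
      by (intro sum.cong refl) (simp add: pw_add F(2) G(2))
  qed
qed

lemma power_family_diff:
  assumes "open V" "power_family V F" "power_family V G"
  shows "power_family V (\<lambda>t y. F t y - G t y)"
  using power_family_add[OF assms(1,2) power_family_mult[OF assms(1) power_family_const[of _ "-1"] assms(3)]] by simp

lemma power_family_power: "open V \<Longrightarrow> power_family V F \<Longrightarrow> power_family V (\<lambda>t y. F t y ^ n)"
  by (induction n) (simp_all add: power_family_const power_family_mult)

text \<open>A family constant in y records that \<open>X\<close> is an exact finite sum of real
  powers of t; such an \<open>X\<close> can act as a factor over any V.\<close>

lemma power_family_param: "power_family UNIV (\<lambda>t y. X t) \<Longrightarrow> power_family V (\<lambda>t y. X t)"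
  using power_family_subset by blast

lemma power_family_DERIV_coeffs:
  assumes "finite E" "\<And>q. q \<in> E \<Longrightarrow> smooth_on V (c q)" "open V" "y \<in> V"
    "\<And>t y. y \<in> V \<Longrightarrow> F t y = (\<Sum>q\<in>E. c q y * pw t q)"
  shows "(F t has_real_derivative (\<Sum>q\<in>E. deriv (c q) y * pw t q)) (at y)"
proof -
  have "((\<lambda>y. \<Sum>q\<in>E. c q y * pw t q) has_real_derivative (\<Sum>q\<in>E. deriv (c q) y * pw t q)) (at y)"
    by (intro DERIV_sum DERIV_cmult_right smooth_on_DERIV[OF assms(2,4)])
  then show ?thesis
    by (rule has_field_derivative_transform_within_open[OF _ assms(3,4)]) (simp only: assms(5))
qed

lemma power_family_DERIV:
  assumes "power_family V F" "open V" "y \<in> V"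
  shows "(F t has_real_derivative dy F t y) (at y)"
proof -
  obtain E c where Ec: "pcoeffs V F E c"
    using assms(1) unfolding power_family_def by blast
  note F = pcoeffsD[OF Ec]
  from power_family_DERIV_coeffs[OF F(1,3) assms(2,3) F(4)] show ?thesis
    unfolding dy_def by (metis DERIV_imp_deriv)
qed

lemma dy_coeffs:
  assumes "finite E" "\<And>q. q \<in> E \<Longrightarrow> smooth_on V (c q)" "open V" "y \<in> V"
    "\<And>t y. y \<in> V \<Longrightarrow> F t y = (\<Sum>q\<in>E. c q y * pw t q)"
  shows "dy F t y = (\<Sum>q\<in>E. deriv (c q) y * pw t q)"
  unfolding dy_def by (rule DERIV_imp_deriv[OF power_family_DERIV_coeffs[OF assms]])

lemma pcoeffs_dy:
  assumes "pcoeffs V F E c" "open V" shows "pcoeffs V (dy F) E (\<lambda>q. deriv (c q))"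
proof -
  note F = pcoeffsD[OF assms(1)]
  have "dy F t y = (\<Sum>q\<in>E. deriv (c q) y * pw t q)" if "y \<in> V" for t y
    by (rule dy_coeffs[OF F(1,3) assms(2) that F(4)])
  then show ?thesis unfolding pcoeffs_def using F(1,2) smooth_on_deriv[OF F(3)] by simp
qed

lemma power_family_dy: "power_family V F \<Longrightarrow> open V \<Longrightarrow> power_family V (dy F)"
  unfolding power_family_def by (elim exE) (rule exI, rule exI, rule pcoeffs_dy)

lemma power_family_antiderivative:
  assumes "power_family {l<..<u} F"
  obtains \<Phi> where "power_family {l<..<u} \<Phi>" "\<And>t y. y \<in> {l<..<u} \<Longrightarrow> dy \<Phi> t y = F t y"
proof -
  let ?V = "{l<..<u}"
  obtain E c where Ec: "pcoeffs ?V F E c"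
    using assms(1) unfolding power_family_def by blast
  note F = pcoeffsD[OF Ec]
  have "\<forall>q\<in>E. \<exists>e. smooth_on ?V e \<and> (\<forall>y\<in>?V. deriv e y = c q y)"
    using smooth_on_antiderivative[OF F(3)] by metis
  then obtain e where e: "\<And>q. q \<in> E \<Longrightarrow> smooth_on ?V (e q)"
      "\<And>q y. q \<in> E \<Longrightarrow> y \<in> ?V \<Longrightarrow> deriv (e q) y = c q y"
    by metis
  define \<Phi> where "\<Phi> = (\<lambda>t y. \<Sum>q\<in>E. e q y * pw t q)"
  have 1: "power_family ?V \<Phi>" by (rule power_familyI[of E _ e, OF F(1,2) e(1)]) (simp_all add: \<Phi>_def)
  have 2: "dy \<Phi> t y = F t y" if "y \<in> ?V" for t y
  proof -
    have "dy \<Phi> t y = (\<Sum>q\<in>E. deriv (e q) y * pw t q)"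
      by (rule dy_coeffs[OF F(1) e(1) _ that]) (simp_all add: \<Phi>_def)
    also have "\<dots> = F t y"
      unfolding F(4)[OF that] by (intro sum.cong refl arg_cong2[where f = "(*)"] e(2) that)
    finally show ?thesis .
  qed
  from 1 2 show ?thesis using that by blast
qed


section \<open>Little-oh polynomials\<close>

lemma Ro_iff: "x \<in> Ro \<longleftrightarrow> (\<exists>X. power_family UNIV (\<lambda>t y. X t) \<and> fsim x X)"
proof
  assume "x \<in> Ro"
  then obtain r and k :: nat and \<alpha> a where "\<forall>i<k. 0 \<le> a i"
    and x: "small_o (\<lambda>t. x t - (r + (\<Sum>i<k. \<alpha> i * pw t (a i))))"
    unfolding Ro_def by blast
  then have "power_family UNIV (\<lambda>t y. r + (\<Sum>i<k. \<alpha> i * pw t (a i)))"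
    by (intro power_family_add power_family_const power_family_sum power_family_term smooth_on_const open_UNIV) simp
  then show "\<exists>X. power_family UNIV (\<lambda>t y. X t) \<and> fsim x X"
    unfolding fsim_def using x by (intro exI[of _ "\<lambda>t. r + (\<Sum>i<k. \<alpha> i * pw t (a i))"] conjI)
next
  assume "\<exists>X. power_family UNIV (\<lambda>t y. X t) \<and> fsim x X"
  then obtain X where X: "power_family UNIV (\<lambda>t y. X t)" "fsim x X" by blast
  obtain E c where Ec: "pcoeffs UNIV (\<lambda>t y. X t) E c"
    using X(1) unfolding power_family_def by blast
  note F = pcoeffsD[OF Ec]
  obtain h where h: "bij_betw h {0..<card E} E" using ex_bij_betw_nat_finite[OF F(1)] by blast
  \<comment> \<open>\<open>X t\<close> is constant in y, so its coefficients are read off at y = 0;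
    a constant term, if any, sits at exponent 0, hence r = 0.\<close>
  have "X t = 0 + (\<Sum>i<card E. c (h i) 0 * pw t (h i))" for t
    unfolding F(4)[of 0, simplified] sum.reindex_bij_betw[OF h, symmetric]
    by (simp add: lessThan_atLeast0)
  moreover have "\<forall>i<card E. 0 \<le> h i"
    using F(2) bij_betwE[OF h] by simp
  ultimately show "x \<in> Ro"
    using X(2) unfolding Ro_def fsim_def
    by (intro CollectI exI[of _ 0] exI[of _ "card E"] exI[of _ "\<lambda>i. c (h i) 0"] exI[of _ h] conjI) simp_all
qed

lemma RoE:
  assumes "x \<in> Ro" obtains X where "power_family UNIV (\<lambda>t y. X t)" "fsim x X"
  using assms[unfolded Ro_iff] by (elim exE conjE)

lemma RoI: "power_family UNIV (\<lambda>t y. X t) \<Longrightarrow> fsim x X \<Longrightarrow> x \<in> Ro"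
  unfolding Ro_iff by (intro exI[of _ X] conjI)

lemma Ro_cong: "y \<in> Ro \<Longrightarrow> fsim x y \<Longrightarrow> x \<in> Ro"
  by (elim RoE, rule RoI, assumption, rule fsim_trans)

lemma Ro_param: "power_family UNIV (\<lambda>t y. X t) \<Longrightarrow> X \<in> Ro"
  by (rule RoI[OF _ fsim_refl])

lemma Ro_const: "(\<lambda>t. k) \<in> Ro"
  by (rule Ro_param[OF power_family_const])

lemma Ro_pw: "0 \<le> q \<Longrightarrow> (\<lambda>t. pw t q) \<in> Ro"
  using power_family_term[OF _ smooth_on_const[of _ 1]] by (intro Ro_param) simp

lemma Ro_add: "x \<in> Ro \<Longrightarrow> y \<in> Ro \<Longrightarrow> (\<lambda>t. x t + y t) \<in> Ro"
  by (elim RoE, rule RoI[OF power_family_add[OF open_UNIV] fsim_add]) assumption+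

lemma Ro_bounded:
  assumes "x \<in> Ro" shows "x \<in> O[germ0](\<lambda>_. 1)"
proof -
  obtain X where X: "power_family UNIV (\<lambda>t y. X t)" "fsim x X" using assms by (elim RoE)
  obtain E c where Ec: "pcoeffs UNIV (\<lambda>t y. X t) E c"
    using X(1) unfolding power_family_def by blast
  note F = pcoeffsD[OF Ec]
  have "X = (\<lambda>t. \<Sum>q\<in>E. c q 0 * pw t q)" using F(4) by blast
  moreover have "(\<lambda>t. \<Sum>q\<in>E. c q 0 * pw t q) \<in> O[germ0](\<lambda>_. 1)"
    by (rule big_sum_in_bigo) (simp add: pw_bounded F(2))
  ultimately show ?thesis using fsim_bounded[OF X(2)] by simp
qed

lemma Ro_mult:
  assumes "x \<in> Ro" "y \<in> Ro" shows "(\<lambda>t. x t * y t) \<in> Ro"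
proof -
  obtain X where X: "power_family UNIV (\<lambda>t y. X t)" "fsim x X" using assms by (elim RoE)
  obtain Y where Y: "power_family UNIV (\<lambda>t y. Y t)" "fsim y Y" using assms by (elim RoE)
  have "fsim (\<lambda>t. x t * y t) (\<lambda>t. X t * Y t)"
    by (intro fsim_mult X Y Ro_bounded assms Ro_param)
  then show ?thesis by (rule RoI[OF power_family_mult[OF open_UNIV X(1) Y(1)]])
qed

lemma Ro_diff: "x \<in> Ro \<Longrightarrow> y \<in> Ro \<Longrightarrow> (\<lambda>t. x t - y t) \<in> Ro"
  using Ro_add[OF _ Ro_mult[OF Ro_const[of "-1"]], of x y] by simp

lemma Ro_sum: "(\<And>i. i \<in> I \<Longrightarrow> x i \<in> Ro) \<Longrightarrow> (\<lambda>t. \<Sum>i\<in>I. x i t) \<in> Ro"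
  by (induction I rule: infinite_finite_induct) (simp_all add: Ro_const Ro_add)

lemma Ro_power: "x \<in> Ro \<Longrightarrow> (\<lambda>t. x t ^ n) \<in> Ro"
  by (induction n) (simp_all add: Ro_const Ro_mult)

section \<open>Infinitesimal increments and composition with smooth functions\<close>

lemma infinitesimal_add:
  assumes "infinitesimal x" "infinitesimal y" shows "infinitesimal (\<lambda>t. x t + y t)"
proof -
  obtain a b where "a > 0" and x: "x \<in> O[germ0](\<lambda>t. pw t a)" and "b > 0" and y: "y \<in> O[germ0](\<lambda>t. pw t b)"
    using assms unfolding infinitesimal_def by blast
  then have "(\<lambda>t. pw t a) \<in> O[germ0](\<lambda>t. pw t (min a b))" "(\<lambda>t. pw t b) \<in> O[germ0](\<lambda>t. pw t (min a b))"
    by (intro pw_bigo; simp)+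
  with x y have "(\<lambda>t. x t + y t) \<in> O[germ0](\<lambda>t. pw t (min a b))"
    by (intro sum_in_bigo(1)) (blast intro: landau_o.big_trans)+
  moreover have "min a b > 0" using \<open>a > 0\<close> \<open>b > 0\<close> by simp
  ultimately show ?thesis unfolding infinitesimal_def by blast
qed

lemma infinitesimal_0: "infinitesimal (\<lambda>t. 0)"
  unfolding infinitesimal_def by (rule exI[of _ 1]) simp

lemma infinitesimal_sum:
  "(\<And>i. i \<in> I \<Longrightarrow> infinitesimal (x i)) \<Longrightarrow> infinitesimal (\<lambda>t. \<Sum>i\<in>I. x i t)"
  by (induction I rule: infinite_finite_induct) (simp_all add: infinitesimal_0 infinitesimal_add)

lemma infinitesimal_smallo: "x \<in> o[germ0](\<lambda>t. t) \<Longrightarrow> infinitesimal x"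
  unfolding infinitesimal_def germ0_pw_1
  by (intro exI[of _ 1] conjI landau_o.small_imp_big) simp_all

text \<open>Subtracting the value at 0 leaves only positive exponents, and the least of these
  finitely many gives a rate; the o(t) error has rate 1.\<close>

lemma Ro_infinitesimal:
  assumes "x \<in> Ro" shows "infinitesimal (\<lambda>t. x t - x 0)"
proof -
  obtain X where X: "power_family UNIV (\<lambda>t y. X t)" "fsim x X" using assms by (elim RoE)
  obtain E c where Ec: "pcoeffs UNIV (\<lambda>t y. X t) E c"
    using X(1) unfolding power_family_def by blast
  note F = pcoeffsD[OF Ec]
  have "infinitesimal (\<lambda>t. c q 0 * (pw t q - pw 0 q))" if "q \<in> E" for q
  proof (cases "q = 0")
    case False
    with F(2)[OF that] have "q > 0" "pw 0 q = 0" by (simp_all add: pw_def)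
    then show ?thesis unfolding infinitesimal_def by (intro exI[of _ q]) simp
  qed (simp add: infinitesimal_0)
  then have "infinitesimal (\<lambda>t. \<Sum>q\<in>E. c q 0 * (pw t q - pw 0 q))" by (rule infinitesimal_sum)
  moreover have "X t - x 0 = (\<Sum>q\<in>E. c q 0 * (pw t q - pw 0 q))" for t
    unfolding fsim_at_0[OF X(2)] using F(4)[of 0] by (simp add: right_diff_distrib sum_subtractf)
  ultimately have "infinitesimal (\<lambda>t. X t - x 0)" by simp
  from infinitesimal_add[OF infinitesimal_smallo[OF X(2)[unfolded fsim_iff]] this]
  show ?thesis by simp
qed

lemma Ro_tendsto: "x \<in> Ro \<Longrightarrow> (x \<longlongrightarrow> x 0) germ0"
  using infinitesimal_tendsto[OF Ro_infinitesimal] by (simp add: LIM_zero_iff)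

lemma Ro_eventually_in: "x \<in> Ro \<Longrightarrow> open V \<Longrightarrow> x 0 \<in> V \<Longrightarrow> eventually (\<lambda>t. x t \<in> V) germ0"
  using topological_tendstoD[OF Ro_tendsto] by blast

lemma smooth_on_comp_Ro:
  assumes "smooth_on V c" "open V" "x \<in> Ro" "x 0 \<in> V"
  shows "(\<lambda>t. c (x t)) \<in> Ro"
proof -
  obtain n where "fsim (\<lambda>t. c (x 0 + (x t - x 0))) (\<lambda>t. \<Sum>m<n. (deriv ^^ m) c (x 0) / fact m * (x t - x 0) ^ m)"
    using smooth_on_taylor[OF assms(1,2,4) Ro_infinitesimal[OF assms(3)]] .
  moreover have "(\<lambda>t. \<Sum>m<n. (deriv ^^ m) c (x 0) / fact m * (x t - x 0) ^ m) \<in> Ro"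
    by (intro Ro_sum Ro_mult Ro_const Ro_power Ro_diff assms)
  ultimately show ?thesis using Ro_cong by simp
qed

text \<open>The curve \<open>x\<close> is guaranteed to lie in V only for small t, and outside V the
  values of \<open>F\<close> are unconstrained; hence a congruence instead of an equality.\<close>

lemma power_family_comp_coeffs:
  assumes "open V" "x \<in> Ro" "x 0 \<in> V" "pcoeffs V F E c"
  shows "fsim (\<lambda>t. F t (x t)) (\<lambda>t. \<Sum>q\<in>E. c q (x t) * pw t q)"
  by (rule fsim_eventually_eq, rule eventually_mono[OF Ro_eventually_in[OF assms(2,1,3)]], rule pcoeffsD(4)[OF assms(4)])

lemma power_family_comp_Ro:
  assumes "power_family V F" "open V" "x \<in> Ro" "x 0 \<in> V"
  shows "(\<lambda>t. F t (x t)) \<in> Ro"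
proof -
  obtain E c where Ec: "pcoeffs V F E c"
    using assms(1) unfolding power_family_def by blast
  note F = pcoeffsD[OF Ec]
  have "(\<lambda>t. \<Sum>q\<in>E. c q (x t) * pw t q) \<in> Ro"
    by (intro Ro_sum Ro_mult Ro_pw F(2) smooth_on_comp_Ro[OF F(3) assms(2-4)])
  then show ?thesis
    by (rule Ro_cong[OF _ power_family_comp_coeffs[OF assms(2-4) Ec]])
qed

text \<open>\<open>c\<close> is Lipschitz on a closed ball around \<open>x 0\<close>, and both
  curves stay in that ball for small t.\<close>

lemma smooth_on_comp_fsim:
  assumes c: "smooth_on V c" "open V" and x: "x \<in> Ro" "x 0 \<in> V" and y: "fsim y x"
  shows "fsim (\<lambda>t. c (y t)) (\<lambda>t. c (x t))"
proof -
  obtain e where e: "e > 0" "cball (x 0) e \<subseteq> V" using c x open_contains_cball by blast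
  have "continuous_on (cball (x 0) e) (deriv c)"
    using e c by (intro continuous_at_imp_continuous_on ballI smooth_on_isCont smooth_on_deriv) auto
  then have "bounded (deriv c ` cball (x 0) e)"
    by (intro compact_imp_bounded compact_continuous_image compact_cball)
  then obtain M where M: "\<And>z. z \<in> cball (x 0) e \<Longrightarrow> norm (deriv c z) \<le> M"
    unfolding bounded_iff by blast
  have y': "y \<in> Ro" "y 0 = x 0" using Ro_cong[OF x(1) y] fsim_at_0[OF y] by auto
  have "eventually (\<lambda>t. x t \<in> ball (x 0) e) germ0" "eventually (\<lambda>t. y t \<in> ball (x 0) e) germ0"
    by (rule Ro_eventually_in; use x y' e in simp)+
  then have "eventually (\<lambda>t. norm (c (y t) - c (x t)) \<le> M * norm (y t - x t)) germ0"
  proof eventually_elim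
    case (elim t)
    show ?case
    proof (rule field_differentiable_bound[of "cball (x 0) e" c "deriv c" M])
      show "(c has_field_derivative deriv c z) (at z within cball (x 0) e)"
        if "z \<in> cball (x 0) e" for z
        using smooth_on_DERIV[OF c(1)] that e(2) by (blast intro: has_field_derivative_at_within)
    qed (use M elim in auto)
  qed
  then have "(\<lambda>t. c (y t) - c (x t)) \<in> O[germ0](\<lambda>t. y t - x t)" by (rule bigoI)
  with y show ?thesis unfolding fsim_iff by (rule landau_o.big_small_trans[rotated])
qed

lemma power_family_comp_fsim:
  assumes F: "power_family V F" "open V" and x: "x \<in> Ro" "x 0 \<in> V" and y: "fsim y x"
  shows "fsim (\<lambda>t. F t (y t)) (\<lambda>t. F t (x t))"
proof -
  obtain E c where Ec: "pcoeffs V F E c"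
    using F(1) unfolding power_family_def by blast
  note E = pcoeffsD[OF Ec]
  have y': "y \<in> Ro" "y 0 \<in> V" using Ro_cong[OF x(1) y] fsim_at_0[OF y] x by auto
  have "fsim (\<lambda>t. F t (y t)) (\<lambda>t. \<Sum>q\<in>E. c q (y t) * pw t q)"
    by (rule power_family_comp_coeffs[OF F(2) y' Ec])
  also have "fsim (\<lambda>t. \<Sum>q\<in>E. c q (y t) * pw t q) (\<lambda>t. \<Sum>q\<in>E. c q (x t) * pw t q)"
    by (intro fsim_sum fsim_mult fsim_refl smooth_on_comp_fsim[OF E(3) F(2) x y]
        Ro_bounded smooth_on_comp_Ro[OF E(3) F(2) y'] Ro_pw E(2))
  also have "fsim (\<lambda>t. \<Sum>q\<in>E. c q (x t) * pw t q) (\<lambda>t. F t (x t))"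
    by (rule fsim_sym[OF power_family_comp_coeffs[OF F(2) x Ec]])
  finally show ?thesis .
qed


section \<open>Flatness at the boundary of an interval\<close>

text \<open>By continuity \<open>c\<close> has at \<open>x 0\<close> the value k and vanishing
  derivatives, even if \<open>x 0\<close> is an end point of I. Its Taylor polynomial there is the
  constant k, so \<open>c\<close> is k modulo o(t) also along a curve that stays outside I.\<close>

lemma smooth_on_flat:
  assumes c: "smooth_on V c" "open V" and x: "x \<in> Ro" "x 0 \<in> V"
    and I: "open I" "I \<subseteq> V" "x 0 \<in> closure I" and k: "\<And>y. y \<in> I \<Longrightarrow> c y = k"
  shows "fsim (\<lambda>t. c (x t)) (\<lambda>t. k)"
proof -
  have D: "\<forall>y\<in>I. (deriv ^^ m) c y = (if m = 0 then k else 0)" for m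
  proof (induction m)
    case (Suc m)
    show ?case
    proof
      fix y assume "y \<in> I"
      have "deriv ((deriv ^^ m) c) y = deriv (\<lambda>_. if m = 0 then k else 0) y"
        using Suc by (intro deriv_cong_on[OF I(1) \<open>y \<in> I\<close>]) blast
      then show "(deriv ^^ Suc m) c y = (if Suc m = 0 then k else 0)" by simp
    qed
  qed (simp add: k)
  have D0: "(deriv ^^ m) c (x 0) = (if m = 0 then k else 0)" for m
  proof -
    obtain y where y: "\<And>n. y n \<in> I" "y \<longlonglongrightarrow> x 0" using I(3) closure_sequential by metis
    have "(\<lambda>n. (deriv ^^ m) c (y n)) \<longlonglongrightarrow> (deriv ^^ m) c (x 0)"
      using smooth_on_isCont[OF smooth_on_funpow_deriv[OF c(1)] x(2)] y(2)
      by (rule isCont_tendsto_compose)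
    moreover have "(\<lambda>n. (deriv ^^ m) c (y n)) = (\<lambda>n. if m = 0 then k else 0)"
      using D y(1) by blast
    ultimately show ?thesis using LIMSEQ_unique tendsto_const by metis
  qed
  obtain n where n: "n > 0"
    "fsim (\<lambda>t. c (x 0 + (x t - x 0))) (\<lambda>t. \<Sum>m<n. (deriv ^^ m) c (x 0) / fact m * (x t - x 0) ^ m)"
    using smooth_on_taylor[OF c x(2) Ro_infinitesimal[OF x(1)]] .
  have "(\<Sum>m<n. (deriv ^^ m) c (x 0) / fact m * (x t - x 0) ^ m) = (\<Sum>m<n. if m = 0 then k else 0)" for t
    unfolding D0 by (intro sum.cong refl) simp
  also have "\<dots> = k" using n(1) by simp
  finally show ?thesis using n(2) by simp
qed

text \<open>Terms with exponent above 1 are o(t) whatever their coefficients; the remaining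
  coefficients are constant by flatness.\<close>

lemma coeffs_flat:
  assumes E: "finite E" "\<And>q. q \<in> E \<Longrightarrow> 0 \<le> q" "\<And>q. q \<in> E \<Longrightarrow> smooth_on V (c q)"
    and V: "open V" and x: "x \<in> Ro" "x 0 \<in> V"
    and I: "open I" "I \<subseteq> V" "x 0 \<in> closure I"
    and k: "\<And>q y. q \<in> E \<Longrightarrow> q \<le> 1 \<Longrightarrow> y \<in> I \<Longrightarrow> c q y = k q"
  shows "fsim (\<lambda>t. \<Sum>q\<in>E. c q (x t) * pw t q) (\<lambda>t. \<Sum>q\<in>E. (if q \<le> 1 then k q else 0) * pw t q)"
proof (rule fsim_sum)
  fix q assume q: "q \<in> E"
  show "fsim (\<lambda>t. c q (x t) * pw t q) (\<lambda>t. (if q \<le> 1 then k q else 0) * pw t q)"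
  proof (cases "q \<le> 1")
    case True
    have "fsim (\<lambda>t. c q (x t)) (\<lambda>t. k q)"
      by (rule smooth_on_flat[OF E(3)[OF q] V x I k[OF q True]])
    then have "fsim (\<lambda>t. c q (x t) * pw t q) (\<lambda>t. k q * pw t q)"
      by (intro fsim_mult fsim_refl Ro_bounded smooth_on_comp_Ro[OF E(3)[OF q] V x] Ro_pw[OF E(2)[OF q]])
    with True show ?thesis by simp
  next
    case False
    then have "(\<lambda>t. c q (x t) * pw t q) \<in> o[germ0](\<lambda>t. t)"
      by (intro smallo_bounded_mult pw_smallo_id Ro_bounded smooth_on_comp_Ro[OF E(3)[OF q] V x]) simp
    with False show ?thesis unfolding fsim_iff by simp
  qed
qed

text \<open>
  The exponents must not depend on \<open>y\<close>: a family of smooth functions that is merely \<open>o(t)\<close> at each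
  point can have a derivative that is not \<open>o(t)\<close>. The base point of \<open>x\<close> may be an end point of \<open>I\<close>.
\<close>

lemma power_family_vanishing:
  assumes F: "power_family V F" and V: "open V" and I: "open I" "I \<subseteq> V"
    and small: "\<And>y. y \<in> I \<Longrightarrow> fsim (\<lambda>t. F t y) (\<lambda>t. 0)"
    and x: "x \<in> Ro" "x 0 \<in> V" "x 0 \<in> closure I"
  shows "fsim (\<lambda>t. F t (x t)) (\<lambda>t. 0)" "fsim (\<lambda>t. dy F t (x t)) (\<lambda>t. 0)"
proof -
  obtain E c where Ec: "pcoeffs V F E c"
    using F(1) unfolding power_family_def by blast
  note E = pcoeffsD[OF Ec]
  have c0: "c q y = 0" if "q \<in> E" "q \<le> 1" "y \<in> I" for q y
  proof -
    have "F t y = (\<Sum>q\<in>E. c q y * pw t q)" for t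
      by (rule E(4)) (use that(3) I(2) in blast)
    then have "(\<lambda>t. \<Sum>q\<in>E. c q y * pw t q) \<in> o[germ0](\<lambda>t. t)"
      using small[OF that(3)] unfolding fsim_iff by simp
    from pw_sum_smallo_imp_coeff_0[OF E(1,2) this that(1,2)] show ?thesis .
  qed
  have c1: "deriv (c q) y = 0" if "q \<in> E" "q \<le> 1" "y \<in> I" for q y
  proof -
    have "deriv (c q) y = deriv (\<lambda>_. 0) y"
      by (rule deriv_cong_on[OF I(1) that(3)]) (rule c0[OF that(1,2)])
    then show ?thesis by simp
  qed
  have "fsim (\<lambda>t. F t (x t)) (\<lambda>t. \<Sum>q\<in>E. c q (x t) * pw t q)"
    by (rule power_family_comp_coeffs[OF V x(1,2) Ec])
  also have "fsim \<dots> (\<lambda>t. \<Sum>q\<in>E. (if q \<le> 1 then 0 else 0) * pw t q)"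
    by (rule coeffs_flat[OF E(1-3) V x(1,2) I x(3) c0])
  finally show "fsim (\<lambda>t. F t (x t)) (\<lambda>t. 0)" by simp
  have "fsim (\<lambda>t. dy F t (x t)) (\<lambda>t. \<Sum>q\<in>E. deriv (c q) (x t) * pw t q)"
    by (rule power_family_comp_coeffs[OF V x(1,2) pcoeffs_dy[OF Ec V]])
  also have "fsim \<dots> (\<lambda>t. \<Sum>q\<in>E. (if q \<le> 1 then 0 else 0) * pw t q)"
    by (rule coeffs_flat[OF E(1,2) smooth_on_deriv[OF E(3)] V x(1,2) I x(3) c1])
  finally show "fsim (\<lambda>t. dy F t (x t)) (\<lambda>t. 0)" by simp
qed

text \<open>At exponents up to 1 the coefficients of \<open>dy F\<close> vanish on I, so those of
  \<open>F\<close> are constant there by convexity, and flatness carries the same constants to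
  \<open>x\<close> and to \<open>y\<close>. This yields uniqueness of primitives, also between
  points infinitely near the ends.\<close>

lemma power_family_dy_vanishing:
  assumes F: "power_family V F" and V: "open V" and I: "open I" "convex I" "I \<subseteq> V"
    and small: "\<And>y. y \<in> I \<Longrightarrow> fsim (\<lambda>t. dy F t y) (\<lambda>t. 0)"
    and x: "x \<in> Ro" "x 0 \<in> V" "x 0 \<in> closure I"
    and y: "y \<in> Ro" "y 0 \<in> V" "y 0 \<in> closure I"
  shows "fsim (\<lambda>t. F t (x t)) (\<lambda>t. F t (y t))"
proof -
  obtain E c where Ec: "pcoeffs V F E c"
    using F(1) unfolding power_family_def by blast
  note E = pcoeffsD[OF Ec]
  have "\<exists>k. \<forall>y\<in>I. c q y = k" if "q \<in> E" "q \<le> 1" for q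
  proof (rule has_field_derivative_zero_constant[OF I(2)])
    fix y assume "y \<in> I"
    then have "y \<in> V" using I(3) by blast
    then have "dy F t y = (\<Sum>q\<in>E. deriv (c q) y * pw t q)" for t
      by (rule pcoeffsD(4)[OF pcoeffs_dy[OF Ec V]])
    then have "(\<lambda>t. \<Sum>q\<in>E. deriv (c q) y * pw t q) \<in> o[germ0](\<lambda>t. t)"
      using small[OF \<open>y \<in> I\<close>] unfolding fsim_iff by simp
    from pw_sum_smallo_imp_coeff_0[OF E(1,2) this that] have "deriv (c q) y = 0" .
    with smooth_on_DERIV[OF E(3)[OF that(1)] \<open>y \<in> V\<close>]
    show "(c q has_real_derivative 0) (at y within I)"
      by (simp add: has_field_derivative_at_within)
  qed
  then obtain k where k: "\<And>q y. q \<in> E \<Longrightarrow> q \<le> 1 \<Longrightarrow> y \<in> I \<Longrightarrow> c q y = k q" by metis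
  have *: "fsim (\<lambda>t. F t (z t)) (\<lambda>t. \<Sum>q\<in>E. (if q \<le> 1 then k q else 0) * pw t q)"
    if "z \<in> Ro" "z 0 \<in> V" "z 0 \<in> closure I" for z
  proof -
    have "fsim (\<lambda>t. F t (z t)) (\<lambda>t. \<Sum>q\<in>E. c q (z t) * pw t q)"
      by (rule power_family_comp_coeffs[OF V that(1,2) Ec])
    also have "fsim \<dots> (\<lambda>t. \<Sum>q\<in>E. (if q \<le> 1 then k q else 0) * pw t q)"
      by (rule coeffs_flat[OF E(1-3) V that(1,2) I(1,3) that(3) k])
    finally show ?thesis .
  qed
  from fsim_trans[OF *[OF x] fsim_sym[OF *[OF y]]] show ?thesis .
qed


section \<open>Expansion of smooth functions of several variables\<close>

lemma Cinf_pdiff: "Cinf N U \<alpha> \<Longrightarrow> i < N \<Longrightarrow> Cinf N U (pdiff i \<alpha>)"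
  unfolding Cinf_def
proof
  fix k assume "\<forall>k. Ck N k U \<alpha>" "i < N"
  then have "Ck N (Suc k) U \<alpha>" by blast
  with \<open>i < N\<close> show "Ck N k U (pdiff i \<alpha>)" by simp
qed

lemma Cinf_pdiff_funpow: "Cinf N U \<alpha> \<Longrightarrow> i < N \<Longrightarrow> Cinf N U ((pdiff i ^^ n) \<alpha>)"
  by (induction n) (simp_all add: Cinf_pdiff)

lemma Cinf_continuous_on: "Cinf N U \<alpha> \<Longrightarrow> continuous_on U \<alpha>"
  unfolding Cinf_def by (drule spec[of _ 0]) simp

lemma Cinf_DERIV:
  assumes "Cinf N U \<alpha>" "i < N" "z(i := r) \<in> U"
  shows "((\<lambda>s. \<alpha> (z(i := s))) has_real_derivative pdiff i \<alpha> (z(i := r))) (at r)"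
proof -
  have "Ck N (Suc 0) U \<alpha>" using assms(1) unfolding Cinf_def by blast
  then have "(\<lambda>s. \<alpha> ((z(i := r))(i := (z(i := r)) i + s))) differentiable (at 0)"
    using assms(2,3) unfolding Ck.simps by blast
  then have "((\<lambda>s. \<alpha> ((z(i := r))(i := (z(i := r)) i + s))) has_real_derivative pdiff i \<alpha> (z(i := r))) (at 0)"
    unfolding pdiff_def DERIV_deriv_iff_real_differentiable .
  then have "((\<lambda>s. \<alpha> (z(i := s + r))) has_real_derivative pdiff i \<alpha> (z(i := r))) (at 0)"
    by (simp add: add.commute)
  then show ?thesis using DERIV_shift[of "\<lambda>s. \<alpha> (z(i := s))" _ 0 r] by simp
qed

lemma Cinf_smooth_on:
  assumes "Cinf N U \<alpha>" "i < N" "open V" "\<And>y. y \<in> V \<Longrightarrow> z(i := y) \<in> U"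
  shows "smooth_on V (\<lambda>y. \<alpha> (z(i := y)))"
  unfolding smooth_on_upto
proof
  fix n
  show "differentiable_upto n V (\<lambda>y. \<alpha> (z(i := y)))"
    using assms(1)
  proof (induction n arbitrary: \<alpha>)
    case (Suc n)
    note D = Cinf_DERIV[OF Suc.prems assms(2) assms(4)]
    have "differentiable_upto n V (\<lambda>y. pdiff i \<alpha> (z(i := y)))"
      by (rule Suc.IH[OF Cinf_pdiff[OF Suc.prems assms(2)]])
    then have "differentiable_upto n V (deriv (\<lambda>y. \<alpha> (z(i := y))))"
      by (rule differentiable_upto_cong[OF assms(3), rotated]) (rule DERIV_imp_deriv[OF D, symmetric])
    moreover have "\<forall>y\<in>V. (\<lambda>y. \<alpha> (z(i := y))) differentiable (at y)"
      using D unfolding real_differentiable_def by blast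
    ultimately show ?case unfolding differentiable_upto.simps by (rule conjI[rotated])
  qed simp
qed

text \<open>All points concerned vanish beyond coordinate d, so a basic neighbourhood restricts only
  d coordinates and finitely many radii suffice.\<close>

lemma openR_box:
  assumes "openR d P" "p0 \<in> P"
  obtains \<delta> where "\<delta> > 0" "\<And>z. z \<in> emb d \<Longrightarrow> (\<And>i. i < d \<Longrightarrow> \<bar>z i - p0 i\<bar> \<le> \<delta>) \<Longrightarrow> z \<in> P"
proof -
  obtain W where W: "open W" "P = W \<inter> emb d" using assms(1) unfolding openR_def by blast
  have "openin (product_topology (\<lambda>i. euclidean) UNIV) W" using W(1) unfolding open_fun_def .
  from product_topology_open_contains_basis[OF this] W(2) assms(2)
  obtain X where X: "p0 \<in> Pi\<^sub>E UNIV X" "\<forall>i. open (X i)" "Pi\<^sub>E UNIV X \<subseteq> W"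
    unfolding open_openin[symmetric] by blast
  have "\<exists>e>0. cball (p0 i) e \<subseteq> X i" for i
  proof -
    have "p0 i \<in> X i" using X(1) by (simp add: PiE_iff)
    moreover have "open (X i)" using X(2) by blast
    ultimately show ?thesis unfolding open_contains_cball by blast
  qed
  then obtain e where e: "\<And>i. e i > 0" "\<And>i. cball (p0 i) (e i) \<subseteq> X i" by metis
  \<comment> \<open>The 1 keeps the set nonempty when d = 0.\<close>
  define \<delta> where "\<delta> = Min (insert 1 (e ` {..<d}))"
  have "\<delta> > 0" unfolding \<delta>_def using e(1) by simp
  have le: "\<delta> \<le> e i" if "i < d" for i unfolding \<delta>_def using that by simp
  have "z \<in> P" if z: "z \<in> emb d" "\<And>i. i < d \<Longrightarrow> \<bar>z i - p0 i\<bar> \<le> \<delta>" for z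
  proof -
    have "z i \<in> X i" for i
    proof (cases "i < d")
      case True
      then have "z i \<in> cball (p0 i) (e i)"
        using z(2)[OF True] le[OF True] by (simp add: dist_real_def abs_minus_commute)
      then show ?thesis using e(2) by blast
    next
      case False
      then have "z i = p0 i" using z(1) assms(2) W(2) by (simp add: emb_def)
      then show ?thesis using X(1) by (simp add: PiE_iff)
    qed
    then show ?thesis using X(3) W(2) z(1) by blast
  qed
  with \<open>\<delta> > 0\<close> show ?thesis using that by blast
qed

text \<open>By Tychonoff: the set is a full product whose factors beyond d are the compact set
  {0}.\<close>

lemma compact_box:
  fixes p0 :: "nat \<Rightarrow> real"
  assumes "compact K"
  shows "compact {z \<in> emb (Suc d). (\<forall>i<d. \<bar>z i - p0 i\<bar> \<le> \<delta>) \<and> z d \<in> K}" (is "compact ?C")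
proof -
  define S where "S i = (if i < d then cball (p0 i) \<delta> else if i = d then K else {0})" for i
  have "?C = Pi\<^sub>E UNIV S"
  proof (intro equalityI subsetI)
    fix z assume "z \<in> ?C"
    then show "z \<in> Pi\<^sub>E UNIV S"
      by (auto simp: S_def emb_def dist_real_def abs_minus_commute)
  next
    fix z assume z: "z \<in> Pi\<^sub>E UNIV S"
    have zi: "z i \<in> S i" for i using z by (simp add: PiE_iff)
    have "\<bar>z i - p0 i\<bar> \<le> \<delta>" if "i < d" for i
      using zi[of i] that by (simp add: S_def dist_real_def abs_minus_commute)
    moreover have "z d \<in> K" using zi[of d] by (simp add: S_def)
    moreover have "z i = 0" if "i \<ge> Suc d" for i using zi[of i] that by (simp add: S_def)
    ultimately show "z \<in> ?C" by (simp add: emb_def)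
  qed
  moreover have "compactin (product_topology (\<lambda>i. euclidean) UNIV) (Pi\<^sub>E UNIV S)"
    unfolding compactin_PiE using assms by (simp add: S_def)
  ultimately show ?thesis by (simp add: euclidean_product_topology)
qed

lemma fsim_power: "x \<in> Ro \<Longrightarrow> y \<in> Ro \<Longrightarrow> fsim x y \<Longrightarrow> fsim (\<lambda>t. x t ^ n) (\<lambda>t. y t ^ n)"
proof (induction n)
  case (Suc n)
  then show ?case unfolding power_Suc by (intro fsim_mult Ro_bounded Ro_power)
qed simp

section \<open>Estimates uniform in the base point\<close>

text \<open>Membership in \<open>o[unif K](fst)\<close> means o(t) uniformly for y in K; such bounds
  survive substitution of a moving point \<open>y t\<close> and passage from a derivative to an
  increment.\<close>

definition unif :: "real set \<Rightarrow> (real \<times> real) filter" where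
  "unif K = germ0 \<times>\<^sub>F principal K"

lemma filterlim_unif: 
  assumes "eventually (\<lambda>t. y t \<in> K) germ0"
  shows "filterlim (\<lambda>t. (t, y t)) (unif K) germ0"
  unfolding unif_def
  by (rule filterlim_Pair[OF filterlim_ident]) (simp add: filterlim_principal assms)

lemma unif_smalloD:
  assumes "(\<lambda>\<omega>. f (fst \<omega>) (snd \<omega>)) \<in> o[unif K](fst)" "eventually (\<lambda>t. y t \<in> K) germ0"
  shows "(\<lambda>t. f t (y t)) \<in> o[germ0](\<lambda>t. t)"
  using landau_o.small.compose[OF assms(1) filterlim_unif[OF assms(2)]] by simp

lemma unif_smallo_fst: "f \<in> o[germ0](\<lambda>t. t) \<Longrightarrow> (\<lambda>\<omega>. f (fst \<omega>)) \<in> o[unif K](fst)"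
  unfolding unif_def using landau_o.small.compose[OF _ filterlim_fst] by fastforce

lemma unif_bigo_fst: "f \<in> O[germ0](\<lambda>_. 1) \<Longrightarrow> (\<lambda>\<omega>. f (fst \<omega>)) \<in> O[unif K](\<lambda>_. 1)"
  unfolding unif_def using landau_o.big.compose[OF _ filterlim_fst] by fastforce

lemma eventually_unif_fst: "eventually P germ0 \<Longrightarrow> eventually (\<lambda>\<omega>. P (fst \<omega>)) (unif K)"
  unfolding unif_def by (rule eventually_compose_filterlim[OF _ filterlim_fst])

lemma eventually_unif_snd: "eventually (\<lambda>\<omega>. snd \<omega> \<in> K) (unif K)"
  unfolding unif_def using filterlim_snd[of "principal K" germ0] by (simp add: filterlim_principal)

lemma power_family_unif_bounded:
  assumes "power_family V F" "open V" "compact K" "K \<subseteq> V"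
  shows "(\<lambda>\<omega>. F (fst \<omega>) (snd \<omega>)) \<in> O[unif K](\<lambda>_. 1)"
proof -
  obtain E c where Ec: "pcoeffs V F E c" using assms(1) unfolding power_family_def by blast
  note F = pcoeffsD[OF Ec]
  have c: "(\<lambda>\<omega>. c q (snd \<omega>)) \<in> O[unif K](\<lambda>_. 1)" if "q \<in> E" for q
  proof -
    have "continuous_on K (c q)"
      using assms(4) smooth_on_isCont[OF F(3)[OF that]]
      by (intro continuous_at_imp_continuous_on ballI) blast
    then have "bounded (c q ` K)"
      by (intro compact_imp_bounded compact_continuous_image assms(3))
    then obtain M where M: "\<And>z. z \<in> K \<Longrightarrow> norm (c q z) \<le> M" unfolding bounded_iff by blast
    show ?thesis
      by (rule bigoI[of _ M], rule eventually_mono[OF eventually_unif_snd]) (simp add: M[unfolded real_norm_def])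
  qed
  have "(\<lambda>\<omega>. \<Sum>q\<in>E. c q (snd \<omega>) * pw (fst \<omega>) q) \<in> O[unif K](\<lambda>_. 1 * 1)"
    by (intro big_sum_in_bigo landau_o.big.mult c unif_bigo_fst pw_bounded F(2))
  moreover have "eventually (\<lambda>\<omega>. F (fst \<omega>) (snd \<omega>) = (\<Sum>q\<in>E. c q (snd \<omega>) * pw (fst \<omega>) q)) (unif K)"
    by (rule eventually_mono[OF eventually_unif_snd]) (use F(4) assms(4) in blast)
  ultimately show ?thesis by (simp add: landau_o.big.in_cong)
qed

text \<open>
  Only the first \<open>N\<close> parameters move with \<open>t\<close>; the expansion lemma is proved by induction on \<open>N\<close>.
\<close>

definition pt :: "nat \<Rightarrow> (nat \<Rightarrow> real \<Rightarrow> real) \<Rightarrow> nat \<Rightarrow> real \<Rightarrow> real \<Rightarrow> nat \<Rightarrow> real" where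
  "pt d x N t y = (\<lambda>i. if i < N then x i t else if i < d then x i 0 else if i = d then y else 0)"

text \<open>The Taylor expansion in parameter number N, about its standard part, has as coefficients
  iterated partial derivatives taken at points where just N parameters move. These are again smooth,
  so the induction hypothesis, with \<open>\<alpha>\<close> general, expands them. Compactness of K
  makes the remainder uniform in y.\<close>

lemma Cinf_expansion_partial:
  assumes x: "\<And>i. i < d \<Longrightarrow> x i \<in> Ro"
    and V: "open V" and K: "compact K" "K \<subseteq> V"
    and \<delta>: "\<delta> > 0"
    and C: "{z \<in> emb (Suc d). (\<forall>i<d. \<bar>z i - x i 0\<bar> \<le> \<delta>) \<and> z d \<in> K} \<subseteq> U"
    and VU: "\<And>y. y \<in> V \<Longrightarrow> pt d x 0 0 y \<in> U"
    and N: "N \<le> d" and \<alpha>: "Cinf (Suc d) U \<alpha>"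
  shows "\<exists>F. power_family V F \<and> (\<lambda>\<omega>. \<alpha> (pt d x N (fst \<omega>) (snd \<omega>)) - F (fst \<omega>) (snd \<omega>)) \<in> o[unif K](fst)"
  using N \<alpha>
proof (induction N arbitrary: \<alpha>)
  case 0
  have eq: "pt d x 0 t y = (pt d x 0 0 0)(d := y)" for t y by (auto simp: pt_def)
  have "smooth_on V (\<lambda>y. \<alpha> ((pt d x 0 0 0)(d := y)))"
    by (rule Cinf_smooth_on[OF 0(2) _ V]) (simp_all add: VU flip: eq[of 0])
  then have "power_family V (\<lambda>t y. \<alpha> ((pt d x 0 0 0)(d := y)))" by (rule power_family_smooth)
  then have "power_family V (\<lambda>t y. \<alpha> (pt d x 0 t y))"
    by (rule power_family_cong) (rule arg_cong[where f = \<alpha>], rule eq)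
  then show ?case by (rule exI[of _ "\<lambda>t y. \<alpha> (pt d x 0 t y)", OF conjI]) simp
next
  case (Suc N)
  define h where "h t = x N t - x N 0" for t
  have "N < d" "N < Suc d" using Suc.prems(1) by simp_all
  note \<alpha> = Suc.prems(2)
  have hRo: "h \<in> Ro" unfolding h_def by (intro Ro_diff Ro_const x \<open>N < d\<close>)
  have hinf: "infinitesimal h" unfolding h_def by (intro Ro_infinitesimal x \<open>N < d\<close>)
  obtain n where n: "n > 0" "(\<lambda>t. h t ^ n) \<in> o[germ0](\<lambda>t. t)"
    using infinitesimal_nilpotent[OF hinf] .
  define \<beta> where "\<beta> m = (pdiff N ^^ m) \<alpha>" for m
  have \<beta>: "Cinf (Suc d) U (\<beta> m)" for m
    unfolding \<beta>_def by (rule Cinf_pdiff_funpow[OF \<alpha> \<open>N < Suc d\<close>])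
  define D where "D m \<omega> s = \<beta> m ((pt d x N (fst \<omega>) (snd \<omega>))(N := x N 0 + s))" for m and \<omega> :: "real \<times> real" and s
  let ?C = "{z \<in> emb (Suc d). (\<forall>i<d. \<bar>z i - x i 0\<bar> \<le> \<delta>) \<and> z d \<in> K}"
  \<comment> \<open>On the compact box \<open>?C\<close> the top derivative has a single bound M,
    valid for all small t and all y in K.\<close>
  have "continuous_on ?C (\<beta> n)"
    by (rule continuous_on_subset[OF Cinf_continuous_on[OF \<beta>] C])
  then have "bounded (\<beta> n ` ?C)"
    by (intro compact_imp_bounded compact_continuous_image compact_box K(1))
  then obtain M where M: "\<And>z. z \<in> ?C \<Longrightarrow> norm (\<beta> n z) \<le> M" unfolding bounded_iff by blast
  have "eventually (\<lambda>t. \<bar>x i t - x i 0\<bar> \<le> \<delta>) germ0" if "i < d" for i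
    using tendstoD[OF infinitesimal_tendsto[OF Ro_infinitesimal[OF x[OF that]]] \<delta>]
    by (rule eventually_mono) simp
  then have "eventually (\<lambda>t. \<forall>i\<in>{..<d}. \<bar>x i t - x i 0\<bar> \<le> \<delta>) germ0"
    by (intro eventually_ball_finite) simp_all
  then have "eventually (\<lambda>\<omega>. \<forall>i\<in>{..<d}. \<bar>x i (fst \<omega>) - x i 0\<bar> \<le> \<delta>) (unif K)"
    by (rule eventually_unif_fst)
  then have "eventually (\<lambda>\<omega>. \<forall>s. \<bar>s\<bar> \<le> \<bar>h (fst \<omega>)\<bar> \<longrightarrow>
      (\<forall>m<n. (D m \<omega> has_real_derivative D (Suc m) \<omega> s) (at s)) \<and> \<bar>D n \<omega> s\<bar> \<le> M) (unif K)"
    using eventually_unif_snd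
  proof eventually_elim
    case (elim \<omega>)
    show ?case
    proof (intro allI impI)
      fix s assume s: "\<bar>s\<bar> \<le> \<bar>h (fst \<omega>)\<bar>"
      define z where "z = pt d x N (fst \<omega>) (snd \<omega>)"
      have "\<bar>s\<bar> \<le> \<delta>" using s elim(1) \<open>N < d\<close> unfolding h_def by force
      have zC: "z(N := x N 0 + s) \<in> ?C"
        using elim \<open>\<bar>s\<bar> \<le> \<delta>\<close> \<delta> Suc.prems(1) unfolding z_def by (auto simp: pt_def emb_def)
      have "(D m \<omega> has_real_derivative D (Suc m) \<omega> s) (at s)" for m
      proof -
        have "((\<lambda>r. \<beta> m (z(N := r))) has_real_derivative pdiff N (\<beta> m) (z(N := x N 0 + s))) (at (s + x N 0))"
          using Cinf_DERIV[OF \<beta> \<open>N < Suc d\<close>] zC C by (metis (no_types, lifting) add.commute subsetD)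
        then show ?thesis
          unfolding DERIV_shift D_def z_def \<beta>_def by (simp add: add.commute)
      qed
      moreover have "\<bar>D n \<omega> s\<bar> \<le> M"
        using M[OF zC] unfolding D_def z_def real_norm_def .
      ultimately show "(\<forall>m<n. (D m \<omega> has_real_derivative D (Suc m) \<omega> s) (at s)) \<and> \<bar>D n \<omega> s\<bar> \<le> M"
        by blast
    qed
  qed
  from landau_o.big_small_trans[OF taylor_bigo[OF n(1) this] unif_smallo_fst[OF n(2)]]
  have T: "(\<lambda>\<omega>. D 0 \<omega> (h (fst \<omega>)) - (\<Sum>m<n. D m \<omega> 0 / fact m * h (fst \<omega>) ^ m)) \<in> o[unif K](fst)" .
  have D0: "D m \<omega> 0 = \<beta> m (pt d x N (fst \<omega>) (snd \<omega>))" for m \<omega>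
    unfolding D_def by (rule arg_cong[where f = "\<beta> m"]) (use \<open>N < d\<close> in \<open>auto simp: pt_def\<close>)
  have Dh: "D 0 \<omega> (h (fst \<omega>)) = \<alpha> (pt d x (Suc N) (fst \<omega>) (snd \<omega>))" for \<omega>
    unfolding D_def \<beta>_def funpow_0
    by (rule arg_cong[where f = \<alpha>]) (auto simp: pt_def h_def less_Suc_eq)
  have "\<forall>m. \<exists>F. power_family V F \<and> (\<lambda>\<omega>. \<beta> m (pt d x N (fst \<omega>) (snd \<omega>)) - F (fst \<omega>) (snd \<omega>)) \<in> o[unif K](fst)"
    using Suc.IH[OF _ \<beta>] Suc.prems(1) by simp
  then obtain F where F: "\<And>m. power_family V (F m)"
    "\<And>m. (\<lambda>\<omega>. \<beta> m (pt d x N (fst \<omega>) (snd \<omega>)) - F m (fst \<omega>) (snd \<omega>)) \<in> o[unif K](fst)"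
    by metis
  \<comment> \<open>\<open>G\<close> has to be an exact power family, so \<open>h\<close> is
    replaced by an exact power sum \<open>X\<close>. The error h^m \<beta>_m - X^m F_m then splits
    into two uniformly small differences with bounded factors.\<close>
  obtain X where X: "power_family UNIV (\<lambda>t y. X t)" "fsim h X" using hRo by (elim RoE)
  have "(\<lambda>\<omega>. h (fst \<omega>) ^ m * (\<beta> m (pt d x N (fst \<omega>) (snd \<omega>)) - F m (fst \<omega>) (snd \<omega>))
      + F m (fst \<omega>) (snd \<omega>) * (h (fst \<omega>) ^ m - X (fst \<omega>) ^ m)) \<in> o[unif K](fst)" for m
  proof (intro sum_in_smallo(1) smallo_bounded_mult F(2) power_family_unif_bounded[OF F(1) V K])
    show "(\<lambda>\<omega>. h (fst \<omega>) ^ m) \<in> O[unif K](\<lambda>_. 1)"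
      by (rule unif_bigo_fst[OF Ro_bounded[OF Ro_power[OF hRo]]])
    show "(\<lambda>\<omega>. h (fst \<omega>) ^ m - X (fst \<omega>) ^ m) \<in> o[unif K](fst)"
      by (rule unif_smallo_fst[OF fsim_power[OF hRo Ro_param[OF X(1)] X(2), unfolded fsim_iff]])
  qed
  then have "(\<lambda>\<omega>. 1 / fact m * (h (fst \<omega>) ^ m * (\<beta> m (pt d x N (fst \<omega>) (snd \<omega>)) - F m (fst \<omega>) (snd \<omega>))
      + F m (fst \<omega>) (snd \<omega>) * (h (fst \<omega>) ^ m - X (fst \<omega>) ^ m))) \<in> o[unif K](fst)" for m
    by simp
  then have S: "(\<lambda>\<omega>. \<Sum>m<n. 1 / fact m * (h (fst \<omega>) ^ m * (\<beta> m (pt d x N (fst \<omega>) (snd \<omega>)) - F m (fst \<omega>) (snd \<omega>))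
      + F m (fst \<omega>) (snd \<omega>) * (h (fst \<omega>) ^ m - X (fst \<omega>) ^ m))) \<in> o[unif K](fst)"
    by (rule big_sum_in_smallo)
  define G where "G t y = (\<Sum>m<n. 1 / fact m * (F m t y * X t ^ m))" for t y
  have "power_family V G" unfolding G_def
    by (intro power_family_sum V power_family_mult power_family_const F(1) power_family_power power_family_param[OF X(1)])
  moreover have "(\<lambda>\<omega>. \<alpha> (pt d x (Suc N) (fst \<omega>) (snd \<omega>)) - G (fst \<omega>) (snd \<omega>)) \<in> o[unif K](fst)"
  proof -
    have "\<alpha> (pt d x (Suc N) (fst \<omega>) (snd \<omega>)) - G (fst \<omega>) (snd \<omega>) =
      (D 0 \<omega> (h (fst \<omega>)) - (\<Sum>m<n. D m \<omega> 0 / fact m * h (fst \<omega>) ^ m)) +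
      (\<Sum>m<n. 1 / fact m * (h (fst \<omega>) ^ m * (\<beta> m (pt d x N (fst \<omega>) (snd \<omega>)) - F m (fst \<omega>) (snd \<omega>))
      + F m (fst \<omega>) (snd \<omega>) * (h (fst \<omega>) ^ m - X (fst \<omega>) ^ m)))" for \<omega>
    proof -
      have "(\<Sum>m<n. 1 / fact m * (h (fst \<omega>) ^ m * (\<beta> m (pt d x N (fst \<omega>) (snd \<omega>)) - F m (fst \<omega>) (snd \<omega>))
          + F m (fst \<omega>) (snd \<omega>) * (h (fst \<omega>) ^ m - X (fst \<omega>) ^ m)))
        = (\<Sum>m<n. D m \<omega> 0 / fact m * h (fst \<omega>) ^ m) - G (fst \<omega>) (snd \<omega>)"
        unfolding D0 G_def sum_subtractf[symmetric] by (intro sum.cong refl) (simp add: field_simps)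
      then show ?thesis unfolding Dh by simp
    qed
    then show ?thesis using sum_in_smallo(1)[OF T S] by simp
  qed
  ultimately show ?case by blast
qed

lemma prodset_box:
  assumes "openR d P" "open V" "K \<subseteq> V" "(\<lambda>i. if i < d then p0 i else 0) \<in> P"
  obtains \<delta> where "\<delta> > 0" "{z \<in> emb (Suc d). (\<forall>i<d. \<bar>z i - p0 i\<bar> \<le> \<delta>) \<and> z d \<in> K} \<subseteq> prodset d P V"
proof -
  obtain \<delta> where \<delta>: "\<delta> > 0"
    "\<And>z. z \<in> emb d \<Longrightarrow> (\<And>i. i < d \<Longrightarrow> \<bar>z i - (if i < d then p0 i else 0)\<bar> \<le> \<delta>) \<Longrightarrow> z \<in> P"
    using openR_box[OF assms(1,4)] by metis
  have "z \<in> prodset d P V" if "z \<in> emb (Suc d)" "\<forall>i<d. \<bar>z i - p0 i\<bar> \<le> \<delta>" "z d \<in> K" for z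
  proof -
    have "(\<lambda>i. if i < d then z i else 0) \<in> P"
      by (rule \<delta>(2)) (use that(2) in \<open>auto simp: emb_def\<close>)
    then show ?thesis using that assms(3) by (auto simp: prodset_def)
  qed
  then show ?thesis using that[OF \<delta>(1)] by blast
qed

lemma Cinf_expansion:
  assumes "openR d P" and V: "open V" and K: "compact K" "K \<subseteq> V"
    and x: "\<And>i. i < d \<Longrightarrow> x i \<in> Ro" and P: "(\<lambda>i. if i < d then x i 0 else 0) \<in> P"
    and \<alpha>: "Cinf (Suc d) (prodset d P V) \<alpha>"
  obtains F where "power_family V F"
    "(\<lambda>\<omega>. \<alpha> (pt d x d (fst \<omega>) (snd \<omega>)) - F (fst \<omega>) (snd \<omega>)) \<in> o[unif K](fst)"
proof -
  obtain \<delta> where \<delta>: "\<delta> > 0" "{z \<in> emb (Suc d). (\<forall>i<d. \<bar>z i - x i 0\<bar> \<le> \<delta>) \<and> z d \<in> K} \<subseteq> prodset d P V"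
    using prodset_box[OF assms(1) V K(2) P] by blast
  have eq: "(\<lambda>i. if i < d then pt d x 0 0 y i else 0) = (\<lambda>i. if i < d then x i 0 else 0)" for y
    by (auto simp: pt_def)
  have "pt d x 0 0 y \<in> prodset d P V" if "y \<in> V" for y
    unfolding prodset_def using that P by (simp add: eq) (simp add: emb_def pt_def)
  from Cinf_expansion_partial[where d = d and N = d, OF x V K \<delta> this order_refl \<alpha>]
  show ?thesis using that by blast
qed

text \<open>The increment is controlled by the supremum of \<open>R'\<close> over the interval, so
  an o(t) bound at each single y would not suffice.\<close>

lemma unif_MVT:
  assumes D: "\<And>t y. 0 \<le> t \<Longrightarrow> t < e \<Longrightarrow> y \<in> {l..u} \<Longrightarrow> (R t has_real_derivative R' t y) (at y)"
    and e: "e > 0" and small: "(\<lambda>\<omega>. R' (fst \<omega>) (snd \<omega>)) \<in> o[unif {l..u}](fst)"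
    and y: "y \<in> {l..u}" "y0 \<in> {l..u}"
  shows "fsim (\<lambda>t. R t y) (\<lambda>t. R t y0)"
  unfolding fsim_iff
proof (rule landau_o.smallI)
  fix c :: real assume "c > 0"
  \<comment> \<open>The summand 1 avoids division by 0 when y = y0.\<close>
  define b where "b = c / (\<bar>y - y0\<bar> + 1)"
  have b: "b > 0" "b * \<bar>y - y0\<bar> \<le> c"
    using \<open>c > 0\<close> unfolding b_def by (simp_all add: field_simps)
  have "eventually (\<lambda>\<omega>. norm (R' (fst \<omega>) (snd \<omega>)) \<le> b * norm (fst \<omega>)) (unif {l..u})"
    by (rule landau_o.smallD[OF small b(1)])
  then obtain Pf Pg where *: "eventually Pf germ0" "\<forall>y\<in>{l..u}. Pg y"
      "\<And>t y. Pf t \<Longrightarrow> Pg y \<Longrightarrow> norm (R' t y) \<le> b * norm t"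
    unfolding unif_def eventually_prod_filter eventually_principal by auto
  have "eventually (\<lambda>t. 0 \<le> t \<and> t < e) germ0" using e unfolding eventually_germ0 by blast
  with *(1) show "eventually (\<lambda>t. norm (R t y - R t y0) \<le> c * norm t) germ0"
  proof eventually_elim
    case (elim t)
    have "norm (R t y - R t y0) \<le> (b * norm t) * norm (y - y0)"
    proof (rule field_differentiable_bound[of "{l..u}" "R t" "R' t"])
      show "(R t has_field_derivative R' t z) (at z within {l..u})" if "z \<in> {l..u}" for z
        using D[of t z] elim(2) that by (simp add: has_field_derivative_at_within)
      show "norm (R' t z) \<le> b * norm t" if "z \<in> {l..u}" for z
        using *(3)[OF elim(1)] *(2) that by blast
    qed (use y in auto)
    also have "\<dots> = (b * \<bar>y - y0\<bar>) * norm t" by simp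
    also have "\<dots> \<le> c * norm t" by (rule mult_right_mono[OF b(2)]) simp
    finally show ?case .
  qed
qed

text \<open>
  That \<open>pdiff d \<alpha>\<close> expands to the derivative of the expansion of \<open>\<alpha>\<close> would follow from symmetry of
  mixed partial derivatives. Instead, an antiderivative of the expansion of \<open>pdiff d \<alpha>\<close> is compared
  with the expansion of \<open>\<alpha>\<close> by the mean value theorem, which needs the uniform remainder.
\<close>

lemma Cinf_expansion_deriv:
  assumes P: "openR d P" and V: "open V" and lu: "{l..u} \<subseteq> V"
    and x: "\<And>i. i < d \<Longrightarrow> x i \<in> Ro" and p0: "(\<lambda>i. if i < d then x i 0 else 0) \<in> P"
    and \<alpha>: "Cinf (Suc d) (prodset d P V) \<alpha>"
  obtains F where "power_family {l<..<u} F"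
    "\<And>y. y \<in> Ro \<Longrightarrow> y 0 \<in> {l<..<u} \<Longrightarrow> fsim (\<lambda>t. \<alpha> (pt d x d t (y t))) (\<lambda>t. F t (y t))"
    "\<And>y. y \<in> Ro \<Longrightarrow> y 0 \<in> {l<..<u} \<Longrightarrow> fsim (\<lambda>t. pdiff d \<alpha> (pt d x d t (y t))) (\<lambda>t. dy F t (y t))"
proof -
  let ?I = "{l<..<u}" and ?K = "{l..u}"
  have I: "open ?I" "?I \<subseteq> V" "?I \<subseteq> ?K" using lu by auto
  have \<beta>: "Cinf (Suc d) (prodset d P V) (pdiff d \<alpha>)" by (rule Cinf_pdiff[OF \<alpha>]) simp
  obtain F where F: "power_family V F"
    "(\<lambda>\<omega>. \<alpha> (pt d x d (fst \<omega>) (snd \<omega>)) - F (fst \<omega>) (snd \<omega>)) \<in> o[unif ?K](fst)"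
    using Cinf_expansion[OF P V compact_Icc lu x p0 \<alpha>] by blast
  obtain G where G: "power_family V G"
    "(\<lambda>\<omega>. pdiff d \<alpha> (pt d x d (fst \<omega>) (snd \<omega>)) - G (fst \<omega>) (snd \<omega>)) \<in> o[unif ?K](fst)"
    using Cinf_expansion[OF P V compact_Icc lu x p0 \<beta>] by blast
  have inK: "eventually (\<lambda>t. y t \<in> ?K) germ0" if "y \<in> Ro" "y 0 \<in> ?I" for y
    by (rule eventually_mono[OF Ro_eventually_in[OF that(1) I(1) that(2)]]) (use I(3) in blast)
  have 1: "fsim (\<lambda>t. \<alpha> (pt d x d t (y t))) (\<lambda>t. F t (y t))" if "y \<in> Ro" "y 0 \<in> ?I" for y
    unfolding fsim_iff
    using unif_smalloD[OF F(2) inK[OF that]] .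
  have 2: "fsim (\<lambda>t. pdiff d \<alpha> (pt d x d t (y t))) (\<lambda>t. G t (y t))" if "y \<in> Ro" "y 0 \<in> ?I" for y
    unfolding fsim_iff
    using unif_smalloD[OF G(2) inK[OF that]] .
  have FI: "power_family ?I F" "power_family ?I G"
    by (rule power_family_subset[OF F(1) I(2)], rule power_family_subset[OF G(1) I(2)])
  obtain \<Phi> where \<Phi>: "power_family ?I \<Phi>" "\<And>t y. y \<in> ?I \<Longrightarrow> dy \<Phi> t y = G t y"
    using power_family_antiderivative[OF FI(2)] by blast
  obtain \<delta> where \<delta>: "\<delta> > 0" "{z \<in> emb (Suc d). (\<forall>i<d. \<bar>z i - x i 0\<bar> \<le> \<delta>) \<and> z d \<in> ?K} \<subseteq> prodset d P V"
    using prodset_box[OF P V lu p0] by blast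
  have "eventually (\<lambda>t. \<bar>x i t - x i 0\<bar> \<le> \<delta>) germ0" if "i < d" for i
    using tendstoD[OF infinitesimal_tendsto[OF Ro_infinitesimal[OF x[OF that]]] \<delta>(1)]
    by (rule eventually_mono) simp
  then have "eventually (\<lambda>t. \<forall>i\<in>{..<d}. \<bar>x i t - x i 0\<bar> \<le> \<delta>) germ0"
    by (intro eventually_ball_finite) simp_all
  then obtain e where e: "e > 0" "\<And>t. 0 \<le> t \<Longrightarrow> t < e \<Longrightarrow> \<forall>i\<in>{..<d}. \<bar>x i t - x i 0\<bar> \<le> \<delta>"
    unfolding eventually_germ0 by blast
  have inU: "pt d x d t y \<in> prodset d P V" if "0 \<le> t" "t < e" "y \<in> ?K" for t y
  proof -
    have "pt d x d t y \<in> {z \<in> emb (Suc d). (\<forall>i<d. \<bar>z i - x i 0\<bar> \<le> \<delta>) \<and> z d \<in> ?K}"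
      using e(2)[OF that(1,2)] that(3) by (auto simp: pt_def emb_def)
    then show ?thesis using \<delta>(2) by blast
  qed
  have pt_upd: "pt d x d t y = (pt d x d t 0)(d := y)" for t y by (auto simp: pt_def)
  \<comment> \<open>The y-derivative of this difference is the uniformly small remainder of the
    expansion of \<open>pdiff d \<alpha>\<close>, so the difference is constant in y modulo
    o(t).\<close>
  have R: "fsim (\<lambda>t. \<alpha> (pt d x d t y) - \<Phi> t y) (\<lambda>t. \<alpha> (pt d x d t y0) - \<Phi> t y0)"
    if y: "y \<in> ?I" "y0 \<in> ?I" for y y0
  proof (rule unif_MVT[where l = "min y y0" and u = "max y y0" and e = e and
        R' = "\<lambda>t y. pdiff d \<alpha> (pt d x d t y) - G t y"])
    have sub: "{min y y0..max y y0} \<subseteq> ?I" using y by (auto simp: min_def max_def split: if_splits)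
    show "((\<lambda>y. \<alpha> (pt d x d t y) - \<Phi> t y) has_real_derivative pdiff d \<alpha> (pt d x d t z) - G t z) (at z)"
      if "0 \<le> t" "t < e" "z \<in> {min y y0..max y y0}" for t z
    proof -
      have z: "z \<in> ?I" using that(3) sub by blast
      have "(\<Phi> t has_real_derivative G t z) (at z)"
        using power_family_DERIV[OF \<Phi>(1) I(1) z, of t] unfolding \<Phi>(2)[OF z] .
      moreover have "((\<lambda>y. \<alpha> (pt d x d t y)) has_real_derivative pdiff d \<alpha> (pt d x d t z)) (at z)"
        using Cinf_DERIV[OF \<alpha> lessI, of "pt d x d t 0" z] inU[OF that(1,2)] z I(3)
        unfolding pt_upd[symmetric] by blast
      ultimately show ?thesis by (intro DERIV_diff)
    qed
    have "filterlim (\<lambda>\<omega>. \<omega>) (unif ?K) (unif {min y y0..max y y0})"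
      unfolding unif_def filterlim_def filtermap_ident
      by (intro prod_filter_mono order_refl) (use sub I(3) in auto)
    from landau_o.small.compose[OF G(2) this]
    show "(\<lambda>\<omega>. pdiff d \<alpha> (pt d x d (fst \<omega>) (snd \<omega>)) - G (fst \<omega>) (snd \<omega>)) \<in> o[unif {min y y0..max y y0}](fst)"
      by simp
  qed (use e(1) in auto)
  have dF: "fsim (\<lambda>t. dy F t (y t)) (\<lambda>t. G t (y t))" if y: "y \<in> Ro" "y 0 \<in> ?I" for y
  proof -
    define y0 where "y0 = y 0"
    have y0: "y0 \<in> ?I" using y unfolding y0_def by simp
    \<comment> \<open>Subtracting the value at \<open>y0\<close> makes \<open>H\<close> vanish
      modulo o(t) at every real point and leaves its y-derivative equal to
      \<open>dy F - G\<close>.\<close>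
    define H where "H t z = (F t z - \<Phi> t z) - (F t y0 - \<Phi> t y0)" for t z
    \<comment> \<open>The subtracted function of t is itself an exact power sum, with the
      coefficients evaluated at \<open>y0\<close>.\<close>
    obtain E c where Ec: "pcoeffs ?I (\<lambda>t z. F t z - \<Phi> t z) E c"
      using power_family_diff[OF I(1) FI(1) \<Phi>(1)] unfolding power_family_def by blast
    have "power_family ?I (\<lambda>t z. \<Sum>q\<in>E. c q y0 * pw t q)"
      by (intro power_family_sum I(1) power_family_term smooth_on_const pcoeffsD(2)[OF Ec])
    then have H0: "power_family ?I (\<lambda>t z. F t y0 - \<Phi> t y0)"
      unfolding pcoeffsD(4)[OF Ec y0] .
    have H: "power_family ?I H" unfolding H_def
      by (rule power_family_diff[OF I(1) power_family_diff[OF I(1) FI(1) \<Phi>(1)] H0])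
    have van: "fsim (\<lambda>t. H t z) (\<lambda>t. 0)" if "z \<in> ?I" for z
    proof -
      have Fz: "fsim (\<lambda>t. F t w) (\<lambda>t. \<alpha> (pt d x d t w))" if "w \<in> ?I" for w
        using fsim_sym[OF 1[OF Ro_const, of w]] that by blast
      have "fsim (\<lambda>t. (F t z - \<Phi> t z) - (F t y0 - \<Phi> t y0))
          (\<lambda>t. (\<alpha> (pt d x d t z) - \<Phi> t z) - (\<alpha> (pt d x d t y0) - \<Phi> t y0))"
        by (intro fsim_diff Fz fsim_refl \<open>z \<in> ?I\<close> y0)
      also have "fsim \<dots> (\<lambda>t. (\<alpha> (pt d x d t y0) - \<Phi> t y0) - (\<alpha> (pt d x d t y0) - \<Phi> t y0))"
        by (intro fsim_diff R fsim_refl \<open>z \<in> ?I\<close> y0)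
      finally show ?thesis unfolding H_def by simp
    qed
    have cl: "y 0 \<in> closure ?I" using y(2) closure_subset by blast
    have "fsim (\<lambda>t. dy H t (y t)) (\<lambda>t. 0)"
      by (rule power_family_vanishing(2)[OF H I(1) I(1) order_refl van y cl])
    moreover have "dy H t z = dy F t z - G t z" if "z \<in> ?I" for t z
    proof -
      have "((\<lambda>z. (F t z - \<Phi> t z) - (F t y0 - \<Phi> t y0)) has_real_derivative (dy F t z - dy \<Phi> t z) - 0) (at z)"
        by (intro DERIV_diff DERIV_const power_family_DERIV[OF FI(1) I(1) that] power_family_DERIV[OF \<Phi>(1) I(1) that])
      then have "(H t has_real_derivative dy F t z - G t z) (at z)"
        unfolding \<Phi>(2)[OF that] H_def[abs_def] by simp
      then show ?thesis unfolding dy_def[of H] by (rule DERIV_imp_deriv)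
    qed
    then have "fsim (\<lambda>t. dy H t (y t)) (\<lambda>t. dy F t (y t) - G t (y t))"
      by (intro fsim_eventually_eq eventually_mono[OF Ro_eventually_in[OF y(1) I(1) y(2)]])
    ultimately have "fsim (\<lambda>t. dy F t (y t) - G t (y t)) (\<lambda>t. 0)"
      using fsim_trans fsim_sym by blast
    then show ?thesis by (simp add: fsim_iff)
  qed
  have 3: "fsim (\<lambda>t. pdiff d \<alpha> (pt d x d t (y t))) (\<lambda>t. dy F t (y t))" if "y \<in> Ro" "y 0 \<in> ?I" for y
    by (rule fsim_trans[OF 2[OF that] fsim_sym[OF dF[OF that]]])
  show ?thesis by (rule that[OF FI(1) 1 3])
qed


section \<open>Operations on Fermat reals\<close>

lemma rep_in_Rep: "rep x \<in> Rep_fermat x"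
proof -
  obtain r where "r \<in> Ro" "Rep_fermat x = {y \<in> Ro. fsim r y}" using Rep_fermat[of x] by blast
  then have "r \<in> Rep_fermat x" by simp
  then show ?thesis unfolding rep_def by (rule someI[of "\<lambda>r. r \<in> Rep_fermat x"])
qed

lemma in_Rep_fermat_iff: "y \<in> Rep_fermat x \<longleftrightarrow> y \<in> Ro \<and> fsim (rep x) y"
proof -
  obtain r where r: "r \<in> Ro" "Rep_fermat x = {y \<in> Ro. fsim r y}" using Rep_fermat[of x] by blast
  with rep_in_Rep[of x] have "fsim r (rep x)" by simp
  then show ?thesis unfolding r(2) using fsim_trans fsim_sym by blast
qed

lemma rep_Ro: "rep x \<in> Ro"
  using rep_in_Rep[of x] in_Rep_fermat_iff by blast

lemma Rep_cls: "r \<in> Ro \<Longrightarrow> Rep_fermat (cls r) = {y \<in> Ro. fsim r y}"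
  unfolding cls_def by (rule Abs_fermat_inverse) blast

lemma rep_cls: "r \<in> Ro \<Longrightarrow> fsim (rep (cls r)) r"
  using rep_in_Rep[of "cls r"] by (simp add: Rep_cls fsim_sym)

lemma cls_eqI: "fsim r s \<Longrightarrow> cls r = cls s"
proof -
  assume "fsim r s"
  then have "{y \<in> Ro. fsim r y} = {y \<in> Ro. fsim s y}" using fsim_trans fsim_sym by blast
  then show ?thesis unfolding cls_def by simp
qed

lemma cls_eqD: "cls r = cls s \<Longrightarrow> r \<in> Ro \<Longrightarrow> s \<in> Ro \<Longrightarrow> fsim r s"
  using rep_cls fsim_trans fsim_sym by metis

lemma cls_rep: "cls (rep x) = x"
proof -
  have "{y \<in> Ro. fsim (rep x) y} = Rep_fermat x" using in_Rep_fermat_iff by blast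
  then show ?thesis unfolding cls_def by (simp add: Rep_fermat_inverse)
qed

lemma cls_mult:
  assumes "r \<in> Ro" "s \<in> Ro" shows "cls r * cls s = cls (\<lambda>t. r t * s t)"
  unfolding times_fermat_def
  by (intro cls_eqI fsim_mult rep_cls assms Ro_bounded rep_Ro)

text \<open>The square unfolds to \<open>x * (x * 1)\<close>; that 1 is neutral is derived from
  representatives.\<close>

lemma power2_fermat: "(x::fermat)\<^sup>2 = x * x"
proof -
  have "x * 1 = cls (rep x) * cls (\<lambda>t. 1)" by (simp add: cls_rep one_fermat_def)
  also have "\<dots> = cls (\<lambda>t. rep x t * 1)" by (rule cls_mult[OF rep_Ro Ro_const])
  also have "\<dots> = x" by (simp add: cls_rep)
  finally show ?thesis by (simp add: numeral_2_eq_2)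
qed

lemma st_cls: "r \<in> Ro \<Longrightarrow> st (cls r) = r 0"
  unfolding st_def by (rule fsim_at_0[OF rep_cls])

text \<open>Evaluate the comparison of representatives at t = 0, where z vanishes.\<close>

lemma st_mono: assumes "x \<le> y" shows "st x \<le> st y"
proof -
  obtain xr yr z where *: "xr \<in> Rep_fermat x" "yr \<in> Rep_fermat y" "fsim z (\<lambda>t. 0)"
    and le: "\<exists>\<delta>>0. \<forall>t. 0 \<le> t \<and> t < \<delta> \<longrightarrow> xr t \<le> yr t + z t"
    using assms unfolding less_eq_fermat_def by blast
  have "eventually (\<lambda>t. xr t \<le> yr t + z t) germ0" using le unfolding eventually_germ0 .
  then have "xr 0 \<le> yr 0 + z 0" by (rule eventually_germ0_at_0)
  moreover have "rep x 0 = xr 0" "rep y 0 = yr 0" "z 0 = 0"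
    using * by (auto simp: in_Rep_fermat_iff dest: fsim_at_0)
  ultimately show ?thesis by (simp add: st_def)
qed

lemma cls_leI:
  assumes "r \<in> Ro" "s \<in> Ro" "eventually (\<lambda>t. r t \<le> s t) germ0"
  shows "cls r \<le> cls s"
  unfolding less_eq_fermat_def Rep_cls[OF assms(1)] Rep_cls[OF assms(2)]
proof (rule bexI[of _ r], rule bexI[of _ s], rule bexI[of _ "\<lambda>t. 0"], rule conjI)
  show "\<exists>\<delta>>0. \<forall>t. 0 \<le> t \<and> t < \<delta> \<longrightarrow> r t \<le> s t + 0"
    using assms(3) unfolding eventually_germ0 by simp
qed (use assms in \<open>simp_all add: Ro_const\<close>)

lemma le_if_st_less: assumes "st x < st y" shows "x \<le> y" "x \<noteq> y"
proof -
  have "rep x \<in> Ro" "rep y \<in> Ro" by (rule rep_Ro)+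
  then have "eventually (\<lambda>t. rep y t - rep x t > 0) germ0"
    by (intro order_tendstoD(1)[OF Ro_tendsto[OF Ro_diff]]) (use assms in \<open>simp_all add: st_def\<close>)
  then have "eventually (\<lambda>t. rep x t \<le> rep y t) germ0" by (rule eventually_mono) simp
  from cls_leI[OF rep_Ro rep_Ro this] show "x \<le> y" by (simp add: cls_rep)
  show "x \<noteq> y" using assms by blast
qed


section \<open>Intervals\<close>

text \<open>A form common to the four kinds of brackets. \<open>A\<close> and \<open>B\<close> are
  the standard parts of the ends; J may contain points infinitely near them while the real end point
  itself is missing.\<close>

definition spans :: "fermat set \<Rightarrow> ereal \<Rightarrow> ereal \<Rightarrow> bool" where
  "spans J A B \<longleftrightarrow> A < B \<and> (\<forall>x\<in>J. A \<le> ereal (st x) \<and> ereal (st x) \<le> B) \<and>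
     (\<forall>r. A < ereal r \<and> ereal r < B \<longrightarrow> cls (\<lambda>t. r) \<in> J)"

lemma ele_est: "ele a b \<Longrightarrow> est a \<le> est b"
  by (cases a; cases b) (simp_all add: st_mono)

lemma elt_est: "est a < est b \<Longrightarrow> elt a b"
  by (cases a; cases b) (auto simp: elt_def le_if_st_less)

lemma noninf_interval_spans:
  assumes "noninf_interval J" obtains A B where "spans J A B"
proof -
  obtain a b where ab: "est a < est b" and J: "J = {x. ele a (Fin x) \<and> ele (Fin x) b} \<or>
      J = {x. elt a (Fin x) \<and> elt (Fin x) b} \<or>
      J = {x. ele a (Fin x) \<and> elt (Fin x) b} \<or>
      J = {x. elt a (Fin x) \<and> ele (Fin x) b}"
    using assms unfolding noninf_interval_def by blast
  have el: "elt c d \<Longrightarrow> ele c d" for c d by (simp add: elt_def)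
  have "est a \<le> ereal (st x) \<and> ereal (st x) \<le> est b" if "x \<in> J" for x
  proof -
    have "ele a (Fin x)" "ele (Fin x) b" using J that el by blast+
    then show ?thesis using ele_est[of a "Fin x"] ele_est[of "Fin x" b] by simp
  qed
  moreover have "cls (\<lambda>t. r) \<in> J" if "est a < ereal r" "ereal r < est b" for r
  proof -
    have "elt a (Fin (cls (\<lambda>t. r)))" "elt (Fin (cls (\<lambda>t. r))) b"
      by (rule elt_est; use that in \<open>simp add: st_cls Ro_const\<close>)+
    then show ?thesis using J el by blast
  qed
  ultimately have "spans J (est a) (est b)" unfolding spans_def using ab by blast
  then show ?thesis by (rule that)
qed

text \<open>Under \<open>spans\<close> these real points of the window (l, u) belong to J; functions
  on J are sampled at them.\<close>

definition core :: "ereal \<Rightarrow> ereal \<Rightarrow> real \<Rightarrow> real \<Rightarrow> real set" where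
  "core A B l u = {r. l < r \<and> r < u \<and> A < ereal r \<and> ereal r < B}"

lemma open_core: "open (core A B l u)"
  unfolding core_def by (intro open_Collect_conj open_Collect_less continuous_intros continuous_on_ereal)

lemma convex_core: "convex (core A B l u)"
proof -
  have "is_interval (core A B l u)" unfolding is_interval_1 core_def
    by (auto intro: less_le_trans le_less_trans simp: order.strict_trans1 order.strict_trans2)
      (meson ereal_less_eq(3) less_le_trans le_less_trans)+
  then show ?thesis by (simp add: is_interval_convex_1)
qed

lemma core_subset: "core A B l u \<subseteq> {l<..<u}"
  unfolding core_def by auto

text \<open>Because A < B, the point x coincides with at most one end: it is approached from the
  right if x < B and from the left otherwise.\<close>

lemma closure_core:
  assumes "A < B" "A \<le> ereal x" "ereal x \<le> B" "l < x" "x < u"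
  shows "x \<in> closure (core A B l u)"
  unfolding closure_approachable
proof (intro allI impI)
  fix e :: real assume "e > 0"
  show "\<exists>y\<in>core A B l u. dist y x < e"
  proof (cases "ereal x < B")
    case True
    then have "ereal x < min B (ereal (min u (x + e)))" using assms \<open>e > 0\<close> by simp
    then obtain y where y: "ereal x < ereal y" "ereal y < min B (ereal (min u (x + e)))"
      using ereal_dense2 by blast
    have "A < ereal y" using assms(2) y(1) by (rule le_less_trans)
    with y assms have "y \<in> core A B l u" "dist y x < e" by (simp_all add: core_def dist_real_def)
    then show ?thesis by blast
  next
    case False
    then have B: "B = ereal x" using assms(3) by simp
    then have "max A (ereal (max l (x - e))) < ereal x" using assms \<open>e > 0\<close> by simp
    then obtain y where y: "max A (ereal (max l (x - e))) < ereal y" "ereal y < ereal x"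
      using ereal_dense2 by blast
    have "ereal y < B" using y(2) B by simp
    with y assms have "y \<in> core A B l u" "dist y x < e" by (simp_all add: core_def dist_real_def)
    then show ?thesis by blast
  qed
qed

lemma spans_closure_core:
  "spans J A B \<Longrightarrow> x \<in> J \<Longrightarrow> l < st x \<Longrightarrow> st x < u \<Longrightarrow> rep x 0 \<in> closure (core A B l u)"
  unfolding spans_def by (fold st_def, intro closure_core) blast+


section \<open>Local representations\<close>

text \<open>Working form of \<open>local_rep\<close>: the Fermat parameters are absorbed into real
  powers of t, and the window is an interval of standard parts. By
  \<open>power_family_comp_fsim\<close> any other representative of y gives the same class.\<close>

definition represents :: "fermat set \<Rightarrow> (fermat \<Rightarrow> fermat) \<Rightarrow> real \<Rightarrow> real \<Rightarrow> (real \<Rightarrow> real \<Rightarrow> real) \<Rightarrow> bool" where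
  "represents J f l u F \<longleftrightarrow> power_family {l<..<u} F \<and>
     (\<forall>y\<in>J. l < st y \<and> st y < u \<longrightarrow> f y = cls (\<lambda>t. F t (rep y t)))"

lemma representsD: "represents J f l u F \<Longrightarrow> power_family {l<..<u} F"
  "represents J f l u F \<Longrightarrow> y \<in> J \<Longrightarrow> l < st y \<Longrightarrow> st y < u \<Longrightarrow> f y = cls (\<lambda>t. F t (rep y t))"
  unfolding represents_def by blast+

lemma represents_subset: "represents J f l u F \<Longrightarrow> l \<le> l' \<Longrightarrow> u' \<le> u \<Longrightarrow> represents J f l' u' F"
  unfolding represents_def
proof (elim conjE, intro conjI ballI impI)
  assume "power_family {l<..<u} F" "l \<le> l'" "u' \<le> u"
  then show "power_family {l'<..<u'} F" by (rule_tac power_family_subset) auto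
qed auto

lemma represents_comp_Ro:
  assumes "power_family {l<..<u} F" "l < st y" "st y < u" shows "(\<lambda>t. F t (rep y t)) \<in> Ro"
  by (rule power_family_comp_Ro[OF assms(1) open_greaterThanLessThan rep_Ro]) (use assms in \<open>simp add: st_def\<close>)

lemma eventually_rep_in:
  assumes "l < st y" "st y < u" shows "eventually (\<lambda>t. rep y t \<in> {l<..<u}) germ0"
  by (rule Ro_eventually_in[OF rep_Ro]) (use assms in \<open>simp_all add: st_def\<close>)

lemma represents_cong:
  assumes "represents J f l u F" "\<And>t y. y \<in> {l<..<u} \<Longrightarrow> G t y = F t y" shows "represents J f l u G"
  unfolding represents_def
proof (intro conjI ballI impI)
  show "power_family {l<..<u} G" by (rule power_family_cong[OF representsD(1)[OF assms(1)] assms(2)])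
  fix y assume y: "y \<in> J" "l < st y \<and> st y < u"
  have "f y = cls (\<lambda>t. F t (rep y t))" using representsD(2)[OF assms(1)] y by blast
  also have "\<dots> = cls (\<lambda>t. G t (rep y t))"
    using y(2) by (intro cls_eqI fsim_eventually_eq eventually_mono[OF eventually_rep_in[of l y u]])
      (simp_all add: assms(2))
  finally show "f y = cls (\<lambda>t. G t (rep y t))" .
qed

lemma represents_mult:
  assumes "represents J f l u F" "represents J g l u G"
  shows "represents J (\<lambda>x. f x * g x) l u (\<lambda>t y. F t y * G t y)"
  unfolding represents_def
proof (intro conjI ballI impI)
  show "power_family {l<..<u} (\<lambda>t y. F t y * G t y)"
    by (intro power_family_mult open_greaterThanLessThan representsD(1)[OF assms(1)] representsD(1)[OF assms(2)])
  fix y assume y: "y \<in> J" "l < st y \<and> st y < u"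
  have "f y = cls (\<lambda>t. F t (rep y t))" "g y = cls (\<lambda>t. G t (rep y t))"
    using representsD(2)[OF assms(1)] representsD(2)[OF assms(2)] y by blast+
  moreover have "(\<lambda>t. F t (rep y t)) \<in> Ro" "(\<lambda>t. G t (rep y t)) \<in> Ro"
    using represents_comp_Ro[OF representsD(1)] assms y(2) by blast+
  ultimately show "f y * g y = cls (\<lambda>t. F t (rep y t) * G t (rep y t))"
    by (simp add: cls_mult)
qed

text \<open>Evaluating f at the constant point y, which \<open>spans\<close> puts into J, turns
  equality of classes into a congruence of functions of t.\<close>

lemma represents_agree:
  assumes J: "spans J A B" and F: "represents J f l u F" and G: "represents J f l u G" and y: "y \<in> core A B l u"
  shows "fsim (\<lambda>t. F t y) (\<lambda>t. G t y)"
proof -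
  define Y where "Y = cls (\<lambda>t. y)"
  have Y: "Y \<in> J" "l < st Y" "st Y < u"
    using J y unfolding spans_def core_def Y_def by (simp_all add: st_cls Ro_const)
  have repY: "fsim (rep Y) (\<lambda>t. y)" unfolding Y_def by (rule rep_cls[OF Ro_const])
  have *: "fsim (\<lambda>t. H t (rep Y t)) (\<lambda>t. H t y)" if "power_family {l<..<u} H" for H
    by (rule power_family_comp_fsim[OF that open_greaterThanLessThan Ro_const subsetD[OF core_subset y] repY])
  have "fsim (\<lambda>t. F t (rep Y t)) (\<lambda>t. G t (rep Y t))"
    using representsD(2)[OF F Y] representsD(2)[OF G Y]
    by (intro cls_eqD represents_comp_Ro[OF representsD(1)[OF F] Y(2,3)] represents_comp_Ro[OF representsD(1)[OF G] Y(2,3)]) simp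
  with *[OF representsD(1)[OF F]] *[OF representsD(1)[OF G]] show ?thesis
    using fsim_trans fsim_sym by blast
qed

lemma dy_diff:
  assumes "power_family V F" "power_family V G" "open V" "y \<in> V"
  shows "dy (\<lambda>t y. F t y - G t y) t y = dy F t y - dy G t y"
proof -
  have "((\<lambda>y. F t y - G t y) has_real_derivative dy F t y - dy G t y) (at y)"
    by (intro DERIV_diff power_family_DERIV[OF assms(1,3,4)] power_family_DERIV[OF assms(2,3,4)])
  then show ?thesis unfolding dy_def[of "\<lambda>t y. F t y - G t y"] by (rule DERIV_imp_deriv)
qed

text \<open>The difference of F and G is o(t) at the real points of the common window, and
  \<open>power_family_vanishing\<close> passes this on to the derivative along \<open>rep x\<close>,
  even when \<open>st x\<close> is an end point.\<close>

lemma represents_dy_unique: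
  assumes J: "spans J A B" and F: "represents J f l u F" and G: "represents J f l' u' G"
    and x: "x \<in> J" "l < st x" "st x < u" "l' < st x" "st x < u'"
  shows "fsim (\<lambda>t. dy F t (rep x t)) (\<lambda>t. dy G t (rep x t))"
proof -
  define L U where "L = max l l'" and "U = min u u'"
  let ?V = "{L<..<U}"
  have x': "L < st x" "st x < U" using x by (simp_all add: L_def U_def)
  have F': "represents J f L U F" and G': "represents J f L U G"
    by (rule represents_subset[OF F]; simp add: L_def U_def)
       (rule represents_subset[OF G]; simp add: L_def U_def)
  note P = representsD(1)[OF F'] representsD(1)[OF G']
  have "fsim (\<lambda>t. F t y - G t y) (\<lambda>t. 0)" if "y \<in> core A B L U" for y
    using represents_agree[OF J F' G' that] by (simp add: fsim_iff)
  then have "fsim (\<lambda>t. dy (\<lambda>t y. F t y - G t y) t (rep x t)) (\<lambda>t. 0)"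
    using spans_closure_core[OF J x(1) x'] x'
    by (intro power_family_vanishing(2)[where V = ?V and I = "core A B L U"] power_family_diff P open_core
        core_subset open_greaterThanLessThan rep_Ro) (simp_all add: st_def)
  moreover have "fsim (\<lambda>t. dy (\<lambda>t y. F t y - G t y) t (rep x t)) (\<lambda>t. dy F t (rep x t) - dy G t (rep x t))"
    by (rule fsim_eventually_eq, rule eventually_mono[OF eventually_rep_in[OF x']],
        rule dy_diff[OF P open_greaterThanLessThan])
  ultimately have "fsim (\<lambda>t. dy F t (rep x t) - dy G t (rep x t)) (\<lambda>t. 0)"
    using fsim_trans fsim_sym by blast
  then show ?thesis by (simp add: fsim_iff)
qed

lemma ext_fun_pt: "ext_fun d \<alpha> p y = cls (\<lambda>t. \<alpha> (pt d (\<lambda>i. rep (p i)) d t (rep y t)))"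
  unfolding ext_fun_def pt_def
  by (intro arg_cong[where f = cls] ext arg_cong[where f = \<alpha>]) simp

text \<open>A closed interval around \<open>st x\<close> inside V is the compact set over which the
  remainder is uniform; one F then accounts for both the values and the derivative.\<close>

lemma local_rep_represents:
  assumes "local_rep J f x V d P p \<alpha>"
  obtains l u F where "l < st x" "st x < u" "represents J f l u F"
    "ext_fun d (pdiff d \<alpha>) p x = cls (\<lambda>t. dy F t (rep x t))"
proof -
  have V: "open V" "st x \<in> V" and P: "openR d P" "stv d p \<in> P"
    and \<alpha>: "Cinf (Suc d) (prodset d P V) \<alpha>"
    and f: "\<And>y. y \<in> J \<Longrightarrow> st y \<in> V \<Longrightarrow> f y = ext_fun d \<alpha> p y"
    using assms unfolding local_rep_def by blast+
  obtain e where e: "e > 0" "cball (st x) e \<subseteq> V" using V open_contains_cball by blast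
  define l u where "l = st x - e" and "u = st x + e"
  have lu: "{l..u} \<subseteq> V" "l < st x" "st x < u"
    using e unfolding l_def u_def by (simp_all add: cball_eq_atLeastAtMost)
  have p0: "(\<lambda>i. if i < d then rep (p i) 0 else 0) \<in> P"
    using P(2) unfolding stv_def st_def .
  obtain F where F: "power_family {l<..<u} F"
    and F1: "\<And>y. y \<in> Ro \<Longrightarrow> y 0 \<in> {l<..<u} \<Longrightarrow> fsim (\<lambda>t. \<alpha> (pt d (\<lambda>i. rep (p i)) d t (y t))) (\<lambda>t. F t (y t))"
    and F2: "\<And>y. y \<in> Ro \<Longrightarrow> y 0 \<in> {l<..<u} \<Longrightarrow> fsim (\<lambda>t. pdiff d \<alpha> (pt d (\<lambda>i. rep (p i)) d t (y t))) (\<lambda>t. dy F t (y t))"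
    using Cinf_expansion_deriv[OF P(1) V(1) lu(1) rep_Ro p0 \<alpha>] by metis
  have "represents J f l u F" unfolding represents_def
  proof (intro conjI ballI impI F)
    fix y assume y: "y \<in> J" "l < st y \<and> st y < u"
    then have "st y \<in> {l..u}" by simp
    then have "st y \<in> V" using lu(1) by blast
    show "f y = cls (\<lambda>t. F t (rep y t))"
      unfolding f[OF y(1) \<open>st y \<in> V\<close>] ext_fun_pt
      using y(2) by (intro cls_eqI F1 rep_Ro) (simp add: st_def)
  qed
  moreover have "ext_fun d (pdiff d \<alpha>) p x = cls (\<lambda>t. dy F t (rep x t))"
    unfolding ext_fun_pt using lu by (intro cls_eqI F2 rep_Ro) (simp add: st_def)
  ultimately show ?thesis using that lu by blast
qed

section \<open>From power families back to local representations\<close>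

text \<open>Functions affine in the first d coordinates, with coefficients smooth in the last one,
  are closed under partial derivatives: coordinate i < d leaves the coefficient \<open>c i\<close>,
  which becomes the free term, and coordinate d differentiates all coefficients.\<close>

lemma affine_Ck:
  assumes V: "open V" and U: "U = {z \<in> emb (Suc d). z d \<in> V}"
  shows "(\<And>k. k < d \<Longrightarrow> smooth_on V (c k)) \<Longrightarrow> smooth_on V e \<Longrightarrow>
    (\<And>z. z \<in> U \<Longrightarrow> \<alpha> z = (\<Sum>k<d. z k * c k (z d)) + e (z d)) \<Longrightarrow> Ck (Suc d) n U \<alpha>"
proof (induction n arbitrary: c e \<alpha>)
  have proj: "continuous_on U (\<lambda>z. z k)" for k
    by (rule continuous_on_subset[OF continuous_on_product_coordinates]) simp
  have cont: "continuous_on U (\<lambda>z. a (z d))" if "smooth_on V a" for a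
  proof (rule continuous_on_compose2[OF _ proj])
    show "continuous_on V a"
      by (intro continuous_at_imp_continuous_on ballI smooth_on_isCont[OF that])
    show "(\<lambda>z. z d) ` U \<subseteq> V" unfolding U by blast
  qed
  have cont': "continuous_on U \<alpha>"
    if "\<And>k. k < d \<Longrightarrow> smooth_on V (c k)" "smooth_on V e"
      "\<And>z. z \<in> U \<Longrightarrow> \<alpha> z = (\<Sum>k<d. z k * c k (z d)) + e (z d)" for c e and \<alpha> :: "(nat \<Rightarrow> real) \<Rightarrow> real"
  proof -
    have "continuous_on U (\<lambda>z. (\<Sum>k<d. z k * c k (z d)) + e (z d))"
      by (intro continuous_on_add continuous_on_sum continuous_on_mult proj cont that) simp
    then show ?thesis by (rule continuous_on_eq) (rule that(3)[symmetric])
  qed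
  {
    case 0
    show ?case using cont'[OF 0] by simp
  next
    case (Suc n)
    note c = Suc.prems(1) and e = Suc.prems(2) and \<alpha> = Suc.prems(3)
    have Di: "((\<lambda>s. \<alpha> (z(i := z i + s))) has_real_derivative c i (z d)) (at 0)"
      if i: "i < d" and z: "z \<in> U" for i z
    proof -
      have zU: "z(i := z i + s) \<in> U" for s using z i unfolding U emb_def by simp
      then have eq: "\<alpha> (z(i := z i + s)) = (\<Sum>k<d. (if k = i then z i + s else z k) * c k (z d)) + e (z d)" for s
        unfolding \<alpha>[OF zU] using i by (simp add: fun_upd_apply)
      have "((\<lambda>s. (if k = i then z i + s else z k) * c k (z d)) has_real_derivative (if k = i then c k (z d) else 0)) (at 0)" for k
        by (cases "k = i") (auto intro!: derivative_eq_intros)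
      then have "((\<lambda>s. (\<Sum>k<d. (if k = i then z i + s else z k) * c k (z d)) + e (z d))
          has_real_derivative (\<Sum>k<d. if k = i then c k (z d) else 0) + 0) (at 0)"
        by (intro DERIV_add DERIV_sum DERIV_const)
      then show ?thesis unfolding eq using i by (simp add: sum.delta)
    qed
    have Dd: "((\<lambda>s. \<alpha> (z(d := z d + s))) has_real_derivative
        (\<Sum>k<d. z k * deriv (c k) (z d)) + deriv e (z d)) (at 0)" if z: "z \<in> U" for z
    proof -
      have zd: "z d \<in> V" using z U by blast
      have sh: "((\<lambda>s. a (z d + s)) has_real_derivative deriv a (z d)) (at 0)" if "smooth_on V a" for a
        using smooth_on_DERIV[OF that zd] DERIV_shift[of a "deriv a (z d)" 0 "z d"] by (simp add: add.commute)
      have D: "((\<lambda>s. (\<Sum>k<d. z k * c k (z d + s)) + e (z d + s)) has_real_derivative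
         (\<Sum>k<d. z k * deriv (c k) (z d)) + deriv e (z d)) (at 0)"
        by (intro DERIV_add DERIV_sum DERIV_cmult sh c e) simp
      have op: "open ((\<lambda>s. z d + s) -` V)"
        by (rule open_vimage[OF V]) (intro continuous_intros)
      have "(\<Sum>k<d. z k * c k (z d + s)) + e (z d + s) = \<alpha> (z(d := z d + s))"
        if "s \<in> (\<lambda>s. z d + s) -` V" for s
      proof -
        have zU: "z(d := z d + s) \<in> U" using z that unfolding U emb_def by simp
        show ?thesis unfolding \<alpha>[OF zU] by (simp add: fun_upd_apply)
      qed
      then show ?thesis
        using has_field_derivative_transform_within_open[OF D op] zd by (simp add: vimage_def)
    qed
    have "(\<lambda>s. \<alpha> (z(i := z i + s))) differentiable (at 0)" if "i < Suc d" "z \<in> U" for i z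
    proof (cases "i < d")
      case True
      from Di[OF this that(2)] show ?thesis unfolding real_differentiable_def by blast
    next
      case False
      then have "i = d" using that(1) by simp
      with Dd[OF that(2)] show ?thesis unfolding real_differentiable_def by blast
    qed
    moreover have "Ck (Suc d) n U (pdiff i \<alpha>)" if "i < Suc d" for i
    proof (cases "i < d")
      case True
      show ?thesis
      \<comment> \<open>This derivative depends on the last coordinate alone: zero linear part and
        free term \<open>c i\<close>.\<close>
      proof (rule Suc.IH[of "\<lambda>_ _. 0" "c i"])
        show "pdiff i \<alpha> z = (\<Sum>k<d. z k * 0) + c i (z d)" if "z \<in> U" for z
          unfolding pdiff_def using DERIV_imp_deriv[OF Di[OF True that]] by simp
      qed (simp_all add: smooth_on_const c True)
    next
      case False
      then have [simp]: "i = d" using that by simp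
      show ?thesis
      proof (rule Suc.IH[of "\<lambda>k. deriv (c k)" "deriv e"])
        show "pdiff i \<alpha> z = (\<Sum>k<d. z k * deriv (c k) (z d)) + deriv e (z d)" if "z \<in> U" for z
          unfolding pdiff_def using DERIV_imp_deriv[OF Dd[OF that]] by simp
      qed (simp_all add: smooth_on_deriv c e)
    qed
    ultimately show ?case using cont'[OF c e \<alpha>] unfolding Ck.simps by blast
  }
qed

text \<open>
  The powers of \<open>t\<close> become the Fermat parameters of the local representation, in which \<open>\<alpha>\<close> is linear.
\<close>

lemma represents_local_rep:
  assumes F: "represents J f l u F" and x: "l < st x" "st x < u"
  shows "\<exists>V d P p \<alpha>. local_rep J f x V d P p \<alpha>"
proof -
  let ?V = "{l<..<u}"
  obtain E c where Ec: "pcoeffs ?V F E c" using representsD(1)[OF F] unfolding power_family_def by blast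
  note Fc = pcoeffsD[OF Ec]
  define d where "d = card E"
  obtain h where h: "bij_betw h {..<d} E"
    using ex_bij_betw_nat_finite[OF Fc(1)] unfolding d_def lessThan_atLeast0 by blast
  have hE: "h k \<in> E" if "k < d" for k using bij_betwE[OF h] that by simp
  define p where "p k = cls (\<lambda>t. pw t (h k))" for k
  \<comment> \<open>The \<open>+ 0\<close> is the free term of the affine form.\<close>
  define \<alpha> where "\<alpha> z = (\<Sum>k<d. z k * c (h k) (z d)) + 0" for z :: "nat \<Rightarrow> real"
  have prod: "prodset d (emb d) ?V = {z \<in> emb (Suc d). z d \<in> ?V}"
    unfolding prodset_def by (auto simp: emb_def)
  have "Ck (Suc d) n (prodset d (emb d) ?V) \<alpha>" for n
    by (rule affine_Ck[OF _ prod, where c = "\<lambda>k. c (h k)" and e = "\<lambda>_. 0"])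
       (simp_all add: Fc(3) hE smooth_on_const \<alpha>_def)
  then have C: "Cinf (Suc d) (prodset d (emb d) ?V) \<alpha>" unfolding Cinf_def by blast
  have "f y = ext_fun d \<alpha> p y" if y: "y \<in> J" "st y \<in> ?V" for y
  proof -
    have y': "rep y 0 \<in> ?V" using y(2) unfolding st_def .
    have "fsim (\<lambda>t. \<alpha> (pt d (\<lambda>i. rep (p i)) d t (rep y t))) (\<lambda>t. \<Sum>k<d. rep (p k) t * c (h k) (rep y t))"
      unfolding \<alpha>_def by (rule fsim_eventually_eq) (simp add: pt_def)
    also have "fsim \<dots> (\<lambda>t. \<Sum>k<d. pw t (h k) * c (h k) (rep y t))"
      unfolding p_def
      by (intro fsim_sum fsim_mult rep_cls fsim_refl Ro_bounded Ro_pw rep_Ro Fc(2) hE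
          smooth_on_comp_Ro[OF Fc(3) open_greaterThanLessThan rep_Ro y']) simp_all
    also have "(\<lambda>t. \<Sum>k<d. pw t (h k) * c (h k) (rep y t)) = (\<lambda>t. \<Sum>q\<in>E. c q (rep y t) * pw t q)"
      unfolding sum.reindex_bij_betw[OF h, symmetric] by (simp add: mult.commute)
    also have "fsim \<dots> (\<lambda>t. F t (rep y t))"
      by (rule fsim_sym[OF power_family_comp_coeffs[OF open_greaterThanLessThan rep_Ro y' Ec]])
    finally have "ext_fun d \<alpha> p y = cls (\<lambda>t. F t (rep y t))" unfolding ext_fun_pt by (rule cls_eqI)
    then show ?thesis using representsD(2)[OF F y(1)] y(2) by simp
  qed
  moreover have "openR d (emb d)" unfolding openR_def by (intro exI[of _ UNIV]) simp
  moreover have "stv d p \<in> emb d" unfolding stv_def emb_def by simp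
  ultimately have "local_rep J f x ?V d (emb d) p \<alpha>"
    unfolding local_rep_def using C x by (intro conjI ballI impI) simp_all
  then show ?thesis by blast
qed

lemma fsmooth_iff_represents: "fsmooth J f \<longleftrightarrow> (\<forall>x\<in>J. \<exists>l u F. l < st x \<and> st x < u \<and> represents J f l u F)"
proof
  assume f: "fsmooth J f"
  show "\<forall>x\<in>J. \<exists>l u F. l < st x \<and> st x < u \<and> represents J f l u F"
  proof
    fix x assume "x \<in> J"
    with f obtain V d P p \<alpha> where "local_rep J f x V d P p \<alpha>" unfolding fsmooth_def by blast
    then show "\<exists>l u F. l < st x \<and> st x < u \<and> represents J f l u F" by (rule local_rep_represents) blast
  qed
next
  assume f: "\<forall>x\<in>J. \<exists>l u F. l < st x \<and> st x < u \<and> represents J f l u F"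
  show "fsmooth J f" unfolding fsmooth_def
  proof
    fix x assume "x \<in> J"
    with f obtain l u F where "l < st x" "st x < u" "represents J f l u F" by blast
    then show "\<exists>V d P p \<alpha>. local_rep J f x V d P p \<alpha>" by (intro represents_local_rep)
  qed
qed

text \<open>Any two local forms have congruent derivatives at x, so the choice in
  \<open>fr_deriv\<close> has exactly one candidate; that there is one comes from turning F back
  into a local representation.\<close>

lemma fr_deriv_represents:
  assumes J: "spans J A B" and F: "represents J f l u F" and x: "x \<in> J" "l < st x" "st x < u"
  shows "fr_deriv J f x = cls (\<lambda>t. dy F t (rep x t))"
proof -
  have uniq: "v = cls (\<lambda>t. dy F t (rep x t))"
    if lr: "local_rep J f x V d P p \<alpha>" and v: "v = ext_fun d (pdiff d \<alpha>) p x" for v V d P p \<alpha>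
  proof -
    obtain l' u' G where G: "l' < st x" "st x < u'" "represents J f l' u' G"
      "ext_fun d (pdiff d \<alpha>) p x = cls (\<lambda>t. dy G t (rep x t))"
      using local_rep_represents[OF lr] .
    then show ?thesis unfolding v
      using cls_eqI[OF represents_dy_unique[OF J G(3) F x(1) G(1,2) x(2,3)]] by simp
  qed
  obtain V d P p \<alpha> where lr: "local_rep J f x V d P p \<alpha>"
    using represents_local_rep[OF F x(2,3)] by blast
  show ?thesis unfolding fr_deriv_def
  proof (rule some_equality)
    show "\<exists>V d P p \<alpha>. local_rep J f x V d P p \<alpha> \<and> cls (\<lambda>t. dy F t (rep x t)) = ext_fun d (pdiff d \<alpha>) p x"
      by (intro exI conjI, rule lr, rule uniq[OF lr refl, symmetric])
  qed (elim exE conjE, rule uniq)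
qed


section \<open>Gluing local representations\<close>

text \<open>
  Terms with exponent above \<open>1\<close> are \<open>o(t)\<close> and not determined by \<open>f\<close>; they have to go before gluing.
\<close>

lemma represents_truncate:
  assumes F: "represents J f l u F" and Ec: "pcoeffs {l<..<u} F E c"
    and E': "finite E'" "\<And>q. q \<in> E' \<Longrightarrow> 0 \<le> q" "{q\<in>E. q \<le> 1} \<subseteq> E'" "\<And>q. q \<in> E' \<Longrightarrow> q \<le> 1"
  defines "c' \<equiv> \<lambda>q. if q \<in> E then c q else (\<lambda>_. 0)"
  shows "represents J f l u (\<lambda>t y. \<Sum>q\<in>E'. c' q y * pw t q)" "\<And>q. smooth_on {l<..<u} (c' q)"
proof -
  note Fc = pcoeffsD[OF Ec]
  show sm: "smooth_on {l<..<u} (c' q)" for q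
    unfolding c'_def by (cases "q \<in> E") (simp_all add: Fc(3) smooth_on_const)
  show "represents J f l u (\<lambda>t y. \<Sum>q\<in>E'. c' q y * pw t q)"
    unfolding represents_def
  proof (intro conjI ballI impI)
    show "power_family {l<..<u} (\<lambda>t y. \<Sum>q\<in>E'. c' q y * pw t q)"
      by (intro power_family_sum power_family_term open_greaterThanLessThan sm E'(2))
    fix y assume y: "y \<in> J" "l < st y \<and> st y < u"
    have y0: "rep y 0 \<in> {l<..<u}" using y(2) by (simp add: st_def)
    have "fsim (\<lambda>t. F t (rep y t)) (\<lambda>t. \<Sum>q\<in>E. c q (rep y t) * pw t q)"
      by (rule power_family_comp_coeffs[OF open_greaterThanLessThan rep_Ro y0 Ec])
    also have "fsim \<dots> (\<lambda>t. \<Sum>q\<in>E. if q \<le> 1 then c q (rep y t) * pw t q else 0)"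
    proof (rule fsim_sum)
      fix q assume q: "q \<in> E"
      show "fsim (\<lambda>t. c q (rep y t) * pw t q) (\<lambda>t. if q \<le> 1 then c q (rep y t) * pw t q else 0)"
      proof (cases "q \<le> 1")
        case False
        then have "(\<lambda>t. c q (rep y t) * pw t q) \<in> o[germ0](\<lambda>t. t)"
          by (intro smallo_bounded_mult pw_smallo_id Ro_bounded
              smooth_on_comp_Ro[OF Fc(3)[OF q] open_greaterThanLessThan rep_Ro y0]) simp
        with False show ?thesis unfolding fsim_iff by simp
      qed simp
    qed
    also have "(\<lambda>t. \<Sum>q\<in>E. if q \<le> 1 then c q (rep y t) * pw t q else 0) =
        (\<lambda>t. \<Sum>q\<in>E'. c' q (rep y t) * pw t q)"
    proof
      fix t
      have "(\<Sum>q\<in>E. if q \<le> 1 then c q (rep y t) * pw t q else 0) =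
          (\<Sum>q\<in>{q\<in>E. q \<le> 1}. c' q (rep y t) * pw t q)"
        by (rule sum.mono_neutral_cong_right) (use Fc(1) in \<open>auto simp: c'_def\<close>)
      also have "\<dots> = (\<Sum>q\<in>E'. c' q (rep y t) * pw t q)"
        by (rule sum.mono_neutral_left) (use E' in \<open>auto simp: c'_def\<close>)
      finally show "(\<Sum>q\<in>E. if q \<le> 1 then c q (rep y t) * pw t q else 0) =
        (\<Sum>q\<in>E'. c' q (rep y t) * pw t q)" .
    qed
    finally have "cls (\<lambda>t. F t (rep y t)) = cls (\<lambda>t. \<Sum>q\<in>E'. c' q (rep y t) * pw t q)"
      by (rule cls_eqI)
    then show "f y = cls (\<lambda>t. \<Sum>q\<in>E'. c' q (rep y t) * pw t q)"
      using representsD(2)[OF F y(1)] y(2) by simp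
  qed
qed

text \<open>Over a common exponent set the coefficients near b are determined by f, so switching
  from one family to the other at b keeps them smooth. Since b lies strictly between A and B, a
  whole neighbourhood of b consists of sampled real points.\<close>

lemma represents_glue:
  assumes J: "spans J A B" and F1: "represents J f l1 u1 F1" and F2: "represents J f l2 u2 F2"
    and b: "l1 < b" "l2 < b" "b < u1" "b < u2" "A < ereal b" "ereal b < B"
  shows "\<exists>F. represents J f l1 u2 F"
proof -
  obtain E1 c1 where E1: "pcoeffs {l1<..<u1} F1 E1 c1" using representsD(1)[OF F1] unfolding power_family_def by blast
  obtain E2 c2 where E2: "pcoeffs {l2<..<u2} F2 E2 c2" using representsD(1)[OF F2] unfolding power_family_def by blast
  define E where "E = {q\<in>E1\<union>E2. q \<le> 1}"
  have E: "finite E" "\<And>q. q \<in> E \<Longrightarrow> 0 \<le> q" "\<And>q. q \<in> E \<Longrightarrow> q \<le> 1"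
    "{q\<in>E1. q \<le> 1} \<subseteq> E" "{q\<in>E2. q \<le> 1} \<subseteq> E"
    using pcoeffsD(1,2)[OF E1] pcoeffsD(1,2)[OF E2] unfolding E_def by auto
  define d1 d2 where "d1 = (\<lambda>q. if q \<in> E1 then c1 q else (\<lambda>_. 0))" and "d2 = (\<lambda>q. if q \<in> E2 then c2 q else (\<lambda>_. 0))"
  define G1 G2 where "G1 = (\<lambda>t y. \<Sum>q\<in>E. d1 q y * pw t q)" and "G2 = (\<lambda>t y. \<Sum>q\<in>E. d2 q y * pw t q)"
  have G1: "represents J f l1 u1 G1" "\<And>q. smooth_on {l1<..<u1} (d1 q)"
    unfolding G1_def d1_def by (rule represents_truncate[OF F1 E1 E(1,2,4,3)]; assumption)+
  have G2: "represents J f l2 u2 G2" "\<And>q. smooth_on {l2<..<u2} (d2 q)"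
    unfolding G2_def d2_def by (rule represents_truncate[OF F2 E2 E(1,2,5,3)]; assumption)+
  define W where "W = core A B (max l1 l2) (min u1 u2)"
  have W: "open W" "b \<in> W" "W \<subseteq> {l1<..<u1}" "W \<subseteq> {l2<..<u2}"
    unfolding W_def by (rule open_core) (use b in \<open>auto simp: core_def\<close>)
  have agree: "d1 q y = d2 q y" if "q \<in> E" "y \<in> W" for q y
  proof -
    have "represents J f (max l1 l2) (min u1 u2) G1" "represents J f (max l1 l2) (min u1 u2) G2"
      by (rule represents_subset[OF G1(1)]; simp) (rule represents_subset[OF G2(1)]; simp)
    from represents_agree[OF J this that(2)[unfolded W_def]]
    have "(\<lambda>t. \<Sum>q\<in>E. (d1 q y - d2 q y) * pw t q) \<in> o[germ0](\<lambda>t. t)"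
      unfolding fsim_iff G1_def G2_def by (simp add: sum_subtractf left_diff_distrib)
    from pw_sum_smallo_imp_coeff_0[OF E(1,2) this that(1) E(3)[OF that(1)]] show ?thesis by simp
  qed
  \<comment> \<open>Near b either branch may be used, because \<open>d1\<close> and
    \<open>d2\<close> agree on \<open>W\<close>.\<close>
  define c where "c q y = (if y < b then d1 q y else d2 q y)" for q y
  define F where "F t y = (\<Sum>q\<in>E. c q y * pw t q)" for t y
  have cW: "c q y = d1 q y" if "q \<in> E" "y \<in> W" for q y
    unfolding c_def using agree[OF that] by simp
  have "smooth_on {l1<..<u2} (c q)" if q: "q \<in> E" for q
  proof (rule smooth_on_local)
    fix x assume x: "x \<in> {l1<..<u2}"
    have sm1: "smooth_on {l1<..<b} (d1 q)" by (rule smooth_on_subset[OF G1(2)]) (use b in auto)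
    have sm2: "smooth_on {b<..<u2} (d2 q)" by (rule smooth_on_subset[OF G2(2)]) (use b in auto)
    consider "x < b" | "x = b" | "x > b" by linarith
    then show "\<exists>W e. open W \<and> x \<in> W \<and> smooth_on W e \<and> (\<forall>y\<in>W. c q y = e y)"
    proof cases
      case 1
      then show ?thesis using x b sm1
        by (intro exI[of _ "{l1<..<b}"] exI[of _ "d1 q"] conjI) (auto simp: c_def)
    next
      case 2
      then show ?thesis using W smooth_on_subset[OF G1(2)[of q] W(3)] cW[OF q]
        by (intro exI[of _ W] exI[of _ "d1 q"] conjI) auto
    next
      case 3
      then show ?thesis using x b sm2
        by (intro exI[of _ "{b<..<u2}"] exI[of _ "d2 q"] conjI) (auto simp: c_def)
    qed
  qed
  then have pF: "power_family {l1<..<u2} F" by (intro power_familyI[OF E(1,2)]) (simp_all add: F_def)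
  have "f y = cls (\<lambda>t. F t (rep y t))" if y: "y \<in> J" "l1 < st y \<and> st y < u2" for y
  proof -
    have *: "f y = cls (\<lambda>t. F t (rep y t))"
      if "represents J f l u G" "open X" "st y \<in> X" "X \<subseteq> {l<..<u}" "\<And>t z. z \<in> X \<Longrightarrow> F t z = G t z" for l u G X
    proof -
      have "rep y 0 \<in> X" using that(3) unfolding st_def .
      have "fsim (\<lambda>t. F t (rep y t)) (\<lambda>t. G t (rep y t))"
        by (rule fsim_eventually_eq, rule eventually_mono[OF Ro_eventually_in[OF rep_Ro that(2) \<open>rep y 0 \<in> X\<close>]],
            rule that(5))
      moreover have "f y = cls (\<lambda>t. G t (rep y t))"
        using representsD(2)[OF that(1) y(1)] that(3,4) by auto
      ultimately show ?thesis using cls_eqI by simp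
    qed
    consider "st y < b" | "st y = b" | "st y > b" by linarith
    then show ?thesis
    proof cases
      case 1
      show ?thesis
        by (rule *[OF G1(1), of "{l1<..<b}"]) (use 1 y b in \<open>auto simp: F_def G1_def c_def\<close>)
    next
      case 2
      show ?thesis
        by (rule *[OF G1(1) W(1) _ W(3)]) (use 2 W(2) in \<open>simp_all add: F_def G1_def cW\<close>)
    next
      case 3
      show ?thesis
        by (rule *[OF G2(1), of "{b<..<u2}"]) (use 3 y b in \<open>auto simp: F_def G2_def c_def\<close>)
    qed
  qed
  with pF show ?thesis unfolding represents_def by blast
qed

text \<open>Bisection on the compact interval from \<open>st x\<close> to \<open>st y\<close>: every
  standard part in it has a window, and adjacent windows are glued at their common point.\<close>

lemma represents_between:
  assumes J: "spans J A B" and f: "fsmooth J f" and xy: "x \<in> J" "y \<in> J" "st x \<le> st y"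
  shows "\<exists>l u F. l < st x \<and> st y < u \<and> represents J f l u F"
proof -
  define p q where "p = st x" and "q = st y"
  \<comment> \<open>The joining step ranges over arbitrary points; the guard confines them to
    [p, q], where gluing is possible.\<close>
  define S where "S a b \<longleftrightarrow> (p \<le> a \<and> b \<le> q \<longrightarrow> (\<exists>l u F. l < a \<and> b < u \<and> represents J f l u F))" for a b
  have "S p q" using xy(3)[folded p_def q_def]
  proof (induction rule: Bolzano)
    case (trans a b c)
    note trans = trans[unfolded S_def]
    have "p \<le> a \<and> c \<le> q \<longrightarrow> (\<exists>l u F. l < a \<and> c < u \<and> represents J f l u F)"
    \<comment> \<open>In the degenerate case one of the two windows suffices; otherwise b lies
      strictly between p and q, hence between A and B.\<close>
    proof (cases "a = b \<or> b = c")
      case True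
      then show ?thesis using trans by blast
    next
      case False
      show ?thesis
      proof
        assume ac: "p \<le> a \<and> c \<le> q"
        have ab: "a < b" "b < c" using False trans by simp_all
        obtain l1 u1 F1 where 1: "l1 < a" "b < u1" "represents J f l1 u1 F1"
          using trans ac ab by force
        obtain l2 u2 F2 where 2: "l2 < b" "c < u2" "represents J f l2 u2 F2"
          using trans ac ab by force
        have "A \<le> ereal (st x)" "ereal (st x) < ereal b" "ereal b < ereal (st y)" "ereal (st y) \<le> B"
          using J xy ab ac unfolding spans_def p_def q_def by auto
        then have "A < ereal b" "ereal b < B" by (blast intro: le_less_trans less_le_trans)+
        then have "\<exists>F. represents J f l1 u2 F"
          using 1 2 ab by (intro represents_glue[OF J 1(3) 2(3)]) simp_all
        then show "\<exists>l u F. l < a \<and> c < u \<and> represents J f l u F" using 1(1) 2(2) by blast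
      qed
    qed
    then show ?case unfolding S_def .
  next
    case (local r)
    \<comment> \<open>At r = p or r = q the real number r may be missing from J, but x or y has that
      standard part.\<close>
    have "\<exists>z\<in>J. st z = r"
    proof (cases "r = p \<or> r = q")
      case True
      then show ?thesis using xy unfolding p_def q_def by blast
    next
      case False
      have "A \<le> ereal (st x)" "ereal (st x) < ereal r" "ereal r < ereal (st y)" "ereal (st y) \<le> B"
        using J xy local False unfolding spans_def p_def q_def by auto
      then have "A < ereal r" "ereal r < B" by (blast intro: le_less_trans less_le_trans)+
      then have "cls (\<lambda>t. r) \<in> J" using J unfolding spans_def by blast
      then show ?thesis using st_cls[OF Ro_const] by blast
    qed
    then obtain z where z: "z \<in> J" "st z = r" by blast
    then obtain l u F where F: "l < r" "r < u" "represents J f l u F"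
      using f unfolding fsmooth_iff_represents by blast
    define d where "d = min (r - l) (u - r)"
    have "d > 0" using F by (simp add: d_def)
    moreover have "l < a \<and> b < u" if "a \<le> r \<and> r \<le> b \<and> b - a < d" for a b
      using that by (simp add: d_def)
    ultimately show ?case unfolding S_def using F(3) by blast
  qed
  then show ?thesis unfolding S_def p_def q_def by simp
qed

lemma represents_containing:
  assumes J: "spans J A B" and f: "fsmooth J f" and xy: "x \<in> J" "y \<in> J"
  obtains l u F where "l < st x" "st x < u" "l < st y" "st y < u" "represents J f l u F"
proof (cases "st x \<le> st y")
  case True
  obtain l u F where "l < st x" "st y < u" "represents J f l u F" using represents_between[OF J f xy True] by blast
  with True show ?thesis by (intro that[of l u F]) simp_all
next
  case False
  then have le: "st y \<le> st x" by simp
  obtain l u F where "l < st y" "st x < u" "represents J f l u F" using represents_between[OF J f xy(2,1) le] by blast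
  with le show ?thesis by (intro that[of l u F]) simp_all
qed


section \<open>The integral\<close>

definition primitive_rep :: "fermat set \<Rightarrow> (fermat \<Rightarrow> fermat) \<Rightarrow> real \<Rightarrow> real \<Rightarrow> (real \<Rightarrow> real \<Rightarrow> real) \<Rightarrow> bool" where
  "primitive_rep J f l u \<Phi> \<longleftrightarrow> power_family {l<..<u} \<Phi> \<and> represents J f l u (dy \<Phi>)"

lemma primitive_rep_subset:
  assumes "primitive_rep J f l u \<Phi>" "l \<le> l'" "u' \<le> u" shows "primitive_rep J f l' u' \<Phi>"
proof -
  have "{l'<..<u'} \<subseteq> {l<..<u}" using assms(2,3) by auto
  then show ?thesis
    using assms(1) power_family_subset[of "{l<..<u}" \<Phi> "{l'<..<u'}"] represents_subset[OF _ assms(2,3)]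
    unfolding primitive_rep_def by simp
qed

lemma represents_primitive_rep:
  assumes F: "represents J f l u F"
  obtains \<Phi> where "primitive_rep J f l u \<Phi>" "\<And>t y. y \<in> {l<..<u} \<Longrightarrow> dy \<Phi> t y = F t y"
proof -
  obtain \<Phi> where \<Phi>: "power_family {l<..<u} \<Phi>" "\<And>t y. y \<in> {l<..<u} \<Longrightarrow> dy \<Phi> t y = F t y"
    using power_family_antiderivative[OF representsD(1)[OF F]] by blast
  have "primitive_rep J f l u \<Phi>" unfolding primitive_rep_def using \<Phi>(1) represents_cong[OF F \<Phi>(2)] by blast
  then show ?thesis by (rule that[OF _ \<Phi>(2)])
qed

lemma primitive_rep_containing:
  assumes J: "spans J A B" and f: "fsmooth J f" and xy: "x \<in> J" "y \<in> J"
  obtains l u \<Phi> where "l < st x" "st x < u" "l < st y" "st y < u" "primitive_rep J f l u \<Phi>"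
proof -
  obtain l u F where F: "l < st x" "st x < u" "l < st y" "st y < u" "represents J f l u F"
    using represents_containing[OF J f xy] .
  obtain \<Phi> where "primitive_rep J f l u \<Phi>" using represents_primitive_rep[OF F(5)] .
  with F show ?thesis by (intro that[of l u \<Phi>])
qed

text \<open>The y-derivative of \<Phi> - \<Psi> is o(t) at the real points of the window, so \<Phi>
  - \<Psi> has the same value at a and at b modulo o(t). Increments are compared because a primitive
  is fixed only up to a function of t.\<close>

lemma primitive_rep_unique:
  assumes J: "spans J A B" and \<Phi>: "primitive_rep J f l u \<Phi>" and \<Psi>: "primitive_rep J f l' u' \<Psi>"
    and a: "a \<in> J" "l < st a" "st a < u" "l' < st a" "st a < u'"
    and b: "b \<in> J" "l < st b" "st b < u" "l' < st b" "st b < u'"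
  shows "fsim (\<lambda>t. \<Phi> t (rep b t) - \<Phi> t (rep a t)) (\<lambda>t. \<Psi> t (rep b t) - \<Psi> t (rep a t))"
proof -
  define L U where "L = max l l'" and "U = min u u'"
  let ?V = "{L<..<U}"
  have ab: "L < st a" "st a < U" "L < st b" "st b < U" using a b by (simp_all add: L_def U_def)
  have P: "primitive_rep J f L U \<Phi>" "primitive_rep J f L U \<Psi>"
    by (rule primitive_rep_subset[OF \<Phi>]; simp add: L_def U_def) (rule primitive_rep_subset[OF \<Psi>]; simp add: L_def U_def)
  then have p: "power_family ?V \<Phi>" "power_family ?V \<Psi>" "represents J f L U (dy \<Phi>)" "represents J f L U (dy \<Psi>)"
    unfolding primitive_rep_def by blast+
  have van: "fsim (\<lambda>t. dy (\<lambda>t y. \<Phi> t y - \<Psi> t y) t y) (\<lambda>t. 0)" if y: "y \<in> core A B L U" for y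
  proof -
    have eq: "dy (\<lambda>t y. \<Phi> t y - \<Psi> t y) t y = dy \<Phi> t y - dy \<Psi> t y" for t
      by (rule dy_diff[OF p(1,2) open_greaterThanLessThan subsetD[OF core_subset y]])
    show ?thesis unfolding eq using represents_agree[OF J p(3,4) y] by (simp add: fsim_iff)
  qed
  have "fsim (\<lambda>t. \<Phi> t (rep b t) - \<Psi> t (rep b t)) (\<lambda>t. \<Phi> t (rep a t) - \<Psi> t (rep a t))"
    by (rule power_family_dy_vanishing[OF power_family_diff[OF open_greaterThanLessThan p(1,2)] open_greaterThanLessThan
          open_core convex_core core_subset van rep_Ro _ spans_closure_core[OF J b(1) ab(3,4)]
          rep_Ro _ spans_closure_core[OF J a(1) ab(1,2)]])
       (use ab in \<open>simp_all add: st_def\<close>)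
  then show ?thesis unfolding fsim_iff by (simp add: algebra_simps)
qed

text \<open>Serves the constant of integration: a little-oh polynomial is exchanged for an exact
  power sum, so that subtracting it stays within power families.\<close>

lemma power_family_param_of_Ro:
  assumes "k \<in> Ro" obtains X where "\<And>V. power_family V (\<lambda>t y. X t)" "fsim k X"
proof -
  obtain X where "power_family UNIV (\<lambda>t y. X t)" "fsim k X" using assms by (elim RoE)
  then show ?thesis using that[of X] power_family_param by blast
qed

text \<open>Existence: one window need not cover J, so the candidate is defined point by point from
  a window reaching from u to x, and \<open>primitive_rep_unique\<close> makes it independent of the
  window. Uniqueness: the local form of a competitor is itself a primitive of a local form of f, so
  its increment from u is the value of the candidate.\<close>

lemma fintegral_primitive_rep:
  assumes J: "spans J A B" and f: "fsmooth J f" and u: "u \<in> J" and v: "v \<in> J"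
    and \<Phi>: "primitive_rep J f l r \<Phi>" "l < st u" "st u < r" "l < st v" "st v < r"
  shows "fintegral J f u v = cls (\<lambda>t. \<Phi> t (rep v t) - \<Phi> t (rep u t))"
proof -
  let ?P = "\<lambda>I. fsmooth J I \<and> I u = 0 \<and> (\<forall>x\<in>J. fr_deriv J I x = f x) \<and> (\<forall>x. x \<notin> J \<longrightarrow> I x = 0)"
  have "\<exists>w. \<forall>l r \<Phi>. primitive_rep J f l r \<Phi> \<and> l < st u \<and> st u < r \<and> l < st x \<and> st x < r \<longrightarrow>
      w = cls (\<lambda>t. \<Phi> t (rep x t) - \<Phi> t (rep u t))" if x: "x \<in> J" for x
  proof -
    obtain l r \<Phi> where \<Phi>: "l < st u" "st u < r" "l < st x" "st x < r" "primitive_rep J f l r \<Phi>"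
      using primitive_rep_containing[OF J f u x] .
    show ?thesis
      by (intro exI[of _ "cls (\<lambda>t. \<Phi> t (rep x t) - \<Phi> t (rep u t))"] allI impI)
         (elim conjE, rule cls_eqI, rule primitive_rep_unique[OF J \<Phi>(5) _ u \<Phi>(1,2) _ _ x \<Phi>(3,4)], assumption+)
  qed
  then obtain I0 where I0: "\<And>x l r \<Phi>. x \<in> J \<Longrightarrow> primitive_rep J f l r \<Phi> \<Longrightarrow> l < st u \<Longrightarrow> st u < r \<Longrightarrow>
      l < st x \<Longrightarrow> st x < r \<Longrightarrow> I0 x = cls (\<lambda>t. \<Phi> t (rep x t) - \<Phi> t (rep u t))"
    by metis
  define I where "I x = (if x \<in> J then I0 x else 0)" for x
  have I: "I x = cls (\<lambda>t. \<Phi> t (rep x t) - \<Phi> t (rep u t))"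
    if "x \<in> J" "primitive_rep J f l r \<Phi>" "l < st u" "st u < r" "l < st x" "st x < r" for x l r \<Phi>
    unfolding I_def using I0[OF that] that(1) by simp
  have loc: "\<exists>l r \<Psi>. l < st x \<and> st x < r \<and> represents J I l r \<Psi> \<and> f x = cls (\<lambda>t. dy \<Psi> t (rep x t))"
    if x: "x \<in> J" for x
  proof -
    obtain l r \<Phi> where \<Phi>: "l < st u" "st u < r" "l < st x" "st x < r" "primitive_rep J f l r \<Phi>"
      using primitive_rep_containing[OF J f u x] .
    have p: "power_family {l<..<r} \<Phi>" "represents J f l r (dy \<Phi>)" using \<Phi>(5) unfolding primitive_rep_def by blast+
    \<comment> \<open>The value at the base point u enters as a function of t alone, so it changes
      \<open>\<Phi>\<close> but not its y-derivative.\<close>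
    obtain X where X: "\<And>V. power_family V (\<lambda>t y. X t)" "fsim (\<lambda>t. \<Phi> t (rep u t)) X"
      using power_family_param_of_Ro[OF represents_comp_Ro[OF p(1) \<Phi>(1,2)]] by blast
    define \<Psi> where "\<Psi> t y = \<Phi> t y - X t" for t y
    have \<Psi>: "power_family {l<..<r} \<Psi>" unfolding \<Psi>_def by (intro power_family_diff open_greaterThanLessThan p(1) X(1))
    have dy\<Psi>: "dy \<Psi> t y = dy \<Phi> t y" if "y \<in> {l<..<r}" for t y
    proof -
      have "((\<lambda>y. \<Phi> t y - X t) has_real_derivative dy \<Phi> t y - 0) (at y)"
        by (intro DERIV_diff DERIV_const power_family_DERIV[OF p(1) open_greaterThanLessThan that])
      then have "(\<Psi> t has_real_derivative dy \<Phi> t y) (at y)" unfolding \<Psi>_def[abs_def] by simp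
      then show ?thesis unfolding dy_def[of \<Psi>] by (rule DERIV_imp_deriv)
    qed
    have "represents J I l r \<Psi>" unfolding represents_def
    proof (intro conjI ballI impI \<Psi>)
      fix y assume y: "y \<in> J" "l < st y \<and> st y < r"
      show "I y = cls (\<lambda>t. \<Psi> t (rep y t))"
        unfolding I[OF y(1) \<Phi>(5,1,2) conjunct1[OF y(2)] conjunct2[OF y(2)]] \<Psi>_def
        by (intro cls_eqI fsim_diff fsim_refl X(2))
    qed
    moreover have "f x = cls (\<lambda>t. dy \<Psi> t (rep x t))"
      by (rule representsD(2)[OF represents_cong[OF p(2) dy\<Psi>] x \<Phi>(3,4)])
    ultimately show ?thesis using \<Phi>(3,4) by blast
  qed
  have "?P I"
  proof (intro conjI ballI allI impI)
    show "fsmooth J I" unfolding fsmooth_iff_represents using loc by blast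
    obtain l r \<Phi> where \<Phi>: "l < st u" "st u < r" "primitive_rep J f l r \<Phi>"
      using primitive_rep_containing[OF J f u u] by blast
    show "I u = 0" unfolding I[OF u \<Phi>(3,1,2,1,2)] zero_fermat_def by simp
    show "fr_deriv J I x = f x" if x: "x \<in> J" for x
    proof -
      obtain l r \<Psi> where *: "l < st x" "st x < r" "represents J I l r \<Psi>" "f x = cls (\<lambda>t. dy \<Psi> t (rep x t))"
        using loc[OF x] by blast
      show ?thesis unfolding fr_deriv_represents[OF J *(3) x *(1,2)] *(4) ..
    qed
    show "I x = 0" if "x \<notin> J" for x using that unfolding I_def by simp
  qed
  moreover have "I' = I" if I': "?P I'" for I'
  proof
    fix x
    show "I' x = I x"
    proof (cases "x \<in> J")
      case False
      then show ?thesis using I' unfolding I_def by simp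
    next
      case x: True
      \<comment> \<open>The window contains u as well as x, which links the value at x with the
        condition \<open>I' u = 0\<close>.\<close>
      obtain l r F where F: "l < st u" "st u < r" "l < st x" "st x < r" "represents J I' l r F"
        using represents_containing[OF J conjunct1[OF I'] u x] .
      have pF: "power_family {l<..<r} F" by (rule representsD(1)[OF F(5)])
      have "represents J f l r (dy F)" unfolding represents_def
      proof (intro conjI ballI impI power_family_dy pF open_greaterThanLessThan)
        fix y assume y: "y \<in> J" "l < st y \<and> st y < r"
        have "fr_deriv J I' y = f y" using I' y(1) by blast
        then show "f y = cls (\<lambda>t. dy F t (rep y t))"
          using fr_deriv_represents[OF J F(5) y(1)] y(2) by simp
      qed
      then have "primitive_rep J f l r F" unfolding primitive_rep_def using pF by blast
      from I[OF x this F(1-4)] have Ix: "I x = cls (\<lambda>t. F t (rep x t) - F t (rep u t))" .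
      have "cls (\<lambda>t. F t (rep u t)) = cls (\<lambda>t. 0)"
        using representsD(2)[OF F(5) u F(1,2)] I' unfolding zero_fermat_def by simp
      then have "fsim (\<lambda>t. F t (rep u t)) (\<lambda>t. 0)"
        by (rule cls_eqD[OF _ represents_comp_Ro[OF pF F(1,2)] Ro_const])
      then have "fsim (\<lambda>t. F t (rep x t) - F t (rep u t)) (\<lambda>t. F t (rep x t) - 0)"
        by (intro fsim_diff fsim_refl)
      then show ?thesis unfolding Ix representsD(2)[OF F(5) x F(3,4)] by (simp add: cls_eqI)
    qed
  qed
  ultimately have "(THE I. ?P I) = I" by (rule the_equality)
  then show ?thesis unfolding fintegral_def using I[OF v \<Phi>] by simp
qed


section \<open>The Cauchy--Schwarz inequality\<close>

text \<open>The quadratic form in k and m is the increment of an antiderivative of a square, hence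
  nonnegative; stated with antiderivatives, since power families supply these directly.\<close>

lemma antiderivative_Cauchy_Schwarz:
  fixes f g P Q R :: "real \<Rightarrow> real"
  assumes ab: "a \<le> b"
    and P: "\<And>y. y \<in> {a..b} \<Longrightarrow> (P has_real_derivative f y * g y) (at y)"
    and Q: "\<And>y. y \<in> {a..b} \<Longrightarrow> (Q has_real_derivative f y * f y) (at y)"
    and R: "\<And>y. y \<in> {a..b} \<Longrightarrow> (R has_real_derivative g y * g y) (at y)"
  shows "(P b - P a) * (P b - P a) \<le> (Q b - Q a) * (R b - R a)"
proof -
  define p q r where "p = P b - P a" and "q = Q b - Q a" and "r = R b - R a"
  have quad: "0 \<le> k * k * q + 2 * k * m * p + m * m * r" for k m
  proof -
    define H where "H y = k * k * Q y + 2 * k * m * P y + m * m * R y" for y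
    have "H a \<le> H b"
    proof (rule DERIV_nonneg_imp_nondecreasing[OF ab])
      fix y assume "a \<le> y" "y \<le> b"
      then have y: "y \<in> {a..b}" by simp
      have "(H has_real_derivative k * k * (f y * f y) + 2 * k * m * (f y * g y) + m * m * (g y * g y)) (at y)"
        unfolding H_def[abs_def] by (intro DERIV_add DERIV_cmult P Q R y)
      moreover have "k * k * (f y * f y) + 2 * k * m * (f y * g y) + m * m * (g y * g y) =
          (k * f y + m * g y) * (k * f y + m * g y)" by algebra
      ultimately show "\<exists>D. (H has_real_derivative D) (at y) \<and> 0 \<le> D"
        using zero_le_square by metis
    qed
    then show ?thesis unfolding H_def p_def q_def r_def by (simp add: algebra_simps)
  qed
  have q: "0 \<le> q" and r: "0 \<le> r" using quad[of 1 0] quad[of 0 1] by simp_all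
  \<comment> \<open>The pairs (r, -p) and (-p, q) turn the form into r or q times the determinant q
    r - p^2. If q = r = 0, the pair (1, -p) gives -2 p^2 \<ge> 0.\<close>
  have 1: "0 \<le> r * (q * r - p * p)" using quad[of r "- p"] by (simp add: algebra_simps)
  have 2: "0 \<le> q * (q * r - p * p)" using quad[of "- p" q] by (simp add: algebra_simps)
  consider "r > 0" | "q > 0" | "q = 0" "r = 0" using q r by linarith
  then have "p * p \<le> q * r"
  proof cases
    case 3
    then show ?thesis using quad[of 1 "- p"] by simp
  qed (use 1 2 in \<open>simp_all add: zero_le_mult_iff\<close>)
  then show ?thesis unfolding p_def q_def r_def .
qed

lemma fsmooth_mult:
  assumes "fsmooth J f" "fsmooth J g" shows "fsmooth J (\<lambda>x. f x * g x)"
  unfolding fsmooth_iff_represents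
proof
  fix x assume x: "x \<in> J"
  obtain l u F where F: "l < st x" "st x < u" "represents J f l u F"
    using assms(1) x unfolding fsmooth_iff_represents by blast
  obtain l' u' G where G: "l' < st x" "st x < u'" "represents J g l' u' G"
    using assms(2) x unfolding fsmooth_iff_represents by blast
  have "represents J (\<lambda>x. f x * g x) (max l l') (min u u') (\<lambda>t y. F t y * G t y)"
    by (rule represents_mult[OF represents_subset[OF F(3)] represents_subset[OF G(3)]]) simp_all
  moreover have "max l l' < st x" "st x < min u u'" using F G by simp_all
  ultimately show "\<exists>l u F. l < st x \<and> st x < u \<and> represents J (\<lambda>x. f x * g x) l u F" by blast
qed

theorem theorem31:
  fixes J :: "fermat set" and f g :: "fermat \<Rightarrow> fermat" and a b :: fermat
  assumes "noninf_interval J"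
    and "fsmooth J f" and "fsmooth J g"
    and "a \<in> J" and "b \<in> J" and "a < b"
  shows "(fintegral J (\<lambda>x. f x * g x) a b) ^ 2
           \<le> fintegral J (\<lambda>x. (f x) ^ 2) a b * fintegral J (\<lambda>x. (g x) ^ 2) a b"
proof -
  obtain A B where J: "spans J A B" using noninf_interval_spans[OF assms(1)] .
  note f = assms(2) and g = assms(3) and a = assms(4) and b = assms(5)
  obtain l1 u1 F where F: "l1 < st a" "st a < u1" "l1 < st b" "st b < u1" "represents J f l1 u1 F"
    using represents_containing[OF J f a b] .
  obtain l2 u2 G where G: "l2 < st a" "st a < u2" "l2 < st b" "st b < u2" "represents J g l2 u2 G"
    using represents_containing[OF J g a b] .
  define l u where "l = max l1 l2" and "u = min u1 u2"
  let ?V = "{l<..<u}"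
  have lu: "l < st a" "st a < u" "l < st b" "st b < u" using F G by (simp_all add: l_def u_def)
  have FG: "represents J f l u F" "represents J g l u G"
    by (rule represents_subset[OF F(5)]; simp add: l_def u_def) (rule represents_subset[OF G(5)]; simp add: l_def u_def)
  obtain P where P: "primitive_rep J (\<lambda>x. f x * g x) l u P" "\<And>t y. y \<in> ?V \<Longrightarrow> dy P t y = F t y * G t y"
    using represents_primitive_rep[OF represents_mult[OF FG]] by blast
  obtain Q where Q: "primitive_rep J (\<lambda>x. f x * f x) l u Q" "\<And>t y. y \<in> ?V \<Longrightarrow> dy Q t y = F t y * F t y"
    using represents_primitive_rep[OF represents_mult[OF FG(1) FG(1)]] by blast
  obtain R where R: "primitive_rep J (\<lambda>x. g x * g x) l u R" "\<And>t y. y \<in> ?V \<Longrightarrow> dy R t y = G t y * G t y"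
    using represents_primitive_rep[OF represents_mult[OF FG(2) FG(2)]] by blast
  have pf: "power_family ?V P" "power_family ?V Q" "power_family ?V R" using P(1) Q(1) R(1) unfolding primitive_rep_def by blast+
  have "a \<le> b" using assms(6) unfolding less_fermat_def by blast
  then obtain xr yr z where *: "xr \<in> Rep_fermat a" "yr \<in> Rep_fermat b" "fsim z (\<lambda>t. 0)"
    and ex: "\<exists>\<delta>>0. \<forall>t. 0 \<le> t \<and> t < \<delta> \<longrightarrow> xr t \<le> yr t + z t"
    unfolding less_eq_fermat_def by blast
  have le: "eventually (\<lambda>t. xr t \<le> yr t + z t) germ0" using ex unfolding eventually_germ0 .
  \<comment> \<open>Absorbing \<open>z\<close> into the representative of b gives
    \<open>xr t \<le> \<beta> t\<close> for every small t.\<close>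
  define \<beta> where "\<beta> t = yr t + z t" for t
  have xr: "xr \<in> Ro" "fsim (rep a) xr" using *(1) unfolding in_Rep_fermat_iff by blast+
  have yr: "yr \<in> Ro" "fsim (rep b) yr" using *(2) unfolding in_Rep_fermat_iff by blast+
  have \<beta>: "fsim \<beta> (rep b)"
    using fsim_trans[OF fsim_add[OF fsim_refl[of yr] *(3)], of "rep b"] fsim_sym[OF yr(2)]
    unfolding \<beta>_def by simp
  have \<alpha>: "fsim xr (rep a)" by (rule fsim_sym[OF xr(2)])
  have \<beta>Ro: "\<beta> \<in> Ro" by (rule Ro_cong[OF rep_Ro \<beta>])
  have at0: "rep a 0 \<in> ?V" "rep b 0 \<in> ?V" "xr 0 \<in> ?V" "\<beta> 0 \<in> ?V"
    using lu fsim_at_0[OF \<alpha>] fsim_at_0[OF \<beta>] unfolding st_def by auto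
  \<comment> \<open>The increment may be computed with any representatives of the end points;
    \<open>xr\<close> and \<open>\<beta>\<close> replace \<open>rep a\<close> and
    \<open>rep b\<close>, which need not be ordered.\<close>
  have int: "fintegral J h a b = cls (\<lambda>t. H t (\<beta> t) - H t (xr t))"
      and HRo: "(\<lambda>t. H t (\<beta> t) - H t (xr t)) \<in> Ro"
    if h: "fsmooth J h" and H: "primitive_rep J h l u H" for h H
  proof -
    have pH: "power_family ?V H" using H unfolding primitive_rep_def by blast
    note V = open_greaterThanLessThan[of l u]
    have "fsim (\<lambda>t. H t (\<beta> t) - H t (xr t)) (\<lambda>t. H t (rep b t) - H t (rep a t))"
      by (intro fsim_diff power_family_comp_fsim[OF pH V rep_Ro at0(2) \<beta>] power_family_comp_fsim[OF pH V rep_Ro at0(1) \<alpha>])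
    from cls_eqI[OF this]
    show "fintegral J h a b = cls (\<lambda>t. H t (\<beta> t) - H t (xr t))"
      unfolding fintegral_primitive_rep[OF J h a b H lu] by simp
    show "(\<lambda>t. H t (\<beta> t) - H t (xr t)) \<in> Ro"
      by (intro Ro_diff power_family_comp_Ro[OF pH V \<beta>Ro at0(4)] power_family_comp_Ro[OF pH V xr(1) at0(3)])
  qed
  note iP = int[OF fsmooth_mult[OF f g] P(1)] HRo[OF fsmooth_mult[OF f g] P(1)]
  note iQ = int[OF fsmooth_mult[OF f f] Q(1)] HRo[OF fsmooth_mult[OF f f] Q(1)]
  note iR = int[OF fsmooth_mult[OF g g] R(1)] HRo[OF fsmooth_mult[OF g g] R(1)]
  have "eventually (\<lambda>t. xr t \<in> ?V) germ0" "eventually (\<lambda>t. \<beta> t \<in> ?V) germ0"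
    by (rule Ro_eventually_in[OF xr(1) open_greaterThanLessThan at0(3)],
        rule Ro_eventually_in[OF \<beta>Ro open_greaterThanLessThan at0(4)])
  with le have "eventually (\<lambda>t. (P t (\<beta> t) - P t (xr t)) * (P t (\<beta> t) - P t (xr t))
      \<le> (Q t (\<beta> t) - Q t (xr t)) * (R t (\<beta> t) - R t (xr t))) germ0"
  proof eventually_elim
    case (elim t)
    \<comment> \<open>An interval containing both ends contains the segment between them.\<close>
    have sub: "y \<in> ?V" if "y \<in> {xr t..\<beta> t}" for y using elim(2,3) that by auto
    note D = power_family_DERIV[OF _ open_greaterThanLessThan sub, of _ _ t]
    show ?case
    proof (rule antiderivative_Cauchy_Schwarz[where f = "F t" and g = "G t"])
      show "xr t \<le> \<beta> t" using elim(1) unfolding \<beta>_def .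
      fix y assume y: "y \<in> {xr t..\<beta> t}"
      show "(P t has_real_derivative F t y * G t y) (at y)" using D[OF pf(1) y] P(2)[OF sub[OF y]] by simp
      show "(Q t has_real_derivative F t y * F t y) (at y)" using D[OF pf(2) y] Q(2)[OF sub[OF y]] by simp
      show "(R t has_real_derivative G t y * G t y) (at y)" using D[OF pf(3) y] R(2)[OF sub[OF y]] by simp
    qed
  qed
  from cls_leI[OF Ro_mult[OF iP(2) iP(2)] Ro_mult[OF iQ(2) iR(2)] this]
  show ?thesis
    unfolding power2_fermat iP(1) iQ(1) iR(1) cls_mult[OF iP(2) iP(2)] cls_mult[OF iQ(2) iR(2)] .
qed

end
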